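(* Let $\Gamma=\langle v_0,v_1,\ldots,v_g\rangle$ be the semigroup of values of a plane branch and let $\varphi\in\Sigma_\Gamma$. Then either $\varphi\sim_{\mathcal A}(t^{v_0},t^{v_1})$, or $\Lambda_\varphi\setminus\Gamma\neq\emptyset$ and $\varphi$ is $\mathcal A$-equivalent to a parametrization of the form $$\Big(t^{v_0},\ t^{v_1}+t^{\lambda}+\sum_{i>\lambda,\ i+v_0\notin\Lambda}a_it^i\Big),\qquad (\ast)$$ where $\lambda$ is the Zariski invariant of $\varphi$ and $\Lambda=\Lambda_\varphi$ (the sum is finite). Moreover, if $\varphi$ and $\varphi'$ are two parametrizations of the form $(\ast)$ (with coefficients $a_i$, resp. $a_i'$) having the same semigroup of values $\Gamma$ and the same set of values of differentials $\Lambda$ (hence the same $\lambda$), then $\varphi\sim_{\mathcal A}\varphi'$ if and only if there exists $r\in\mathbb C^*$ with $r^{\lambda-v_1}=1$ and $a_i=r^{\,i-v_1}a_i'$ for all $i$.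
   Context: $\mathcal O_1=\mathbb C\{t\}$ and $\mathcal O_2=\mathbb C\{X,Y\}$ denote the rings of convergent power series, with maximal ideals $\mathcal M_1,\mathcal M_2$. A parametrization is a pair $\varphi(t)=(x(t),y(t))$ with $x,y\in\mathcal M_1$ not both zero; it is primitive if it is not of the form $\psi(t^m)$ with $\psi$ a parametrization and $m\ge 2$. Two parametrizations are $\mathcal A$-equivalent, $\varphi_1\sim_{\mathcal A}\varphi_2$, if $\varphi_2=\sigma\circ\varphi_1\circ\rho^{-1}$ for germs of analytic automorphisms $\sigma$ of $(\mathbb C^2,0)$ and $\rho$ of $(\mathbb C,0)$. For $h\in\mathcal O_2$, $\varphi^*(h)=h(x(t),y(t))$; for a differential $\omega=h\,dX+g\,dY$ ($g,h\in\mathcal O_2$), $\varphi^*(\omega)=\varphi^*(h)x'(t)+\varphi^*(g)y'(t)$. For primitive $\varphi$: $v_\varphi(h)=\mathrm{ord}_t\varphi^*(h)$, $v_\varphi(\omega)=\mathrm{ord}_t\varphi^*(\omega)+1$; the semigroup of values is $\Gamma_\varphi=\{v_\varphi(h):h\in\mathcal O_2,\varphi^*(h)\ne0\}$, with minimal generators $v_0<v_1<\dots<v_g$ and conductor $c$ (least integer with $l\in\Gamma_\varphi$ for all $l\ge c$); the set of values of differentials is $\Lambda_\varphi=\{v_\varphi(\omega):\omega=h\,dX+g\,dY,\ \varphi^*(\omega)\neq0\}$. A Puiseux parametrization is a primitive parametrization $(t^{v_0},\sum_{i\ge v_1}a_it^i)$ with $a_{v_1}=1$, $v_0<v_1$,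 $v_0\nmid v_1$ (then $v_0,v_1$ are the two smallest generators of its semigroup). For a semigroup $\Gamma$ with smallest generators $v_0<v_1$ and conductor $c$, $\Sigma_\Gamma$ is the set of Puiseux parametrizations $(t^{v_0},t^{v_1}+\sum_{v_1<i<c}a_it^i)$ whose semigroup of values is $\Gamma$. If $\Lambda_\varphi\setminus\Gamma_\varphi\ne\emptyset$, the Zariski invariant of $\varphi$ is $\lambda=\min(\Lambda_\varphi\setminus\Gamma_\varphi)-v_0$. *)

theory Defs
  imports "HOL-Analysis.Analysis"
begin

text \<open>Germs in O1 = C{t}: functions complex => complex analytic at 0.
  Germs in O2 = C{X,Y}: functions on complex x complex given near 0 by a
  convergent double power series.\<close>

definition analytic1 :: "(complex \<Rightarrow> complex) \<Rightarrow> bool" where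
  "analytic1 f \<longleftrightarrow> f analytic_on {0}"

definition analytic2 :: "(complex \<times> complex \<Rightarrow> complex) \<Rightarrow> bool" where
  "analytic2 h \<longleftrightarrow> (\<exists>r>0. \<exists>c :: nat \<Rightarrow> nat \<Rightarrow> complex.
      \<forall>x y. norm x < r \<longrightarrow> norm y < r \<longrightarrow>
        ((\<lambda>(i, j). c i j * x ^ i * y ^ j) has_sum h (x, y)) UNIV)"

definition zero_germ :: "(complex \<Rightarrow> 'a::zero) \<Rightarrow> bool" where
  "zero_germ f \<longleftrightarrow> (\<forall>\<^sub>F t in nhds 0. f t = 0)"

definition ordt :: "(complex \<Rightarrow> complex) \<Rightarrow> nat" where
  "ordt f = (LEAST n. (deriv ^^ n) f 0 \<noteq> 0)"

definition param :: "(complex \<Rightarrow> complex \<times> complex) \<Rightarrow> bool" where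
  "param \<phi> \<longleftrightarrow> analytic1 (fst \<circ> \<phi>) \<and> analytic1 (snd \<circ> \<phi>) \<and> \<phi> 0 = (0, 0)
      \<and> \<not> zero_germ \<phi>"

definition primitive :: "(complex \<Rightarrow> complex \<times> complex) \<Rightarrow> bool" where
  "primitive \<phi> \<longleftrightarrow> param \<phi> \<and>
     \<not> (\<exists>\<psi> (m::nat). param \<psi> \<and> m \<ge> 2 \<and> (\<forall>\<^sub>F t in nhds 0. \<phi> t = \<psi> (t ^ m)))"

definition aut1 :: "(complex \<Rightarrow> complex) \<Rightarrow> bool" where
  "aut1 \<rho> \<longleftrightarrow> analytic1 \<rho> \<and> \<rho> 0 = 0 \<and>
     (\<exists>\<rho>'. analytic1 \<rho>' \<and> \<rho>' 0 = 0 \<and> (\<forall>\<^sub>F t in nhds 0. \<rho> (\<rho>' t) = t)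
        \<and> (\<forall>\<^sub>F t in nhds 0. \<rho>' (\<rho> t) = t))"

definition aut2 :: "(complex \<times> complex \<Rightarrow> complex \<times> complex) \<Rightarrow> bool" where
  "aut2 \<sigma> \<longleftrightarrow> analytic2 (fst \<circ> \<sigma>) \<and> analytic2 (snd \<circ> \<sigma>) \<and> \<sigma> (0, 0) = (0, 0) \<and>
     (\<exists>\<tau>. analytic2 (fst \<circ> \<tau>) \<and> analytic2 (snd \<circ> \<tau>) \<and> \<tau> (0, 0) = (0, 0)
        \<and> (\<forall>\<^sub>F p in nhds (0, 0). \<sigma> (\<tau> p) = p)
        \<and> (\<forall>\<^sub>F p in nhds (0, 0). \<tau> (\<sigma> p) = p))"

text \<open>A-equivalence: phi2 = sigma o phi1 o rho^{-1} as germs, i.e. phi2 o rho = sigma o phi1.\<close>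
definition A_equiv :: "(complex \<Rightarrow> complex \<times> complex) \<Rightarrow> (complex \<Rightarrow> complex \<times> complex) \<Rightarrow> bool" where
  "A_equiv \<phi>1 \<phi>2 \<longleftrightarrow> (\<exists>\<sigma> \<rho>. aut2 \<sigma> \<and> aut1 \<rho> \<and> (\<forall>\<^sub>F t in nhds 0. \<phi>2 (\<rho> t) = \<sigma> (\<phi>1 t)))"

definition pull_diff ::
  "(complex \<times> complex \<Rightarrow> complex) \<Rightarrow> (complex \<times> complex \<Rightarrow> complex) \<Rightarrow>
   (complex \<Rightarrow> complex \<times> complex) \<Rightarrow> complex \<Rightarrow> complex" where
  "pull_diff h g \<phi> = (\<lambda>t. h (\<phi> t) * deriv (fst \<circ> \<phi>) t + g (\<phi> t) * deriv (snd \<circ> \<phi>) t)"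

definition vals :: "(complex \<Rightarrow> complex \<times> complex) \<Rightarrow> nat set" where
  "vals \<phi> = {ordt (\<lambda>t. h (\<phi> t)) | h. analytic2 h \<and> \<not> zero_germ (\<lambda>t. h (\<phi> t))}"

definition dvals :: "(complex \<Rightarrow> complex \<times> complex) \<Rightarrow> nat set" where
  "dvals \<phi> = {ordt (pull_diff h g \<phi>) + 1 | h g.
                 analytic2 h \<and> analytic2 g \<and> \<not> zero_germ (pull_diff h g \<phi>)}"

definition conductor :: "nat set \<Rightarrow> nat" where
  "conductor S = (LEAST c. \<forall>l\<ge>c. l \<in> S)"

definition gen0 :: "(complex \<Rightarrow> complex \<times> complex) \<Rightarrow> nat" where
  "gen0 \<phi> = (LEAST n. n \<in> vals \<phi> \<and> 0 < n)"

definition zariski :: "(complex \<Rightarrow> complex \<times> complex) \<Rightarrow> nat" where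
  "zariski \<phi> = (LEAST l. l \<in> dvals \<phi> \<and> l \<notin> vals \<phi>) - gen0 \<phi>"

definition zidx :: "nat \<Rightarrow> nat set \<Rightarrow> nat \<Rightarrow> nat set" where
  "zidx v0 \<Lambda> lam = {i. lam < i \<and> i + v0 \<notin> \<Lambda>}"

definition zform :: "nat \<Rightarrow> nat \<Rightarrow> nat set \<Rightarrow> nat \<Rightarrow> (nat \<Rightarrow> complex) \<Rightarrow> complex \<Rightarrow> complex \<times> complex" where
  "zform v0 v1 \<Lambda> lam a = (\<lambda>t. (t ^ v0, t ^ v1 + t ^ lam + (\<Sum>i\<in>zidx v0 \<Lambda> lam. a i * t ^ i)))"

end

theory Submission
  imports Defs "HOL-Complex_Analysis.Complex_Analysis"
begin

text \<open>Curves are kept in the form \<open>(t^n, y(t))\<close> with \<open>y = t^m + \<dots>\<close>, and are moved by the flows of vector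
  fields \<open>a \<partial>X + b \<partial>Y\<close> that raise the weight given by \<open>X \<mapsto> n\<close>, \<open>Y \<mapsto> m\<close>. After restoring the first
  component to a power, such a flow first changes \<open>y\<close> at the exponent \<open>k\<close> for which \<open>k + n\<close> is the value of
  the differential \<open>b dX - a dY\<close>. Beyond the Zariski invariant every value of a differential is
  attained by such a weight-raising field, so all coefficients at exponents \<open>k\<close> with \<open>k + n \<in> \<Lambda>\<close> can be removed one after
  the other. Only finitely many steps are needed: a sufficiently high order perturbation of \<open>y\<close> is an analytic
  function of \<open>(t^n, y)\<close>, by Lagrange interpolation over the conjugates \<open>y(\<zeta>^j t)\<close>.

  Conversely, up to a homothety an equivalence between two normal forms is unipotent. A unipotent
  automorphism agrees to any given order with the time-one map of a weight-raising flow. So, if the normal forms differ first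
  at the exponent \<open>l\<close>, then \<open>l + n\<close> is the value of a differential, which is excluded for normal
  forms. The homothety that remains is the factor \<open>r\<close>.\<close>

text \<open>The obstacle to removing a coefficient is that a differential of value
  \<open>k + n\<close> need not come from a weight-raising field. Once comparison of orders has
  excluded everything that lowers weights, what can remain is a multiple of the Euler field
  \<open>n X \<partial>X + m Y \<partial>Y\<close>, and its differential has value exactly
  \<open>\<lambda> + n\<close>. So a differential of larger value has no Euler part. Values in the
  semigroup are attained by exact differentials \<open>dh\<close>, whose fields raise weights as
  soon as the order of \<open>h\<close> exceeds \<open>n + m\<close>. Orders translate into weights
  only up to \<open>n + m\<close>, where \<open>n\<close> not dividing \<open>m\<close> rules out
  cancellation along the curve. Elsewhere the weight is finer than the order. Flows are therefore
  estimated in the weight filtration: it returns honest polynomials, so a time-one map is replaced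
  by a polynomial automorphism and convergence of a flow never becomes an issue. Primitivity enters
  through finite determinacy, as the statement that the conjugates of \<open>y\<close> are
  distinct.\<close>

unbundle no vec_syntax

section \<open>Weighted filtrations\<close>


lemma X_pow_dvd_iff:
  fixes f :: "'a::comm_ring_1 fps"
  shows "fps_X ^ k dvd f \<longleftrightarrow> (\<forall>i<k. f $ i = 0)"
proof
  assume "\<forall>i<k. f $ i = 0"
  then have "f = fps_X ^ k * fps_shift k f"
    by (auto simp: fps_eq_iff fps_X_power_mult_nth)
  then show "fps_X ^ k dvd f" by (metis dvd_triv_left)
qed (auto simp: fps_X_power_mult_nth elim!: dvdE)

text \<open>The table \<open>c\<close> may be the full Taylor table of an analytic germ. The cut-off
  \<open>N\<close> is a separate argument so that germs and polynomials share one notation;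
  \<open>supp_le\<close> singles out the polynomials.\<close>

definition pev :: "(nat \<Rightarrow> nat \<Rightarrow> 'a::comm_ring_1) \<Rightarrow> nat \<Rightarrow> 'a fps \<Rightarrow> 'a fps \<Rightarrow> 'a fps" where
  "pev c N F G = (\<Sum>i\<le>N. \<Sum>j\<le>N. fps_const (c i j) * F ^ i * G ^ j)"

definition wts :: "nat \<Rightarrow> nat \<Rightarrow> nat \<Rightarrow> (nat \<Rightarrow> nat \<Rightarrow> 'a::zero) \<Rightarrow> bool" where
  "wts n m w c \<longleftrightarrow> (\<forall>i j. c i j \<noteq> 0 \<longrightarrow> w \<le> n * i + m * j)"

lemma wtsD: "wts n m w c \<Longrightarrow> c i j \<noteq> 0 \<Longrightarrow> w \<le> n * i + m * j"
  by (auto simp: wts_def)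

text \<open>Covers both the order in \<open>t\<close> and the weight of a polynomial expression in
  the components of a curve. The same estimates are used in both readings: weights to construct
  flows, orders to compare coefficients.\<close>

locale filtration =
  fixes Fil :: "nat \<Rightarrow> 'a::comm_ring_1 fps set"
  assumes Fil_zero: "0 \<in> Fil w"
    and Fil_add: "f \<in> Fil w \<Longrightarrow> g \<in> Fil w \<Longrightarrow> f + g \<in> Fil w"
    and Fil_const: "f \<in> Fil w \<Longrightarrow> fps_const p * f \<in> Fil w"
    and Fil_one: "1 \<in> Fil 0"
    and Fil_mult: "f \<in> Fil w \<Longrightarrow> g \<in> Fil w' \<Longrightarrow> f * g \<in> Fil (w + w')"
    and Fil_mono: "f \<in> Fil w \<Longrightarrow> w' \<le> w \<Longrightarrow> f \<in> Fil w'"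
begin

lemma Fil_minus: "f \<in> Fil w \<Longrightarrow> - f \<in> Fil w"
  using Fil_const[of f w "-1"] by (simp add: fps_const_neg[symmetric] del: fps_const_neg)

lemma Fil_diff: "f \<in> Fil w \<Longrightarrow> g \<in> Fil w \<Longrightarrow> f - g \<in> Fil w"
  using Fil_add[of f w "- g"] Fil_minus by simp

lemma Fil_sum: "(\<And>i. i \<in> A \<Longrightarrow> f i \<in> Fil w) \<Longrightarrow> sum f A \<in> Fil w"
  by (induction A rule: infinite_finite_induct) (auto intro: Fil_zero Fil_add)

lemma Fil_power: "f \<in> Fil w \<Longrightarrow> f ^ k \<in> Fil (w * k)"
  by (induction k) (auto intro: Fil_one dest: Fil_mult)

lemma Fil_pev:
  assumes "wts n m w c" "P \<in> Fil n" "Q \<in> Fil m"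
  shows "pev c N P Q \<in> Fil w"
  unfolding pev_def
proof (intro Fil_sum)
  fix i j
  show "fps_const (c i j) * P ^ i * Q ^ j \<in> Fil w"
  proof (cases "c i j = 0")
    case False
    have "P ^ i * Q ^ j \<in> Fil (n * i + m * j)"
      using Fil_mult Fil_power assms by blast
    then show ?thesis
      using Fil_mono[OF Fil_const wtsD[OF assms(1) False]] by (simp add: mult.assoc)
  qed (simp add: Fil_zero)
qed

lemma Fil_power_diff:
  assumes "P \<in> Fil n" "P' \<in> Fil n" "P - P' \<in> Fil (n + d)"
  shows "P ^ i - P' ^ i \<in> Fil (n * i + d)"
proof (induction i)
  case (Suc i)
  have "P ^ Suc i - P' ^ Suc i = P * (P ^ i - P' ^ i) + (P - P') * P' ^ i"
    by (simp add: algebra_simps)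
  moreover have "P * (P ^ i - P' ^ i) \<in> Fil (n * Suc i + d)"
    using Fil_mult[OF assms(1) Suc] by (simp add: algebra_simps)
  moreover have "(P - P') * P' ^ i \<in> Fil (n * Suc i + d)"
    using Fil_mult[OF assms(3) Fil_power[OF assms(2), of i]] by (simp add: algebra_simps)
  ultimately show ?case by (simp add: Fil_add)
qed (simp add: Fil_zero)

text \<open>Telescoping in each monomial. A change of the arguments by \<open>d\<close> above their
  own weights is passed on with the same gain \<open>d\<close>, so a field that raises weights by
  one acts as a contraction. This drives the iterations for flows.\<close>

lemma Fil_pev_diff:
  assumes w: "wts n m w c" and P: "P \<in> Fil n" "P' \<in> Fil n" "P - P' \<in> Fil (n + d)"
    and Q: "Q \<in> Fil m" "Q' \<in> Fil m" "Q - Q' \<in> Fil (m + d)"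
  shows "pev c N P Q - pev c N P' Q' \<in> Fil (w + d)"
  unfolding pev_def sum_subtractf[symmetric]
proof (intro Fil_sum)
  fix i j
  show "fps_const (c i j) * P ^ i * Q ^ j - fps_const (c i j) * P' ^ i * Q' ^ j \<in> Fil (w + d)"
  proof (cases "c i j = 0")
    case False
    have "P ^ i * (Q ^ j - Q' ^ j) \<in> Fil (n * i + m * j + d)"
      using Fil_mult[OF Fil_power[OF P(1)] Fil_power_diff[OF Q], of i j] by (simp add: algebra_simps)
    moreover have "(P ^ i - P' ^ i) * Q' ^ j \<in> Fil (n * i + m * j + d)"
      using Fil_mult[OF Fil_power_diff[OF P] Fil_power[OF Q(2)], of i j] by (simp add: algebra_simps)
    ultimately have "P ^ i * (Q ^ j - Q' ^ j) + (P ^ i - P' ^ i) * Q' ^ j \<in> Fil (n * i + m * j + d)"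
      by (rule Fil_add)
    then have "fps_const (c i j) * (P ^ i * (Q ^ j - Q' ^ j) + (P ^ i - P' ^ i) * Q' ^ j) \<in> Fil (w + d)"
      using wtsD[OF w False] by (intro Fil_const) (auto elim!: Fil_mono)
    then show ?thesis by (simp add: algebra_simps)
  qed (simp add: Fil_zero)
qed

end

interpretation tadic: filtration "\<lambda>k. {f :: 'a::comm_ring_1 fps. fps_X ^ k dvd f}"
  by standard (auto simp: power_add mult_dvd_mono intro: dvd_trans[OF le_imp_power_dvd])

text \<open>The weight belongs to the expression, not to its value: terms of low weight may cancel
  along the curve, so \<open>wspan_dvd\<close> has no converse in general. A member can be turned
  back into an actual polynomial (\<open>wspan_imp_pev\<close>), which lets a time-one map be read
  as a map of the plane.\<close>

inductive_set wspan :: "nat \<Rightarrow> nat \<Rightarrow> 'a::comm_ring_1 fps \<Rightarrow> 'a fps \<Rightarrow> nat \<Rightarrow> 'a fps set"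
  for n m F G w where
  wspan_zero: "0 \<in> wspan n m F G w"
| wspan_step: "w \<le> n * i + m * j \<Longrightarrow> f \<in> wspan n m F G w \<Longrightarrow>
    fps_const p * F ^ i * G ^ j + f \<in> wspan n m F G w"

lemma wspan_monom: "w \<le> n * i + m * j \<Longrightarrow> fps_const p * F ^ i * G ^ j \<in> wspan n m F G w"
  using wspan_step[OF _ wspan_zero] by fastforce

lemma wspan_add:
  assumes "f \<in> wspan n m F G w" "g \<in> wspan n m F G w"
  shows "f + g \<in> wspan n m F G w"
  using assms
proof (induction rule: wspan.induct)
  case (wspan_step i j f p)
  then show ?case using wspan.wspan_step[of w n i m j "f + g" F G p] by (simp add: algebra_simps)
qed simp

interpretation wspan: filtration "wspan n m F G"
proof
  show mono: "f \<in> wspan n m F G w'" if "f \<in> wspan n m F G w" "w' \<le> w" for f w w'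
    using that by (induction rule: wspan.induct) (auto intro!: wspan.intros)
  fix f g p w w'
  show "fps_const p * f \<in> wspan n m F G w" if "f \<in> wspan n m F G w"
    using that
  proof (induction rule: wspan.induct)
    case (wspan_step i j f q)
    then show ?case using wspan.wspan_step[of w n i m j "fps_const p * f" F G "p * q"]
      by (simp add: algebra_simps flip: fps_const_mult)
  qed (simp add: wspan_zero)
  show "f * g \<in> wspan n m F G (w + w')" if f: "f \<in> wspan n m F G w" and g: "g \<in> wspan n m F G w'"
    using f
  proof (induction rule: wspan.induct)
    case (wspan_step i j f p)
    have "fps_const p * F ^ i * G ^ j * g \<in> wspan n m F G (w + w')"
      using g
    proof (induction rule: wspan.induct)
      case (wspan_step i' j' f' p')
      have "fps_const (p * p') * F ^ (i + i') * G ^ (j + j') + fps_const p * F ^ i * G ^ j * f'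
          \<in> wspan n m F G (w + w')"
        using wspan_step \<open>w \<le> n * i + m * j\<close>
        by (intro wspan.wspan_step) (auto simp: algebra_simps)
      then show ?case by (simp add: algebra_simps power_add flip: fps_const_mult)
    qed (simp add: wspan_zero)
    with wspan_step show ?case by (simp add: distrib_right wspan_add)
  qed (simp add: wspan_zero)
  show "1 \<in> wspan n m F G 0" using wspan_monom[of 0 n 0 m 0 1 F G] by simp
qed (auto intro: wspan_zero wspan_add)

lemma wspan_F: "F \<in> wspan n m F G n" using wspan_monom[of n n 1 m 0 1 F G] by simp
lemma wspan_G: "G \<in> wspan n m F G m" using wspan_monom[of m n 0 m 1 1 F G] by simp

lemma wspan_dvd:
  assumes "f \<in> wspan n m F G w" "fps_X ^ n dvd F" "fps_X ^ m dvd G"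
  shows "fps_X ^ w dvd f"
  using assms(1)
proof (induction rule: wspan.induct)
  case (wspan_step i j f p)
  have "fps_X ^ (n * i + m * j) dvd F ^ i * G ^ j"
    using assms(2,3) by (simp add: power_add power_mult mult_dvd_mono dvd_power_same)
  then have "fps_X ^ w dvd F ^ i * G ^ j"
    using wspan_step(1) by (meson dvd_trans le_imp_power_dvd)
  then have "fps_X ^ w dvd fps_const p * (F ^ i * G ^ j)" by (rule dvd_mult)
  with wspan_step show ?case by (simp add: mult.assoc)
qed simp

lemma pev_add: "pev (\<lambda>i j. c i j + d i j) N F G = pev c N F G + pev d N F G"
  by (simp add: pev_def sum.distrib algebra_simps flip: fps_const_add)

lemma pev_cmult: "pev (\<lambda>i j. k * c i j) N F G = fps_const k * pev c N F G"
  by (simp add: pev_def sum_distrib_left algebra_simps flip: fps_const_mult)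

lemma pev_diff: "pev (\<lambda>i j. c i j - d i j) N F G = pev c N F G - pev d N F G"
  by (simp add: pev_def sum_subtractf algebra_simps flip: fps_const_sub)

lemma pev_extend:
  assumes "\<And>i j. c i j \<noteq> 0 \<Longrightarrow> i \<le> N \<and> j \<le> N" "N \<le> N'"
  shows "pev c N' F G = pev c N F G"
proof -
  have "pev c N' F G = (\<Sum>(i,j)\<in>{..N'}\<times>{..N'}. fps_const (c i j) * F ^ i * G ^ j)"
    by (simp add: pev_def sum.cartesian_product)
  also have "\<dots> = (\<Sum>(i,j)\<in>{..N}\<times>{..N}. fps_const (c i j) * F ^ i * G ^ j)"
    using assms by (intro sum.mono_neutral_right) (auto, (metis fps_const_0_eq_0 mult_zero_left)+)
  finally show ?thesis by (simp add: pev_def sum.cartesian_product)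
qed

definition single :: "nat \<Rightarrow> nat \<Rightarrow> 'a::zero \<Rightarrow> nat \<Rightarrow> nat \<Rightarrow> 'a" where
  "single a b p = (\<lambda>i j. if i = a \<and> j = b then p else 0)"

lemma pev_single:
  assumes "a \<le> N" "b \<le> N"
  shows "pev (single a b p) N F G = fps_const p * F ^ a * G ^ b"
proof -
  have "fps_const (if i = a \<and> j = b then p else 0) * F ^ i * G ^ j
      = (if i = a then if j = b then fps_const p * F ^ a * G ^ b else 0 else 0)" for i j by simp
  then have "pev (single a b p) N F G =
      (\<Sum>i\<le>N. if i = a then \<Sum>j\<le>N. if j = b then fps_const p * F ^ a * G ^ b else 0 else 0)"
    unfolding pev_def single_def by (intro sum.cong refl) simp
  also have "\<dots> = fps_const p * F ^ a * G ^ b"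
    using assms by simp
  finally show ?thesis .
qed

definition supp_le :: "nat \<Rightarrow> (nat \<Rightarrow> nat \<Rightarrow> 'a::zero) \<Rightarrow> bool" where
  "supp_le N c \<longleftrightarrow> (\<forall>i j. c i j \<noteq> 0 \<longrightarrow> i \<le> N \<and> j \<le> N)"

lemma pev_extend': "supp_le N c \<Longrightarrow> N \<le> N' \<Longrightarrow> pev c N' F G = pev c N F G"
  by (rule pev_extend) (auto simp: supp_le_def)

lemma wspan_imp_pev:
  assumes "f \<in> wspan n m F G w"
  shows "\<exists>N c. supp_le N c \<and> wts n m w c \<and> f = pev c N F G"
  using assms
proof (induction rule: wspan.induct)
  case wspan_zero
  show ?case by (intro exI[of _ 0] exI[of _ "\<lambda>_ _. 0"]) (auto simp: pev_def wts_def supp_le_def)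
next
  case (wspan_step i j f p)
  then obtain N c where c: "supp_le N c" "wts n m w c" "f = pev c N F G" by blast
  define N' where "N' = max N (max i j)"
  have "supp_le N' (\<lambda>a b. single i j p a b + c a b)"
    using c(1) by (fastforce simp: supp_le_def N'_def single_def split: if_splits)
  moreover have "wts n m w (\<lambda>a b. single i j p a b + c a b)"
    using c(2) wspan_step(1) by (auto simp: wts_def single_def)
  moreover have "fps_const p * F ^ i * G ^ j + f = pev (\<lambda>a b. single i j p a b + c a b) N' F G"
    unfolding pev_add c(3) using pev_extend'[OF c(1), of N' F G] pev_single[of i N' j p F G]
    by (simp add: N'_def)
  ultimately show ?case by blast
qed

text \<open>Every monomial outside the square of side \<open>N\<close> has total degree above
  \<open>N\<close>, and both arguments vanish at 0.\<close>

lemma pev_cong_trunc: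
  fixes F G :: "'a::comm_ring_1 fps"
  assumes "fps_X dvd F" "fps_X dvd G" "N \<le> N'"
  shows "fps_X ^ Suc N dvd (pev c N' F G - pev c N F G)"
proof -
  have *: "fps_X ^ Suc N dvd fps_const (c i j) * F ^ i * G ^ j" if "i > N \<or> j > N" for i j
  proof -
    have "fps_X ^ i dvd F ^ i" "fps_X ^ j dvd G ^ j" using assms by (auto intro: dvd_power_same)
    then have "fps_X ^ (i + j) dvd F ^ i * G ^ j" by (simp add: power_add mult_dvd_mono)
    moreover have "(fps_X :: 'a fps) ^ Suc N dvd fps_X ^ (i + j)"
      using that by (intro le_imp_power_dvd) auto
    ultimately have "fps_X ^ Suc N dvd F ^ i * G ^ j"
      by (rule dvd_trans[rotated])
    then have "fps_X ^ Suc N dvd fps_const (c i j) * (F ^ i * G ^ j)" by (rule dvd_mult)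
    then show ?thesis by (simp add: mult.assoc)
  qed
  have "pev c N' F G - pev c N F G = 
     (\<Sum>(i,j)\<in>{..N'}\<times>{..N'} - {..N}\<times>{..N}. fps_const (c i j) * F ^ i * G ^ j)"
    unfolding pev_def sum.cartesian_product using assms(3)
    by (intro sum_diff[symmetric]) (simp, rule Sigma_mono, auto)
  also have "fps_X ^ Suc N dvd \<dots>"
  proof (rule dvd_sum)
    fix x assume "x \<in> {..N'}\<times>{..N'} - {..N}\<times>{..N}"
    then show "fps_X ^ Suc N dvd (case x of (i, j) \<Rightarrow> fps_const (c i j) * F ^ i * G ^ j)"
      by (cases x) (simp only: prod.case, rule *, auto)
  qed
  finally show ?thesis .
qed

section \<open>Flows over polynomials in the time\<close>

text \<open>An element of \<open>C[s][[t]]\<close> is a family of power series in \<open>t\<close> depending polynomially on the time \<open>s\<close>.\<close>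

definition emb :: "complex fps \<Rightarrow> complex poly fps" where
  "emb f = Abs_fps (\<lambda>k. [:f $ k:])"

definition sev :: "complex \<Rightarrow> complex poly fps \<Rightarrow> complex fps" where
  "sev x f = Abs_fps (\<lambda>k. poly (f $ k) x)"

definition sderiv :: "complex poly fps \<Rightarrow> complex poly fps" where
  "sderiv f = Abs_fps (\<lambda>k. pderiv (f $ k))"

definition pint :: "complex poly \<Rightarrow> complex poly" where
  "pint p = (\<Sum>i\<le>degree p. monom (coeff p i / of_nat (Suc i)) (Suc i))"

definition sint :: "complex poly fps \<Rightarrow> complex poly fps" where
  "sint f = Abs_fps (\<lambda>k. pint (f $ k))"

lemma emb_nth [simp]: "emb f $ k = [:f $ k:]" by (simp add: emb_def)
lemma sev_nth [simp]: "sev x f $ k = poly (f $ k) x" by (simp add: sev_def)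
lemma sderiv_nth [simp]: "sderiv f $ k = pderiv (f $ k)" by (simp add: sderiv_def)
lemma sint_nth [simp]: "sint f $ k = pint (f $ k)" by (simp add: sint_def)

lemma const_poly_sum: "[:sum f A:] = (\<Sum>x\<in>A. [:f x:])"
  by (rule poly_eqI) (simp add: coeff_sum coeff_pCons split: nat.split)

lemma emb_simps [simp]:
  "emb 0 = 0" "emb 1 = 1" "emb fps_X = fps_X" "emb (f + g) = emb f + emb g" "emb (f - g) = emb f - emb g"
  "emb (- f) = - emb f" "emb (f * g) = emb f * emb g" "emb (fps_const c) = fps_const [:c:]"
  by (auto simp: fps_eq_iff fps_mult_nth const_poly_sum fps_one_nth fps_X_nth one_pCons mult.commute
           intro!: sum.cong)

lemma emb_power [simp]: "emb (f ^ k) = emb f ^ k"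
  by (induction k) auto

lemma sev_simps [simp]:
  "sev x 0 = 0" "sev x 1 = 1" "sev x fps_X = fps_X" "sev x (f + g) = sev x f + sev x g"
  "sev x (f - g) = sev x f - sev x g" "sev x (- f) = - sev x f" "sev x (f * g) = sev x f * sev x g"
  "sev x (fps_const p) = fps_const (poly p x)" "sev x (emb h) = h"
  by (auto simp: fps_eq_iff fps_mult_nth poly_sum fps_one_nth fps_X_nth)

lemma sev_power [simp]: "sev x (f ^ k) = sev x f ^ k"
  by (induction k) auto

lemma sev_dvd: "fps_X ^ k dvd f \<Longrightarrow> fps_X ^ k dvd sev x f"
  by (auto simp: X_pow_dvd_iff)

lemma emb_dvd: "fps_X ^ k dvd f \<Longrightarrow> fps_X ^ k dvd emb f"
  by (auto simp: X_pow_dvd_iff)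

lemma sev_compose: "sev x (emb f oo g) = f oo sev x g"
proof (rule fps_ext)
  fix k
  have "sev x (emb f oo g) $ k = (\<Sum>i=0..k. f $ i * (sev x (g ^ i) $ k))"
    by (simp add: fps_compose_nth poly_sum del: sev_power)
  then show "sev x (emb f oo g) $ k = (f oo sev x g) $ k" by (simp add: fps_compose_nth)
qed

lemma sderiv_simps [simp]:
  "sderiv 0 = 0" "sderiv (emb h) = 0" "sderiv (f + g) = sderiv f + sderiv g" "sderiv (f - g) = sderiv f - sderiv g"
  "sderiv (fps_const p) = fps_const (pderiv p)"
  by (auto simp: fps_eq_iff pderiv_add pderiv_diff pderiv_pCons)

lemma pderiv_sum: "pderiv (sum f A) = (\<Sum>x\<in>A. pderiv (f x))"
  by (induction A rule: infinite_finite_induct) (auto simp: pderiv_add)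

lemma sderiv_mult: "sderiv (f * g) = sderiv f * g + f * sderiv g"
proof (rule fps_ext)
  fix k
  have "sderiv (f * g) $ k = (\<Sum>i=0..k. pderiv (f $ i * g $ (k - i)))"
    by (simp add: fps_mult_nth pderiv_sum)
  then show "sderiv (f * g) $ k = (sderiv f * g + f * sderiv g) $ k"
    unfolding fps_mult_nth fps_add_nth pderiv_mult sum.distrib sderiv_nth by (simp add: mult.commute)
qed

lemma sderiv_power: "sderiv (f ^ k) = of_nat k * f ^ (k - 1) * sderiv f"
proof (induction k)
  case 0
  show ?case using sderiv_simps(2)[of 1] by simp
next
  case (Suc k)
  then show ?case by (cases k) (simp_all add: sderiv_mult algebra_simps)
qed

lemma sderiv_cmult: "sderiv (fps_const [:c:] * f) = fps_const [:c:] * sderiv f"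
  by (simp add: sderiv_mult pderiv_pCons)

lemma X_dvd_power_nth: "fps_X dvd (g :: 'a::comm_ring_1 fps) \<Longrightarrow> k < i \<Longrightarrow> (g ^ i) $ k = 0"
  using dvd_power_same[of fps_X g i] by (auto simp: X_pow_dvd_iff)

lemma fps_compose_nth_atMost:
  assumes "fps_X dvd (g :: 'a::comm_ring_1 fps)" "k \<le> K"
  shows "(f oo g) $ k = (\<Sum>i\<le>K. f $ i * (g ^ i) $ k)"
  unfolding fps_compose_nth atLeast0AtMost using assms
  by (intro sum.mono_neutral_left) (auto simp: X_dvd_power_nth)

text \<open>Chain rule, compared coefficient by coefficient: since \<open>g\<close> vanishes at 0,
  each coefficient involves finitely many powers of \<open>g\<close>.\<close>

lemma sderiv_compose:
  assumes g: "fps_X dvd g"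
  shows "sderiv (emb f oo g) = (emb (fps_deriv f) oo g) * sderiv g"
proof (rule fps_ext)
  fix k
  have tr: "(emb h oo g) $ i = (\<Sum>j\<le>k. fps_const [:h $ j:] * g ^ j) $ i" if "i \<le> k" for h i
    using that by (simp add: fps_compose_nth_atMost[OF g that] fps_sum_nth)
  \<comment> \<open>One power more is kept, up to \<open>Suc k\<close>, because differentiation
    shifts the outer index down by one and the result has to reach \<open>k\<close>.\<close>
  have "sderiv (emb f oo g) $ k = sderiv (\<Sum>j\<le>Suc k. fps_const [:f $ j:] * g ^ j) $ k"
    using fps_compose_nth_atMost[OF g, of k "Suc k" "emb f"] by (simp add: fps_sum_nth del: sum.atMost_Suc)
  also have "sderiv (\<Sum>j\<le>Suc k. fps_const [:f $ j:] * g ^ j)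
      = (\<Sum>j\<le>Suc k. fps_const [:f $ j:] * (of_nat j * g ^ (j - 1) * sderiv g))"
  proof -
    have "sderiv (sum h A) = (\<Sum>x\<in>A. sderiv (h x))" if "finite A" for h :: "nat \<Rightarrow> _" and A
      using that by (induction A) auto
    then show ?thesis by (simp add: sderiv_cmult sderiv_power del: sum.atMost_Suc)
  qed
  also have "\<dots> = (\<Sum>j\<le>k. fps_const [:fps_deriv f $ j:] * g ^ j) * sderiv g"
  proof -
    have "fps_const [:f $ Suc j:] * (of_nat (Suc j) * g ^ j * sderiv g)
        = fps_const [:fps_deriv f $ j:] * g ^ j * sderiv g" for j
    proof -
      have "fps_const [:f $ Suc j:] * of_nat (Suc j) = fps_const [:fps_deriv f $ j:]"
        by (simp add: fps_of_nat[symmetric] of_nat_poly mult.commute del: of_nat_Suc)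
      then show ?thesis by (metis mult.assoc)
    qed
    then show ?thesis
      unfolding sum.atMost_Suc_shift sum_distrib_right diff_Suc_1
      by (simp only: of_nat_0 mult_zero_left mult_zero_right add_0_left)
  qed
  also have "\<dots> $ k = ((emb (fps_deriv f) oo g) * sderiv g) $ k"
    unfolding fps_mult_nth by (intro sum.cong refl) (simp add: tr)
  finally show "sderiv (emb f oo g) $ k = ((emb (fps_deriv f) oo g) * sderiv g) $ k" .
qed

lemma poly_pint_0 [simp]: "poly (pint p) 0 = 0"
  by (simp add: pint_def poly_sum poly_monom)

lemma pderiv_pint [simp]: "pderiv (pint p) = p"
proof -
  have "pderiv (pint p) = (\<Sum>i\<le>degree p. monom (coeff p i) i)"
    unfolding pint_def pderiv_sum pderiv_monom
    by (intro sum.cong refl) (simp del: of_nat_Suc)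
  then show ?thesis by (simp add: poly_as_sum_of_monoms)
qed

lemma poly_eq_by_pderiv:
  fixes p q :: "complex poly"
  assumes "pderiv p = pderiv q" "poly p 0 = poly q 0"
  shows "p = q"
proof -
  have "pderiv (p - q) = 0" using assms by (simp add: pderiv_diff)
  then obtain c where "p - q = [:c:]"
    by (metis degree_eq_zeroE pderiv_eq_0_iff)
  moreover have "poly (p - q) 0 = 0" using assms(2) by simp
  ultimately have "p - q = 0" by simp
  then show ?thesis by simp
qed

lemma sderiv_sint [simp]: "sderiv (sint f) = f" by (simp add: fps_eq_iff)
lemma sev_sint [simp]: "sev 0 (sint f) = 0" by (simp add: fps_eq_iff)

lemma sint_sderiv: "sint (sderiv f) = f - emb (sev 0 f)"
  by (rule fps_ext, rule poly_eq_by_pderiv) (auto simp: pderiv_diff pderiv_pCons)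

lemma sint_eqI: "sderiv f = g \<Longrightarrow> sev 0 f = 0 \<Longrightarrow> sint g = f"
  using sint_sderiv[of f] by simp

lemma sint_const_emb: "sint (fps_const p * emb g) = fps_const (pint p) * emb g"
  by (rule sint_eqI) (auto simp: sderiv_mult)

lemma sint_add: "sint (f + g) = sint f + sint g"
  by (rule sint_eqI) auto

text \<open>Integration in the time acts on the coefficients only, which are polynomials in
  \<open>s\<close>; the monomials in \<open>emb F\<close> and \<open>emb G\<close> do not depend on
  the time.\<close>

lemma sint_wspan:
  assumes "f \<in> wspan n m (emb F) (emb G) w"
  shows "sint f \<in> wspan n m (emb F) (emb G) w"
  using assms
proof (induction rule: wspan.induct)
  case wspan_zero
  have "sint 0 = 0" by (rule sint_eqI) auto
  then show ?case by (simp add: wspan.wspan_zero)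
next
  case (wspan_step i j f p)
  have "sint (fps_const p * emb F ^ i * emb G ^ j) = fps_const (pint p) * emb F ^ i * emb G ^ j"
    using sint_const_emb[of p "F ^ i * G ^ j"] by (simp add: mult.assoc)
  with wspan_step show ?case by (simp add: sint_add wspan.wspan_step)
qed

text \<open>Plays the part of uniqueness for differential equations: an estimate of the derivative,
  together with the initial value, is an estimate of the family itself.\<close>

lemma wspan_sderivD:
  assumes "sderiv f \<in> wspan n m (emb F) (emb G) w" "sev 0 f = 0"
  shows "f \<in> wspan n m (emb F) (emb G) w"
  using sint_wspan[OF assms(1)] assms(2) by (simp add: sint_sderiv)

lemma sev_wspan:
  assumes "f \<in> wspan n m (emb F) (emb G) w"
  shows "sev x f \<in> wspan n m F G w"
  using assms
  by (induction rule: wspan.induct) (auto intro: wspan.intros)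

definition cst :: "(nat \<Rightarrow> nat \<Rightarrow> complex) \<Rightarrow> nat \<Rightarrow> nat \<Rightarrow> complex poly" where
  "cst a = (\<lambda>i j. [:a i j:])"

lemma wts_cst [simp]: "wts n m w (cst a) \<longleftrightarrow> wts n m w a"
  by (auto simp: wts_def cst_def)

lemma emb_sum: "emb (sum f A) = (\<Sum>i\<in>A. emb (f i))"
  by (induction A rule: infinite_finite_induct) auto

lemma emb_pev: "emb (pev a N P Q) = pev (cst a) N (emb P) (emb Q)"
  by (simp add: pev_def emb_sum cst_def)

lemma pev_compose:
  fixes F :: "'a::idom fps"
  assumes "fps_X dvd h"
  shows "pev a N F G oo h = pev a N (F oo h) (G oo h)"
proof -
  have h: "h $ 0 = 0" using assms X_pow_dvd_iff[of 1 h] by simp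
  show ?thesis
    by (simp add: pev_def fps_compose_sum_distrib fps_compose_mult_distrib[OF h] fps_compose_power[OF h])
qed

section \<open>Leading coefficients and n-th roots of power series\<close>

lemma mult_nth_lead:
  fixes f g :: "'a::comm_ring_1 fps"
  assumes "fps_X ^ p dvd f" "fps_X ^ q dvd g"
  shows "(f * g) $ (p + q) = f $ p * g $ q"
proof -
  obtain f' g' where "f = fps_X ^ p * f'" "g = fps_X ^ q * g'" using assms by (auto elim!: dvdE)
  moreover have "fps_X ^ p * f' * (fps_X ^ q * g') = fps_X ^ (p + q) * (f' * g')"
    by (simp add: power_add algebra_simps)
  ultimately show ?thesis by (simp add: fps_X_power_mult_nth)
qed

lemma power_nth_lead:
  fixes f :: "'a::comm_ring_1 fps"
  assumes "fps_X dvd f"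
  shows "(f ^ k) $ k = (f $ 1) ^ k"
proof (induction k)
  case (Suc k)
  have "fps_X ^ k dvd f ^ k" using assms by (rule dvd_power_same)
  then have "(f * f ^ k) $ (1 + k) = f $ 1 * (f ^ k) $ k"
    using assms by (intro mult_nth_lead) auto
  with Suc show ?case by simp
qed simp

lemma X_dvd_iff: "fps_X dvd (f :: 'a::comm_ring_1 fps) \<longleftrightarrow> f $ 0 = 0"
  using X_pow_dvd_iff[of 1 f] by simp

lemma tangent_idD:
  assumes "fps_X ^ 2 dvd (f :: 'a::comm_ring_1 fps) - fps_X"
  shows "f $ 0 = 0" "f $ Suc 0 = 1" "fps_X dvd f"
proof -
  have *: "\<forall>i<2. (f - fps_X) $ i = 0" using assms unfolding X_pow_dvd_iff .
  show f0: "f $ 0 = 0" using spec[OF *, of 0] by simp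
  show "f $ Suc 0 = 1" using spec[OF *, of "Suc 0"] by simp
  show "fps_X dvd f" using f0 by (simp add: X_dvd_iff)
qed

lemma compose_dvd:
  fixes f g :: "'a::idom fps"
  assumes "fps_X ^ p dvd f" "fps_X dvd g"
  shows "fps_X ^ p dvd f oo g"
proof -
  obtain f' where f: "f = fps_X ^ p * f'" using assms(1) by (auto elim: dvdE)
  have g: "g $ 0 = 0" using assms(2) by (simp add: X_dvd_iff)
  have "f oo g = g ^ p * (f' oo g)"
    unfolding f fps_compose_mult_distrib[OF g] using g by (simp flip: fps_compose_power[OF g])
  moreover have "fps_X ^ p dvd g ^ p" using assms(2) by (rule dvd_power_same)
  ultimately show ?thesis by simp
qed

lemma compose_nth_lead:
  fixes f g :: "'a::idom fps"
  assumes "fps_X ^ p dvd f" "fps_X dvd g"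
  shows "(f oo g) $ p = f $ p * (g $ 1) ^ p"
proof -
  obtain f' where f: "f = fps_X ^ p * f'" using assms(1) by (auto elim: dvdE)
  have g: "g $ 0 = 0" using assms(2) by (simp add: X_dvd_iff)
  have "f oo g = g ^ p * (f' oo g)"
    unfolding f fps_compose_mult_distrib[OF g] using g by (simp flip: fps_compose_power[OF g])
  moreover have "fps_X ^ p dvd g ^ p" using assms(2) by (rule dvd_power_same)
  ultimately have "(f oo g) $ (p + 0) = (g ^ p) $ p * (f' oo g) $ 0"
    by (simp only:) (intro mult_nth_lead, auto)
  then show ?thesis using power_nth_lead[OF assms(2)] by (simp add: f fps_X_power_mult_nth)
qed

text \<open>\<open>f ^ n - g ^ n\<close> is \<open>f - g\<close> times a sum of \<open>n\<close>
  products, each with leading term \<open>t ^ (n - 1)\<close>. In characteristic 0 these leading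
  terms add up to a nonzero one, so taking the root costs exactly \<open>n - 1\<close>
  orders.\<close>

lemma root_congruence:
  fixes f g :: "'a::{idom,ring_char_0} fps"
  assumes f: "fps_X ^ 2 dvd f - fps_X" and g: "fps_X ^ 2 dvd g - fps_X"
    and n: "0 < n" and d: "fps_X ^ (N + n - 1) dvd f ^ n - g ^ n"
  shows "fps_X ^ N dvd f - g"
proof (cases "f = g")
  case False
  define S where "S = (\<Sum>i<n. g ^ (n - Suc i) * f ^ i)"
  have trm: "fps_X ^ (n - 1) dvd g ^ (n - Suc i) * f ^ i \<and> (g ^ (n - Suc i) * f ^ i) $ (n - 1) = 1"
    if "i < n" for i
  proof -
    have e: "n - 1 = (n - Suc i) + i" using that by simp
    have 1: "fps_X ^ (n - Suc i) dvd g ^ (n - Suc i)" "fps_X ^ i dvd f ^ i"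
      using tangent_idD(3)[OF f] tangent_idD(3)[OF g] by (auto intro: dvd_power_same)
    have "(g ^ (n - Suc i) * f ^ i) $ (n - 1) = (g ^ (n - Suc i)) $ (n - Suc i) * (f ^ i) $ i"
      unfolding e by (rule mult_nth_lead[OF 1])
    also have "\<dots> = 1"
      using power_nth_lead[OF tangent_idD(3)[OF f]] power_nth_lead[OF tangent_idD(3)[OF g]]
        tangent_idD(2)[OF f] tangent_idD(2)[OF g] by simp
    finally have "(g ^ (n - Suc i) * f ^ i) $ (n - 1) = 1" .
    moreover have "fps_X ^ (n - 1) dvd g ^ (n - Suc i) * f ^ i"
      unfolding e power_add using 1 by (rule mult_dvd_mono)
    ultimately show ?thesis by blast
  qed
  have S1: "fps_X ^ (n - 1) dvd S" unfolding S_def using trm by (intro dvd_sum) auto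
  have "S $ (n - 1) = (\<Sum>i<n. 1)" unfolding S_def fps_sum_nth using trm by (intro sum.cong) auto
  then have Sn: "S $ (n - 1) \<noteq> 0" using n by simp
  have sS: "subdegree S = n - 1"
    using S1 Sn by (intro subdegreeI) (auto simp: X_pow_dvd_iff)
  have "f ^ n - g ^ n = (f - g) * S" unfolding S_def by (rule power_diff_sumr2)
  moreover have "subdegree ((f - g) * S) = subdegree (f - g) + (n - 1)"
    using False Sn sS by (subst subdegree_mult) auto
  moreover have "(f - g) * S \<noteq> 0" using False Sn by auto
  ultimately have "N + n - 1 \<le> subdegree (f - g) + (n - 1)"
    using d by (metis X_pow_dvd_iff subdegree_geI nth_less_subdegree_zero not_le nth_subdegree_nonzero)
  then have "N \<le> subdegree (f - g)" using n by simp
  then show ?thesis unfolding X_pow_dvd_iff by (metis nth_less_subdegree_zero less_le_trans)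
qed simp

lemma root_unique:
  fixes f g :: "'a::{idom,ring_char_0} fps"
  assumes "fps_X ^ 2 dvd f - fps_X" "fps_X ^ 2 dvd g - fps_X" "0 < n" "f ^ n = g ^ n"
  shows "f = g"
proof -
  have "fps_X ^ N dvd f - g" for N using assms by (intro root_congruence[of f g n]) auto
  then have "(f - g) $ i = 0" for i using X_pow_dvd_iff[of "Suc i" "f - g"] by blast
  then show ?thesis by (simp add: fps_eq_iff)
qed

text \<open>Writing \<open>P = t ^ n * (1 + t * z)\<close>, the root is
  \<open>t * (1 + t * z) ^ (1 / n)\<close> by the binomial series. The coefficients of that series
  are constants, so the root stays polynomial in the time.\<close>

lemma root_exists:
  fixes P :: "complex poly fps"
  assumes n: "0 < n" and P: "fps_X ^ Suc n dvd P - fps_X ^ n"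
  obtains r where "fps_X ^ 2 dvd r - fps_X" "r ^ n = P"
proof -
  obtain z where z: "P - fps_X ^ n = fps_X ^ Suc n * z" using P by (auto elim: dvdE)
  define b where "b = emb (fps_binomial (1 / of_nat n)) oo (fps_X * z)"
  have X0: "(fps_X * z) $ 0 = 0" by simp
  have "b ^ n = emb (fps_binomial (1 / of_nat n) ^ n) oo (fps_X * z)"
    by (simp add: b_def fps_compose_power[OF X0])
  also have "fps_binomial (1 / of_nat n) ^ n = (1 + fps_X :: complex fps)"
    using n by (simp add: fps_binomial_power fps_binomial_1)
  also have "emb \<dots> oo (fps_X * z) = 1 + fps_X * z"
    by (simp add: fps_compose_add_distrib)
  finally have "(fps_X * b) ^ n = P"
    using z by (simp add: power_mult_distrib algebra_simps)
  moreover have "fps_X dvd b - 1" by (simp add: X_dvd_iff b_def one_pCons)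
  then have "fps_X ^ 2 dvd fps_X * b - fps_X"
    using mult_dvd_mono[of fps_X fps_X fps_X "b - 1"] by (simp add: power2_eq_square algebra_simps)
  ultimately show ?thesis using that by blast
qed

text \<open>\<open>(P, Q)\<close> is the orbit of the curve \<open>(F, y)\<close> under the field \<open>a \<partial>X + b \<partial>Y\<close>, up to an error whose
  weight exceeds that of the curve by more than \<open>K\<close>. This truncation keeps \<open>P\<close> and \<open>Q\<close> polynomial in \<open>F\<close> and \<open>y\<close>.\<close>

definition flow where
  "flow n m F y a b N K P Q \<longleftrightarrow>
     P - emb F \<in> wspan n m (emb F) (emb y) (n + 1) \<and> Q - emb y \<in> wspan n m (emb F) (emb y) (m + 1) \<and>
     sev 0 P = F \<and> sev 0 Q = y \<and>
     sderiv P - pev (cst a) N P Q \<in> wspan n m (emb F) (emb y) (n + 1 + K) \<and>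
     sderiv Q - pev (cst b) N P Q \<in> wspan n m (emb F) (emb y) (m + 1 + K)"

lemma flowD:
  assumes "flow n m F y a b N K P Q"
  shows "P - emb F \<in> wspan n m (emb F) (emb y) (n + 1)" "Q - emb y \<in> wspan n m (emb F) (emb y) (m + 1)"
     "sev 0 P = F" "sev 0 Q = y"
     "sderiv P - pev (cst a) N P Q \<in> wspan n m (emb F) (emb y) (n + 1 + K)"
     "sderiv Q - pev (cst b) N P Q \<in> wspan n m (emb F) (emb y) (m + 1 + K)"
  using assms unfolding flow_def by blast+

lemma flow_wspan:
  assumes "flow n m F y a b N K P Q"
  shows "P \<in> wspan n m (emb F) (emb y) n" "Q \<in> wspan n m (emb F) (emb y) m"
proof -
  have "P - emb F \<in> wspan n m (emb F) (emb y) n" "Q - emb y \<in> wspan n m (emb F) (emb y) m"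
    using assms by (auto simp: flow_def intro: wspan.Fil_mono)
  from this(1)[THEN wspan.Fil_add[OF wspan_F]] this(2)[THEN wspan.Fil_add[OF wspan_G]]
  show "P \<in> wspan n m (emb F) (emb y) n" "Q \<in> wspan n m (emb F) (emb y) m" by simp_all
qed

text \<open>Picard iteration. One step improves the error by one weight, because the field raises
  weights by one.\<close>

lemma flow_exists:
  assumes a: "wts n m (n + 1) a" and b: "wts n m (m + 1) b"
  shows "\<exists>P Q. flow n m F y a b N K P Q"
proof (induction K)
  case 0
  have "pev (cst a) N (emb F) (emb y) \<in> wspan n m (emb F) (emb y) (n + 1)"
    "pev (cst b) N (emb F) (emb y) \<in> wspan n m (emb F) (emb y) (m + 1)"
    using a b by (auto intro!: wspan.Fil_pev wspan_F wspan_G simp del: One_nat_def)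
  then have "flow n m F y a b N 0 (emb F) (emb y)"
    by (auto simp: flow_def wspan_zero dest: wspan.Fil_minus)
  then show ?case by blast
next
  case (Suc K)
  then obtain P Q where fl: "flow n m F y a b N K P Q" by blast
  let ?J = "wspan n m (emb F) (emb y)"
  define P' where "P' = emb F + sint (pev (cst a) N P Q)"
  define Q' where "Q' = emb y + sint (pev (cst b) N P Q)"
  have P: "P \<in> ?J n" and Q: "Q \<in> ?J m" using flow_wspan[OF fl] by auto
  have 1: "P' - emb F \<in> ?J (n + 1)" "Q' - emb y \<in> ?J (m + 1)"
    unfolding P'_def Q'_def using a b P Q by (auto intro!: sint_wspan wspan.Fil_pev simp del: One_nat_def)
  have 2: "sev 0 P' = F" "sev 0 Q' = y" by (simp_all add: P'_def Q'_def)
  have 3: "sderiv P' = pev (cst a) N P Q" "sderiv Q' = pev (cst b) N P Q"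
    by (simp_all add: P'_def Q'_def)
  have P': "P' \<in> ?J n" and Q': "Q' \<in> ?J m"
    using wspan.Fil_add[OF wspan_F wspan.Fil_mono[OF 1(1)]] wspan.Fil_add[OF wspan_G wspan.Fil_mono[OF 1(2)]]
    by simp_all
  \<comment> \<open>The derivative of \<open>P - P'\<close> is exactly the error of the previous
    stage.\<close>
  have "P - P' \<in> ?J (n + Suc K)" "Q - Q' \<in> ?J (m + Suc K)"
    using flowD(3-6)[OF fl] by (simp_all add: wspan_sderivD 2 3)
  then have "pev (cst a) N P Q - pev (cst a) N P' Q' \<in> ?J (n + 1 + Suc K)"
    "pev (cst b) N P Q - pev (cst b) N P' Q' \<in> ?J (m + 1 + Suc K)"
    using a b P Q P' Q' by (blast intro: wspan.Fil_pev_diff wts_cst[THEN iffD2])+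
  then have "flow n m F y a b N (Suc K) P' Q'" using 1 2 3 by (simp add: flow_def)
  then show ?case by blast
qed

text \<open>The common field acts on the difference of the two orbits with a gain of one weight, so
  up to gain \<open>k\<close> only the added field counts, and it may be frozen at the initial
  curve. The sum of fields is expressed through values of \<open>pev\<close> because the summands
  are truncated at different degrees.\<close>

lemma flow_perturb:
  fixes F y :: "complex fps"
  assumes fl: "flow n m F y a b N K P Q" and fl': "flow n m F y a' b' N' K P' Q'"
    and a: "wts n m (n + 1) a" and b: "wts n m (m + 1) b"
    and al: "wts n m (n + k) al" and be: "wts n m (m + k) be" and k: "1 \<le> k" "k \<le> K"
    and a': "\<And>U V. pev (cst a') N' U V = pev (cst a) N U V + pev (cst al) N' U V"
    and b': "\<And>U V. pev (cst b') N' U V = pev (cst b) N U V + pev (cst be) N' U V"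
  shows "sev 1 P' - sev 1 P - pev al N' F y \<in> wspan n m F y (n + Suc k)"
    "sev 1 Q' - sev 1 Q - pev be N' F y \<in> wspan n m F y (m + Suc k)"
proof -
  let ?J = "wspan n m (emb F) (emb y)"
  note PQ = flow_wspan[OF fl] flow_wspan[OF fl']
  have eP: "sderiv P' - sderiv P - (pev (cst a) N P' Q' - pev (cst a) N P Q) - pev (cst al) N' P' Q'
      \<in> ?J (n + 1 + K)"
  proof -
    have "sderiv P' - pev (cst a') N' P' Q' - (sderiv P - pev (cst a) N P Q) \<in> ?J (n + 1 + K)"
      by (rule wspan.Fil_diff[OF flowD(5)[OF fl'] flowD(5)[OF fl]])
    then show ?thesis by (simp add: a' algebra_simps)
  qed
  have eQ: "sderiv Q' - sderiv Q - (pev (cst b) N P' Q' - pev (cst b) N P Q) - pev (cst be) N' P' Q'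
      \<in> ?J (m + 1 + K)"
  proof -
    have "sderiv Q' - pev (cst b') N' P' Q' - (sderiv Q - pev (cst b) N P Q) \<in> ?J (m + 1 + K)"
      by (rule wspan.Fil_diff[OF flowD(6)[OF fl'] flowD(6)[OF fl]])
    then show ?thesis by (simp add: b' algebra_simps)
  qed
  have s0: "sev 0 (P' - P) = 0" "sev 0 (Q' - Q) = 0" using flowD(3,4)[OF fl] flowD(3,4)[OF fl'] by simp_all
  have alJ: "pev (cst al) N' P' Q' \<in> ?J (n + k)" and beJ: "pev (cst be) N' P' Q' \<in> ?J (m + k)"
    using al be PQ by (auto intro!: wspan.Fil_pev)
  have dd: "pev (cst a) N P' Q' - pev (cst a) N P Q \<in> ?J (n + 1 + d)"
    "pev (cst b) N P' Q' - pev (cst b) N P Q \<in> ?J (m + 1 + d)"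
    if "P' - P \<in> ?J (n + d)" "Q' - Q \<in> ?J (m + d)" for d
    using that a b PQ by (auto intro!: wspan.Fil_pev_diff simp del: One_nat_def)
  \<comment> \<open>Bootstrap on \<open>d\<close>: agreement of the orbits with gain
    \<open>d\<close> improves to \<open>d + 1\<close> until the added field is felt at
    \<open>k\<close>.\<close>
  have "P' - P \<in> ?J (n + d) \<and> Q' - Q \<in> ?J (m + d)" if "d \<le> k" for d
    using that
  proof (induction d)
    case 0
    show ?case using PQ by (simp add: wspan.Fil_diff)
  next
    case (Suc d)
    then have IH: "P' - P \<in> ?J (n + d)" "Q' - Q \<in> ?J (m + d)" by auto
    have "sderiv (P' - P) \<in> ?J (n + Suc d)"
    proof -
      have "sderiv P' - sderiv P - (pev (cst a) N P' Q' - pev (cst a) N P Q) - pev (cst al) N' P' Q'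
        + (pev (cst a) N P' Q' - pev (cst a) N P Q) + pev (cst al) N' P' Q' \<in> ?J (n + Suc d)"
        using eP dd(1)[OF IH] alJ Suc(2) k
        by (intro wspan.Fil_add) (auto elim!: wspan.Fil_mono)
      then show ?thesis by (simp add: algebra_simps)
    qed
    moreover have "sderiv (Q' - Q) \<in> ?J (m + Suc d)"
    proof -
      have "sderiv Q' - sderiv Q - (pev (cst b) N P' Q' - pev (cst b) N P Q) - pev (cst be) N' P' Q'
        + (pev (cst b) N P' Q' - pev (cst b) N P Q) + pev (cst be) N' P' Q' \<in> ?J (m + Suc d)"
        using eQ dd(2)[OF IH] beJ Suc(2) k
        by (intro wspan.Fil_add) (auto elim!: wspan.Fil_mono)
      then show ?thesis by (simp add: algebra_simps)
    qed
    ultimately show ?case using s0 by (blast intro: wspan_sderivD)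
  qed
  then have Dk: "P' - P \<in> ?J (n + k)" "Q' - Q \<in> ?J (m + k)" by auto
  have F1: "P' - emb F \<in> ?J (n + 1)" "Q' - emb y \<in> ?J (m + 1)" using flowD(1,2)[OF fl'] .
  have "pev (cst al) N' P' Q' - pev (cst al) N' (emb F) (emb y) \<in> ?J (n + k + 1)"
    "pev (cst be) N' P' Q' - pev (cst be) N' (emb F) (emb y) \<in> ?J (m + k + 1)"
    using al be PQ F1 by (auto intro!: wspan.Fil_pev_diff wspan_F wspan_G simp del: One_nat_def)
  note d2 = this
  have t: "sderiv (fps_const [:0, 1:] * emb g) = emb g" for g
    by (simp add: sderiv_mult pderiv_pCons)
  \<comment> \<open>\<open>[:0, 1:]\<close> is the time \<open>s\<close> itself; at time one the
    subtracted term becomes the added field at the initial curve.\<close>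
  have "P' - P - fps_const [:0, 1:] * emb (pev al N' F y) \<in> ?J (n + Suc k)"
  proof (rule wspan_sderivD)
    have "sderiv P' - sderiv P - (pev (cst a) N P' Q' - pev (cst a) N P Q) - pev (cst al) N' P' Q'
        + (pev (cst a) N P' Q' - pev (cst a) N P Q)
        + (pev (cst al) N' P' Q' - pev (cst al) N' (emb F) (emb y)) \<in> ?J (n + Suc k)"
      using eP dd(1)[OF Dk] d2(1) k by (intro wspan.Fil_add) (auto elim!: wspan.Fil_mono)
    then show "sderiv (P' - P - fps_const [:0, 1:] * emb (pev al N' F y)) \<in> ?J (n + Suc k)"
      unfolding sderiv_simps t unfolding emb_pev by (simp add: algebra_simps)
  qed (use s0 in simp)
  from sev_wspan[OF this, of 1] show "sev 1 P' - sev 1 P - pev al N' F y \<in> wspan n m F y (n + Suc k)"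
    by simp
  have "Q' - Q - fps_const [:0, 1:] * emb (pev be N' F y) \<in> ?J (m + Suc k)"
  proof (rule wspan_sderivD)
    have "sderiv Q' - sderiv Q - (pev (cst b) N P' Q' - pev (cst b) N P Q) - pev (cst be) N' P' Q'
        + (pev (cst b) N P' Q' - pev (cst b) N P Q)
        + (pev (cst be) N' P' Q' - pev (cst be) N' (emb F) (emb y)) \<in> ?J (m + Suc k)"
      using eQ dd(2)[OF Dk] d2(2) k by (intro wspan.Fil_add) (auto elim!: wspan.Fil_mono)
    then show "sderiv (Q' - Q - fps_const [:0, 1:] * emb (pev be N' F y)) \<in> ?J (m + Suc k)"
      unfolding sderiv_simps t unfolding emb_pev by (simp add: algebra_simps)
  qed (use s0 in simp)
  from sev_wspan[OF this, of 1] show "sev 1 Q' - sev 1 Q - pev be N' F y \<in> wspan n m F y (m + Suc k)"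
    by simp
qed

lemma supp_le_add:
  fixes c d :: "nat \<Rightarrow> nat \<Rightarrow> 'a::monoid_add"
  assumes "supp_le N c" "supp_le N' d" "N \<le> M" "N' \<le> M"
  shows "supp_le M (\<lambda>i j. c i j + d i j)"
  unfolding supp_le_def
proof (intro allI impI)
  fix i j assume "c i j + d i j \<noteq> 0"
  then have "c i j \<noteq> 0 \<or> d i j \<noteq> 0" by auto
  with assms show "i \<le> M \<and> j \<le> M" unfolding supp_le_def by (meson order_trans)
qed

lemma wts_add:
  fixes c d :: "nat \<Rightarrow> nat \<Rightarrow> 'a::monoid_add"
  assumes "wts n m w c" "wts n m w d"
  shows "wts n m w (\<lambda>i j. c i j + d i j)"
  unfolding wts_def
proof (intro allI impI)
  fix i j assume "c i j + d i j \<noteq> 0"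
  then have "c i j \<noteq> 0 \<or> d i j \<noteq> 0" by auto
  with assms show "w \<le> n * i + m * j" by (auto simp: wts_def)
qed

lemma wts_mono: "wts n m w c \<Longrightarrow> w' \<le> w \<Longrightarrow> wts n m w' c"
  by (auto simp: wts_def intro: order_trans)

lemma supp_le_cst: "supp_le N c \<Longrightarrow> supp_le N (cst c)"
  by (auto simp: supp_le_def cst_def)

lemma cst_add: "cst (\<lambda>i j. c i j + d i j) = (\<lambda>i j. cst c i j + cst d i j)"
  by (simp add: cst_def fun_eq_iff)

text \<open>A unipotent map is approximated, weight by weight, by the time-one map of a flow: the leading part of
  the remaining error is added to the vector field.\<close>

lemma log_exists:
  fixes F y :: "complex fps"
  assumes S: "S1 - F \<in> wspan n m F y (n + 1)" "S2 - y \<in> wspan n m F y (m + 1)"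
    and k: "1 \<le> k" "k \<le> Suc K"
  shows "\<exists>N a b P Q. supp_le N a \<and> supp_le N b \<and> wts n m (n + 1) a \<and> wts n m (m + 1) b \<and>
    flow n m F y a b N K P Q \<and> sev 1 P - S1 \<in> wspan n m F y (n + k) \<and> sev 1 Q - S2 \<in> wspan n m F y (m + k)"
  using k
proof (induction k rule: dec_induct)
  case base
  have "flow n m F y (\<lambda>_ _. 0) (\<lambda>_ _. 0) 0 K (emb F) (emb y)"
    by (auto simp: flow_def wspan_zero pev_def cst_def)
  moreover have "sev 1 (emb F) - S1 \<in> wspan n m F y (n + 1)" "sev 1 (emb y) - S2 \<in> wspan n m F y (m + 1)"
    using S[THEN wspan.Fil_minus] by simp_all
  ultimately show ?case
    by (intro exI[of _ 0] exI[of _ "\<lambda>_ _. 0"] exI[of _ "emb F"] exI[of _ "emb y"])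
       (auto simp: supp_le_def wts_def)
next
  case (step k)
  then obtain N a b P Q where IH: "supp_le N a" "supp_le N b" "wts n m (n + 1) a" "wts n m (m + 1) b"
    "flow n m F y a b N K P Q" "sev 1 P - S1 \<in> wspan n m F y (n + k)" "sev 1 Q - S2 \<in> wspan n m F y (m + k)"
    by auto
  obtain N1 al where al: "supp_le N1 al" "wts n m (n + k) al" "- (sev 1 P - S1) = pev al N1 F y"
    using wspan_imp_pev[OF wspan.Fil_minus[OF IH(6)]] by blast
  obtain N2 be where be: "supp_le N2 be" "wts n m (m + k) be" "- (sev 1 Q - S2) = pev be N2 F y"
    using wspan_imp_pev[OF wspan.Fil_minus[OF IH(7)]] by blast
  define M where "M = max N (max N1 N2)"
  define a' where "a' = (\<lambda>i j. a i j + al i j)"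
  define b' where "b' = (\<lambda>i j. b i j + be i j)"
  have s: "supp_le M a'" "supp_le M b'"
    unfolding a'_def b'_def using supp_le_add[OF IH(1) al(1)] supp_le_add[OF IH(2) be(1)] by (auto simp: M_def)
  have w: "wts n m (n + 1) a'" "wts n m (m + 1) b'"
    unfolding a'_def b'_def using IH al be step(1) by (auto intro!: wts_add elim!: wts_mono)
  obtain P' Q' where fl': "flow n m F y a' b' M K P' Q'" using flow_exists[OF w] by blast
  have e: "pev (cst a') M U V = pev (cst a) N U V + pev (cst al) M U V"
     "pev (cst b') M U V = pev (cst b) N U V + pev (cst be) M U V" for U V
    unfolding a'_def b'_def cst_add pev_add
    using pev_extend'[OF supp_le_cst[OF IH(1)], of M] pev_extend'[OF supp_le_cst[OF IH(2)], of M]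
    by (auto simp: M_def)
  have "k \<le> K" using step by simp
  note pt = flow_perturb[OF IH(5) fl' IH(3,4) al(2) be(2) step(1) this e]
  have "sev 1 P' - S1 = sev 1 P' - sev 1 P - pev al M F y"
    using al(3) pev_extend'[OF al(1), of M F y] by (simp add: M_def algebra_simps)
  moreover have "sev 1 Q' - S2 = sev 1 Q' - sev 1 Q - pev be M F y"
    using be(3) pev_extend'[OF be(1), of M F y] by (simp add: M_def algebra_simps)
  ultimately show ?case using pt s w fl' by metis
qed

text \<open>The pull-back of the differential \<open>b dX - a dY\<close> to the curve \<open>(t^n, y)\<close>; its value is one more
  than its order. Note that the coefficients come in the order of the vector field \<open>a \<partial>X + b \<partial>Y\<close>.\<close>

definition Wser :: "nat \<Rightarrow> complex fps \<Rightarrow> (nat \<Rightarrow> nat \<Rightarrow> complex) \<Rightarrow> (nat \<Rightarrow> nat \<Rightarrow> complex) \<Rightarrow> nat \<Rightarrow> complex fps" where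
  "Wser n y a b N = of_nat n * fps_X ^ (n - 1) * pev b N (fps_X ^ n) y - pev a N (fps_X ^ n) y * fps_deriv y"

section \<open>Displacement of a curve by a flow\<close>

lemma dvd_deriv: "fps_X ^ m dvd (y :: 'a::comm_ring_1 fps) \<Longrightarrow> fps_X ^ (m - 1) dvd fps_deriv y"
  by (auto simp: X_pow_dvd_iff)

lemma X_pow_dvd_mono: "fps_X ^ k dvd (f :: 'a::comm_ring_1 fps) \<Longrightarrow> l \<le> k \<Longrightarrow> fps_X ^ l dvd f"
  by (auto simp: X_pow_dvd_iff)

lemma X_pow_mult_dvd:
  "fps_X ^ k dvd (f :: 'a::comm_ring_1 fps) \<Longrightarrow> fps_X ^ l dvd g \<Longrightarrow> p \<le> k + l \<Longrightarrow> fps_X ^ p dvd f * g"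
  by (metis X_pow_dvd_mono mult_dvd_mono power_add)

lemma emb_W: "emb (Wser n y a b N) = of_nat n * fps_X ^ (n - 1) * pev (cst b) N (fps_X ^ n) (emb y)
   - pev (cst a) N (fps_X ^ n) (emb y) * emb (fps_deriv y)"
proof -
  have "emb (of_nat n) = of_nat n" by (induction n) auto
  then show ?thesis by (simp add: Wser_def emb_pev)
qed

lemma pderiv_eq_constD:
  fixes p :: "complex poly"
  assumes "of_nat n * pderiv p = [:w:]" "poly p 0 = 0" "0 < n"
  shows "p = [:0, w / of_nat n:]"
proof (rule poly_eq_by_pderiv)
  have "smult (1 / of_nat n) (of_nat n * pderiv p) = pderiv p"
    using assms(3) by (simp add: of_nat_poly)
  then have "pderiv p = [:w / of_nat n:]" unfolding assms(1) by simp
  then show "pderiv p = pderiv [:0, w / of_nat n:]" by (simp only: pderiv_pCons) simp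
qed (use assms in simp)

text \<open>With \<open>G\<close> for \<open>y\<close> composed with \<open>r\<close>, multiply the
  time derivative of \<open>Q - G\<close> by \<open>n * r ^ (n - 1)\<close>. This trades the time
  derivative of \<open>r\<close> for that of \<open>P = r ^ n\<close>; inserting the field and
  replacing \<open>Q\<close> by \<open>G\<close> leaves the form composed with \<open>r\<close>. Its
  leading coefficient does not depend on the time, so the coefficient sought is linear in
  \<open>s\<close>.\<close>

lemma flow_step:
  assumes fl: "flow n m (fps_X ^ n) y a b N K P Q" and y: "fps_X ^ m dvd y" and nm: "0 < n" "n < m"
    and a: "wts n m (n + 1) a" and b: "wts n m (m + 1) b"
    and r: "fps_X ^ 2 dvd r - fps_X" "r ^ n = P"
    and k: "m \<le> k" "k \<le> K" and W: "fps_X ^ (k + n - 1) dvd Wser n y a b N"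
    and F: "fps_X ^ k dvd Q - (emb y oo r)"
  shows "(Q - (emb y oo r)) $ k = [:0, Wser n y a b N $ (k + n - 1) / of_nat n:]"
proof -
  define G where "G = emb y oo r"
  have rX: "fps_X dvd r" and r0: "r $ 0 = 0" and r1: "r $ Suc 0 = 1" using tangent_idD[OF r(1)] by auto
  have yX: "fps_X ^ m dvd emb y" using y by (rule emb_dvd)
  have X: "fps_X ^ n dvd emb (fps_X ^ n)" by simp
  have dP: "fps_X ^ n dvd P" and dQ: "fps_X ^ m dvd Q"
    using flow_wspan[OF fl] wspan_dvd[OF _ X yX] by auto
  have eP: "fps_X ^ (n + 1 + K) dvd sderiv P - pev (cst a) N P Q"
    and eQ: "fps_X ^ (m + 1 + K) dvd sderiv Q - pev (cst b) N P Q"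
    by (rule wspan_dvd[OF flowD(5)[OF fl] X yX], rule wspan_dvd[OF flowD(6)[OF fl] X yX])
  have dG: "fps_X ^ m dvd G" unfolding G_def using yX rX by (rule compose_dvd)
  have dd: "fps_X ^ (m - 1) dvd emb (fps_deriv y) oo r"
    using compose_dvd[OF emb_dvd[OF dvd_deriv[OF y]] rX] .
  have dr: "fps_X ^ (n - 1) dvd r ^ (n - 1)" using rX by (rule dvd_power_same)
  have QG: "fps_X ^ (m + (k - m)) dvd Q - G" using F k by (simp add: G_def)
  have PP: "fps_X ^ (n + (k - m)) dvd P - P" by simp
  have da: "fps_X ^ (n + 1 + (k - m)) dvd pev (cst a) N P Q - pev (cst a) N P G"
    using tadic.Fil_pev_diff[of n m "n + 1" "cst a" P P "k - m" Q G N] a dP PP dQ dG QG by simp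
  have db: "fps_X ^ (m + 1 + (k - m)) dvd pev (cst b) N P Q - pev (cst b) N P G"
    using tadic.Fil_pev_diff[of n m "m + 1" "cst b" P P "k - m" Q G N] b dP PP dQ dG QG by simp
  have "fps_X oo r = r" using r0 by simp
  then have Xr: "fps_X ^ i oo r = r ^ i" for i using fps_compose_power[OF r0, of fps_X i] by simp
  have cn: "of_nat n oo r = of_nat n" by (simp flip: fps_of_nat)
  have Wr: "emb (Wser n y a b N) oo r = of_nat n * r ^ (n - 1) * pev (cst b) N P G
      - pev (cst a) N P G * (emb (fps_deriv y) oo r)"
    unfolding emb_W fps_compose_sub_distrib fps_compose_mult_distrib[OF r0] pev_compose[OF rX]
    by (simp add: Xr cn r(2) G_def)
  have sP: "of_nat n * r ^ (n - 1) * sderiv r = sderiv P" using r(2) sderiv_power[of r n] by simp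
  have sF: "of_nat n * r ^ (n - 1) * sderiv (Q - G)
      = of_nat n * r ^ (n - 1) * sderiv Q - (emb (fps_deriv y) oo r) * sderiv P"
    unfolding sP[symmetric] G_def sderiv_simps sderiv_compose[OF rX] by (simp add: algebra_simps)
  \<comment> \<open>Four errors: the defects of the truncated flow in \<open>P\<close> and in
    \<open>Q\<close>, and the replacement of \<open>Q\<close> by \<open>G\<close> in both components
    of the field. Each has order at least \<open>k + n\<close>, beyond the coefficient
    inspected.\<close>
  have "of_nat n * r ^ (n - 1) * sderiv (Q - G) - (emb (Wser n y a b N) oo r)
     = of_nat n * (r ^ (n - 1) * (sderiv Q - pev (cst b) N P Q))
      + of_nat n * (r ^ (n - 1) * (pev (cst b) N P Q - pev (cst b) N P G))
      - ((emb (fps_deriv y) oo r) * (sderiv P - pev (cst a) N P Q)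
       + (emb (fps_deriv y) oo r) * (pev (cst a) N P Q - pev (cst a) N P G))"
    unfolding sF Wr by (simp add: algebra_simps)
  also have "fps_X ^ (k + n) dvd \<dots>"
    using nm k
    by (intro dvd_diff dvd_add dvd_mult X_pow_mult_dvd[OF dr eQ] X_pow_mult_dvd[OF dr db]
          X_pow_mult_dvd[OF dd eP] X_pow_mult_dvd[OF dd da]) auto
  finally have "(of_nat n * r ^ (n - 1) * sderiv (Q - G) - (emb (Wser n y a b N) oo r)) $ (k + n - 1) = 0"
    using nm by (simp add: X_pow_dvd_iff)
  then have 1: "(of_nat n * r ^ (n - 1) * sderiv (Q - G)) $ (k + n - 1) = (emb (Wser n y a b N) oo r) $ (k + n - 1)"
    by simp
  have 2: "(emb (Wser n y a b N) oo r) $ (k + n - 1) = [:Wser n y a b N $ (k + n - 1):]"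
    using compose_nth_lead[OF emb_dvd[OF W] rX] r1 by simp
  have "fps_X ^ k dvd sderiv (Q - G)" using F by (auto simp: X_pow_dvd_iff G_def)
  from mult_nth_lead[OF dr this]
  have "(r ^ (n - 1) * sderiv (Q - G)) $ (n - 1 + k) = pderiv ((Q - G) $ k)"
    using power_nth_lead[OF rX, of "n - 1"] r1 by (simp add: pderiv_diff)
  moreover have "n - 1 + k = k + n - 1" using nm by simp
  ultimately have "of_nat n * pderiv ((Q - G) $ k) = [:Wser n y a b N $ (k + n - 1):]"
    using 1 2 by (simp add: mult.assoc fps_mult_left_const_nth flip: fps_of_nat)
  \<comment> \<open>At time 0 the root is \<open>t\<close>, since roots tangent to the identity are
    unique; hence the displacement starts from zero.\<close>
  moreover have "sev 0 r = fps_X"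
  proof (rule root_unique)
    have "fps_X ^ 2 dvd sev 0 (r - fps_X)" using r(1) by (rule sev_dvd)
    then show "fps_X ^ 2 dvd sev 0 r - fps_X" by simp
    show "sev 0 r ^ n = fps_X ^ n" using r(2) flowD(3)[OF fl] by (metis sev_power)
  qed (use nm in auto)
  then have "sev 0 (Q - G) = 0" using flowD(4)[OF fl] by (simp add: G_def sev_compose)
  then have "poly ((Q - G) $ k) 0 = 0" by (metis fps_zero_nth sev_nth)
  ultimately show ?thesis using pderiv_eq_constD nm unfolding G_def by blast
qed

text \<open>The form has zero coefficients before the exponent \<open>k + n - 1\<close>, so
  \<open>flow_step\<close> raises the order of the displacement one exponent at a time until it
  reaches \<open>k\<close>.\<close>

theorem flow_displacement:
  assumes fl: "flow n m (fps_X ^ n) y a b N K P Q" and y: "fps_X ^ m dvd y" and nm: "0 < n" "n < m"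
    and a: "wts n m (n + 1) a" and b: "wts n m (m + 1) b"
    and r: "fps_X ^ 2 dvd r - fps_X" "r ^ n = P"
    and k: "m \<le> k" "k \<le> K" and W: "fps_X ^ (k + n - 1) dvd Wser n y a b N"
  shows "fps_X ^ k dvd sev 1 Q - (y oo sev 1 r)"
    "(sev 1 Q - (y oo sev 1 r)) $ k = Wser n y a b N $ (k + n - 1) / of_nat n"
proof -
  have yX: "fps_X ^ m dvd emb y" using y by (rule emb_dvd)
  have "fps_X ^ l dvd Q - (emb y oo r)" if "m \<le> l" "l \<le> k" for l
    using that
  proof (induction l rule: dec_induct)
    case base
    have "fps_X ^ m dvd Q" using flow_wspan(2)[OF fl] wspan_dvd[OF _ _ yX] by auto
    moreover have "fps_X ^ m dvd emb y oo r" using compose_dvd[OF yX] tangent_idD(3)[OF r(1)] by blast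
    ultimately show ?case by (rule dvd_diff)
  next
    case (step l)
    then have IH: "fps_X ^ l dvd Q - (emb y oo r)" and l: "m \<le> l" "l < k" by auto
    have Wl: "fps_X ^ (l + n - 1) dvd Wser n y a b N" "Wser n y a b N $ (l + n - 1) = 0"
      using W l nm by (auto simp: X_pow_dvd_iff)
    have "(Q - (emb y oo r)) $ l = 0"
      using flow_step[OF fl y nm a b r l(1) _ Wl(1) IH] l k Wl(2) by simp
    with IH show ?case unfolding X_pow_dvd_iff using less_Suc_eq by auto
  qed
  then have F: "fps_X ^ k dvd Q - (emb y oo r)" using k by simp
  have e: "sev 1 (Q - (emb y oo r)) = sev 1 Q - (y oo sev 1 r)" by (simp add: sev_compose)
  show "fps_X ^ k dvd sev 1 Q - (y oo sev 1 r)" using sev_dvd[OF F, of 1] unfolding e .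
  show "(sev 1 Q - (y oo sev 1 r)) $ k = Wser n y a b N $ (k + n - 1) / of_nat n"
    using flow_step[OF fl y nm a b r k W F] unfolding e[symmetric] sev_nth by simp
qed

text \<open>The time-one orbit in a shape that can be realised analytically: a polynomial change of
  coordinates \<open>(X + u, Y + v)\<close> and a reparametrization \<open>r\<close> that turns the
  first component back into a power.\<close>

lemma formal_elimination:
  assumes y: "fps_X ^ m dvd y" and nm: "0 < n" "n < m"
    and a: "wts n m (n + 1) a" and b: "wts n m (m + 1) b"
    and k: "m \<le> k" and W: "fps_X ^ (k + n - 1) dvd Wser n y a b N"
  obtains M u v r where "supp_le M u" "supp_le M v" "wts n m (n + 1) u" "wts n m (m + 1) v"
    "fps_X ^ 2 dvd r - fps_X" "r ^ n = fps_X ^ n + pev u M (fps_X ^ n) y"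
    "fps_X ^ k dvd y + pev v M (fps_X ^ n) y - (y oo r)"
    "(y + pev v M (fps_X ^ n) y - (y oo r)) $ k = Wser n y a b N $ (k + n - 1) / of_nat n"
proof -
  obtain P Q where fl: "flow n m (fps_X ^ n) y a b N k P Q" using flow_exists[OF a b] by blast
  have yX: "fps_X ^ m dvd emb y" using y by (rule emb_dvd)
  have X: "fps_X ^ n dvd emb (fps_X ^ n)" by simp
  have "fps_X ^ Suc n dvd P - fps_X ^ n" using wspan_dvd[OF flowD(1)[OF fl] X yX] by simp
  then obtain r where r: "fps_X ^ 2 dvd r - fps_X" "r ^ n = P" using root_exists nm by blast
  note D = flow_displacement[OF fl y nm a b r k order.refl W]
  obtain M1 u where u: "supp_le M1 u" "wts n m (n + 1) u" "sev 1 P - fps_X ^ n = pev u M1 (fps_X ^ n) y"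
    using wspan_imp_pev[OF sev_wspan[OF flowD(1)[OF fl], of 1]] by auto
  obtain M2 v where v: "supp_le M2 v" "wts n m (m + 1) v" "sev 1 Q - y = pev v M2 (fps_X ^ n) y"
    using wspan_imp_pev[OF sev_wspan[OF flowD(2)[OF fl], of 1]] by auto
  define M where "M = max M1 M2"
  have u': "sev 1 P = fps_X ^ n + pev u M (fps_X ^ n) y"
    using u(3) pev_extend'[OF u(1), of M "fps_X ^ n" y] by (simp add: M_def algebra_simps)
  have v': "sev 1 Q = y + pev v M (fps_X ^ n) y"
    using v(3) pev_extend'[OF v(1), of M "fps_X ^ n" y] by (simp add: M_def algebra_simps)
  show ?thesis
  proof (rule that)
    show "supp_le M u" "supp_le M v" using u(1) v(1) by (auto simp: supp_le_def M_def le_max_iff_disj)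
    show "fps_X ^ 2 dvd sev 1 r - fps_X" using sev_dvd[OF r(1), of 1] by simp
    show "sev 1 r ^ n = fps_X ^ n + pev u M (fps_X ^ n) y" using r(2) u' by (metis sev_power)
  qed (use D u(2) v(2) in \<open>simp_all add: v'\<close>)
qed

lemma compose_cong_dvd:
  fixes f g h :: "'a::comm_ring_1 fps"
  assumes "fps_X ^ N dvd g - h" "fps_X dvd g" "fps_X dvd h"
  shows "fps_X ^ N dvd (f oo g) - (f oo h)"
  unfolding X_pow_dvd_iff
proof (intro allI impI)
  fix i assume "i < N"
  have "(g ^ j) $ i = (h ^ j) $ i" for j
  proof -
    have "g - h dvd g ^ j - h ^ j" by (simp add: power_diff_sumr2)
    with assms(1) have "fps_X ^ N dvd g ^ j - h ^ j" by (rule dvd_trans)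
    with \<open>i < N\<close> show ?thesis by (auto simp: X_pow_dvd_iff)
  qed
  then show "((f oo g) - (f oo h)) $ i = 0"
    using fps_compose_nth_atMost[OF assms(2), of i i f] fps_compose_nth_atMost[OF assms(3), of i i f] by simp
qed

lemma Wser_dvd:
  assumes y: "fps_X ^ m dvd y" and nm: "0 < n"
    and a: "wts n m (n + 1) a" and b: "wts n m (m + 1) b"
  shows "fps_X ^ (m + n) dvd Wser n y a b N"
proof -
  have "fps_X ^ (n + 1) dvd pev a N (fps_X ^ n) y" "fps_X ^ (m + 1) dvd pev b N (fps_X ^ n) y"
    using tadic.Fil_pev[OF a, of "fps_X ^ n" y N] tadic.Fil_pev[OF b, of "fps_X ^ n" y N] y by simp_all
  then show ?thesis unfolding Wser_def mult.assoc using nm dvd_deriv[OF y]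
    by (intro dvd_diff dvd_mult[of _ _ "of_nat n"] X_pow_mult_dvd[of "n - 1" _ "m + 1"] X_pow_mult_dvd[of "n + 1" _ "m - 1"]) auto
qed

text \<open>The unipotent map is replaced by a flow to precision \<open>M\<close>. The
  reparametrization of the flow then agrees with \<open>rho\<close> far enough that its displacement
  begins like \<open>y' - y\<close>, and \<open>flow_displacement\<close> identifies this beginning
  with that of the form.\<close>

theorem formal_uniqueness:
  assumes y: "fps_X ^ m dvd y" and y': "fps_X ^ m dvd y'" and ne: "y' \<noteq> y" and nm: "0 < n" "n < m"
    and S: "S1 - fps_X ^ n \<in> wspan n m (fps_X ^ n) y (n + 1)" "S2 - y \<in> wspan n m (fps_X ^ n) y (m + 1)"
    and rho: "fps_X ^ 2 dvd rho - fps_X" and M: "subdegree (y' - y) + n \<le> M"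
    and d: "fps_X ^ M dvd rho ^ n - S1" "fps_X ^ M dvd (y' oo rho) - S2"
  obtains N a b where "wts n m (n + 1) a" "wts n m (m + 1) b"
    "fps_X ^ (subdegree (y' - y) + n - 1) dvd Wser n y a b N"
    "Wser n y a b N $ (subdegree (y' - y) + n - 1) \<noteq> 0"
proof -
  define l where "l = subdegree (y' - y)"
  have M1: "1 \<le> M" "M \<le> Suc M" using M nm by auto
  obtain N a b P Q where *: "wts n m (n + 1) a" "wts n m (m + 1) b"
    "flow n m (fps_X ^ n) y a b N M P Q"
    "sev 1 P - S1 \<in> wspan n m (fps_X ^ n) y (n + M)" "sev 1 Q - S2 \<in> wspan n m (fps_X ^ n) y (m + M)"
    using log_exists[OF S M1] by blast
  note ab = *(1,2) and fl = *(3)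
  have yX: "fps_X ^ m dvd emb y" using y by (rule emb_dvd)
  have X: "fps_X ^ n dvd emb (fps_X ^ n)" by simp
  have "fps_X ^ Suc n dvd P - fps_X ^ n" using wspan_dvd[OF flowD(1)[OF fl] X yX] by simp
  then obtain r where r: "fps_X ^ 2 dvd r - fps_X" "r ^ n = P" using root_exists nm by blast
  define r1 where "r1 = sev 1 r"
  have r1: "fps_X ^ 2 dvd r1 - fps_X" "r1 ^ n = sev 1 P"
    using sev_dvd[OF r(1), of 1] r(2) by (auto simp: r1_def simp flip: sev_power)
  have e: "fps_X ^ M dvd sev 1 P - S1" "fps_X ^ M dvd sev 1 Q - S2"
    using wspan_dvd[OF *(4) _ y] wspan_dvd[OF *(5) _ y] by (auto elim: X_pow_dvd_mono)
  have "fps_X ^ M dvd (rho ^ n - S1) - (sev 1 P - S1)" using d(1) e(1) by (rule dvd_diff)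
  \<comment> \<open>The root loses \<open>n - 1\<close> orders; this is why the precision
    \<open>M\<close> has to reach \<open>l + n\<close>.\<close>
  then have "fps_X ^ (Suc l + n - 1) dvd rho ^ n - r1 ^ n"
    using M by (auto simp: r1 l_def elim!: X_pow_dvd_mono)
  then have "fps_X ^ Suc l dvd rho - r1" using root_congruence[OF rho r1(1) nm(1)] by blast
  then have yy: "fps_X ^ Suc l dvd (y oo rho) - (y oo r1)"
    using tangent_idD(3)[OF rho] tangent_idD(3)[OF r1(1)] by (rule compose_cong_dvd)
  define D where "D = sev 1 Q - (y oo r1)"
  have "fps_X ^ Suc l dvd (sev 1 Q - S2) - ((y' oo rho) - S2) + ((y oo rho) - (y oo r1))"
  proof -
    have "Suc l \<le> M" using M nm by (simp add: l_def)
    from dvd_add[OF dvd_diff[OF X_pow_dvd_mono[OF e(2) this] X_pow_dvd_mono[OF d(2) this]] yy]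
    show ?thesis .
  qed
  then have D1: "fps_X ^ Suc l dvd D - ((y' - y) oo rho)"
    by (simp add: D_def fps_compose_sub_distrib algebra_simps del: power_Suc)
  have lead: "fps_X ^ l dvd y' - y" 
    unfolding X_pow_dvd_iff l_def by (blast intro: nth_less_subdegree_zero)
  have comp: "fps_X ^ l dvd (y' - y) oo rho" "((y' - y) oo rho) $ l = (y' - y) $ l"
    using compose_dvd[OF lead tangent_idD(3)[OF rho]] compose_nth_lead[OF lead tangent_idD(3)[OF rho]]
      tangent_idD(2)[OF rho] by auto
  have D0: "D $ i = 0" if "i < l" for i
    using that D1 comp(1) unfolding X_pow_dvd_iff by (force simp: less_Suc_eq)
  have Dl: "D $ l = (y' - y) $ l" using D1 comp(2) unfolding X_pow_dvd_iff by (force simp: less_Suc_eq)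
  have ml: "m \<le> l" unfolding l_def using ne y y' by (intro subdegree_geI) (auto simp: X_pow_dvd_iff)
  have disp: "D $ k = Wser n y a b N $ (k + n - 1) / of_nat n"
    if "m \<le> k" "k \<le> l" "fps_X ^ (k + n - 1) dvd Wser n y a b N" for k
    using flow_displacement(2)[OF fl y nm ab r that(1) _ that(3)] that M by (simp add: D_def r1_def l_def)
  \<comment> \<open>The displacement formula at \<open>k\<close> presupposes that the form vanishes
    before; as the displacement is zero at every \<open>k < l\<close>, the formula then gives the
    next vanishing coefficient.\<close>
  have W: "fps_X ^ (k + n - 1) dvd Wser n y a b N" if "m \<le> k" "k \<le> l" for k
    using that
  proof (induction k rule: dec_induct)
    case base
    show ?case using Wser_dvd[OF y nm(1) ab, of N] by (rule X_pow_dvd_mono) simp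
  next
    case (step k)
    then have "Wser n y a b N $ (k + n - 1) = 0" using disp[of k] D0[of k] nm by simp
    moreover have "fps_X ^ (k + n - 1) dvd Wser n y a b N" using step by simp
    moreover have e: "Suc k + n - 1 = Suc (k + n - 1)" using nm by simp
    ultimately show ?case unfolding X_pow_dvd_iff e by (metis less_Suc_eq)
  qed
  have "(y' - y) $ l \<noteq> 0" unfolding l_def using ne by (intro nth_subdegree_nonzero) simp
  then have "Wser n y a b N $ (l + n - 1) \<noteq> 0" using disp[OF ml order.refl W[OF ml order.refl]] Dl by auto
  then show ?thesis using that[OF ab W[OF ml order.refl, unfolded l_def]] by (simp add: l_def)
qed

section \<open>Curves close to a monomial curve\<close>

definition Sg :: "nat \<Rightarrow> nat \<Rightarrow> nat set" where
  "Sg n m = {n * i + m * j | i j. True}"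

lemma Sg_add: "p \<in> Sg n m \<Longrightarrow> q \<in> Sg n m \<Longrightarrow> p + q \<in> Sg n m"
proof -
  assume "p \<in> Sg n m" "q \<in> Sg n m"
  then obtain i j i' j' where "p = n * i + m * j" "q = n * i' + m * j'" by (auto simp: Sg_def)
  then have "p + q = n * (i + i') + m * (j + j')" by (simp add: algebra_simps)
  then show ?thesis unfolding Sg_def by blast
qed

lemma Sg_base: "0 \<in> Sg n m" "n \<in> Sg n m" "m \<in> Sg n m"
proof -
  have "0 = n * 0 + m * 0" "n = n * 1 + m * 0" "m = n * 0 + m * 1" by auto
  then show "0 \<in> Sg n m" "n \<in> Sg n m" "m \<in> Sg n m" unfolding Sg_def by blast+
qed

lemma Sg_below: "p \<in> Sg n m \<Longrightarrow> p < m \<Longrightarrow> n dvd p"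
proof -
  assume "p \<in> Sg n m" "p < m"
  then obtain i j where ij: "p = n * i + m * j" by (auto simp: Sg_def)
  with \<open>p < m\<close> have "j = 0" by (cases j) auto
  with ij show ?thesis by simp
qed

text \<open>Exponents from \<open>K\<close> on are free: the curves considered agree with the
  monomial curve below \<open>K\<close> only, and the lemmas that follow track how far this
  knowledge survives.\<close>

definition ssup :: "nat set \<Rightarrow> nat \<Rightarrow> 'a::zero fps \<Rightarrow> bool" where
  "ssup S K f \<longleftrightarrow> (\<forall>k<K. f $ k \<noteq> 0 \<longrightarrow> k \<in> S)"

lemma ssup_mono: "ssup S K f \<Longrightarrow> K' \<le> K \<Longrightarrow> ssup S K' f"
  by (auto simp: ssup_def)

lemma ssup_X_pow: "n \<in> S \<Longrightarrow> ssup S K (fps_X ^ n :: 'a::comm_ring_1 fps)"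
  by (auto simp: ssup_def)

lemma mult_nth_nonzeroD:
  fixes f g :: "'a::comm_ring_1 fps"
  assumes "(f * g) $ k \<noteq> 0"
  obtains i where "i \<le> k" "f $ i \<noteq> 0" "g $ (k - i) \<noteq> 0"
proof -
  from sum.not_neutral_contains_not_neutral[OF assms[unfolded fps_mult_nth]]
  obtain i where "i \<in> {0..k}" "f $ i * g $ (k - i) \<noteq> 0" .
  then show ?thesis using that[of i] by force
qed

text \<open>Below exponent \<open>K\<close> the factor \<open>f\<close> matters only below
  \<open>K - q\<close>, since \<open>g\<close> has order at least \<open>q\<close>, and
  symmetrically for \<open>g\<close>.\<close>

lemma ssup_mult:
  fixes f g :: "'a::comm_ring_1 fps"
  assumes "\<And>p q. p \<in> S \<Longrightarrow> q \<in> S \<Longrightarrow> p + q \<in> S"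
    and "fps_X ^ p dvd f" "fps_X ^ q dvd g" "ssup S (K - q) f" "ssup S (K - p) g"
  shows "ssup S K (f * g)"
  unfolding ssup_def
proof (intro allI impI)
  fix k assume k: "k < K" "(f * g) $ k \<noteq> 0"
  obtain i where i: "i \<le> k" and nz: "f $ i \<noteq> 0" "g $ (k - i) \<noteq> 0"
    using mult_nth_nonzeroD[OF k(2)] .
  then have "p \<le> i" "q \<le> k - i" using assms(2,3) by (auto simp: X_pow_dvd_iff not_less[symmetric])
  then have "i < K - q" "k - i < K - p" using k(1) i by auto
  then have "i \<in> S" "k - i \<in> S" using assms(4,5) nz by (auto simp: ssup_def)
  then show "k \<in> S" using assms(1)[of i "k - i"] i by simp
qed

lemma ssup_pow:
  fixes y :: "'a::comm_ring_1 fps"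
  assumes "\<And>p q. p \<in> S \<Longrightarrow> q \<in> S \<Longrightarrow> p + q \<in> S" "0 \<in> S"
    and "fps_X ^ m dvd y" "ssup S K y"
  shows "ssup S (m * j + K - m) (y ^ j)"
proof (induction j)
  case (Suc j)
  have 1: "fps_X ^ (m * j) dvd y ^ j" using dvd_power_same[OF assms(3), of j] by (simp add: power_mult)
  show ?case
  proof (cases "m \<le> K")
    case True
    have "ssup S (m * Suc j + K - m) (y * y ^ j)"
      using Suc assms(4) True by (intro ssup_mult[OF assms(1) assms(3) 1]) (auto elim!: ssup_mono)
    then show ?thesis by simp
  next
    case False
    have "fps_X ^ (m * Suc j) dvd y ^ Suc j"
      using dvd_power_same[OF assms(3), of "Suc j"] by (simp only: power_mult)
    then have "(y ^ Suc j) $ k = 0" if "k < m * Suc j + K - m" for k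
      using that False unfolding X_pow_dvd_iff by simp
    then show ?thesis by (simp add: ssup_def)
  qed
qed (auto simp: ssup_def assms fps_one_nth)

lemma ssup_sum: "(\<And>i. i \<in> A \<Longrightarrow> ssup S K (f i)) \<Longrightarrow> ssup S K (sum f A)"
  unfolding ssup_def fps_sum_nth by (blast elim: sum.not_neutral_contains_not_neutral)

text \<open>Replacing one factor \<open>y\<close> of a monomial by the unknown tail gives up the
  order \<open>m\<close> and brings in the order \<open>K\<close>, so exponents are controlled below
  \<open>w + K - m\<close>.\<close>

lemma ssup_pev:
  fixes y :: "complex fps"
  assumes y: "fps_X ^ m dvd y" "ssup (Sg n m) K y" and m: "m \<le> K" and c: "wts n m w c"
  shows "ssup (Sg n m) (w + K - m) (pev c N (fps_X ^ n) y)"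
  unfolding pev_def
proof (intro ssup_sum)
  fix i j
  show "ssup (Sg n m) (w + K - m) (fps_const (c i j) * (fps_X ^ n) ^ i * y ^ j)"
  proof (cases "c i j = 0")
    case False
    then have w: "w \<le> n * i + m * j" using c wtsD by blast
    have 1: "fps_X ^ (m * j) dvd y ^ j" using dvd_power_same[OF y(1), of j] by (simp add: power_mult)
    have 2: "n * i \<in> Sg n m" unfolding Sg_def by (auto intro: exI[of _ i] exI[of _ 0])
    have "ssup (Sg n m) (w + K - m) ((fps_X ^ n) ^ i * y ^ j)"
    proof (rule ssup_mult[OF Sg_add _ 1])
      show "fps_X ^ (n * i) dvd ((fps_X ^ n) ^ i :: complex fps)" by (simp add: power_mult)
      show "ssup (Sg n m) (w + K - m - m * j) ((fps_X ^ n) ^ i :: complex fps)"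
        using ssup_X_pow[OF 2] by (simp add: power_mult)
      show "ssup (Sg n m) (w + K - m - n * i) (y ^ j)"
        using ssup_pow[OF Sg_add Sg_base(1) y, of j] w m by (auto elim!: ssup_mono)
    qed
    then show ?thesis by (auto simp: ssup_def mult.assoc)
  qed (simp add: ssup_def)
qed

lemma ssup_pev_all:
  fixes y :: "complex fps"
  assumes S: "ssup (Sg n m) K y"
  shows "ssup (Sg n m) K (pev c N (fps_X ^ n) y)"
  unfolding pev_def
proof (intro ssup_sum)
  fix i j
  have 1: "fps_X ^ 0 dvd f" for f :: "complex fps" by simp
  have "n * i \<in> Sg n m" unfolding Sg_def by (auto intro: exI[of _ i] exI[of _ 0])
  then have "ssup (Sg n m) K ((fps_X ^ n) ^ i :: complex fps)" using ssup_X_pow by (simp flip: power_mult)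
  moreover have "ssup (Sg n m) K (y ^ j)"
  proof (induction j)
    case (Suc j)
    then show ?case using ssup_mult[OF Sg_add 1 1, where K = K and f = y and g = "y ^ j"] S by simp
  qed (auto simp: ssup_def Sg_base)
  ultimately have "ssup (Sg n m) K ((fps_X ^ n) ^ i * y ^ j)"
    using ssup_mult[OF Sg_add 1 1, where K = K and f = "(fps_X ^ n) ^ i" and g = "y ^ j"] by simp
  then show "ssup (Sg n m) K (fps_const (c i j) * (fps_X ^ n) ^ i * y ^ j)"
    by (auto simp: ssup_def mult.assoc)
qed

lemma ssup_near:
  assumes "fps_X ^ K dvd y - fps_X ^ m"
  shows "ssup (Sg n m) K (y :: complex fps)"
  using assms Sg_base(3)[of m n] by (auto simp: ssup_def X_pow_dvd_iff split: if_splits)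

section \<open>Reading weights off orders near the monomial curve\<close>

lemma wts_0: "wts n m 0 c" by (simp add: wts_def)

lemma near_dvd: "fps_X ^ K dvd y - fps_X ^ m \<Longrightarrow> m \<le> K \<Longrightarrow> fps_X ^ m dvd (y :: complex fps)"
  using dvd_add[OF X_pow_dvd_mono, of K "y - fps_X ^ m" m "fps_X ^ m"] by simp

lemma near_nth: "fps_X ^ K dvd y - fps_X ^ m \<Longrightarrow> m < K \<Longrightarrow> (y :: complex fps) $ m = 1"
  by (auto simp: X_pow_dvd_iff)

lemma pev_nth_0: "fps_X dvd F \<Longrightarrow> fps_X dvd G \<Longrightarrow> (pev c N F G) $ 0 = (c 0 0 :: complex)"
  using pev_cong_trunc[of F G 0 N c] by (simp add: pev_def X_dvd_iff)

text \<open>For weights up to \<open>n + m\<close> the representation \<open>n * i + m * j\<close>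
  is unique: \<open>j\<close> is 0 or 1 because \<open>n + m < 2 * m\<close>, and \<open>n\<close>
  does not divide \<open>m\<close>. Hence nothing cancels in the lowest weight.\<close>

lemma pev_lead:
  fixes y :: "complex fps"
  assumes n: "0 < n" "n < m" "\<not> n dvd m" and y: "fps_X ^ m dvd y" "y $ m = 1"
    and c: "wts n m w c" and w: "n * i + m * j = w" "w \<le> n + m" "i \<le> N" "j \<le> N"
  shows "pev c N (fps_X ^ n) y $ w = c i j"
proof -
  have nth: "(fps_const (c i' j') * (fps_X ^ n) ^ i' * y ^ j') $ w = (if i' = i \<and> j' = j then c i j else 0)"
    for i' j'
  proof -
    have e: "(fps_const (c i' j') * (fps_X ^ n) ^ i' * y ^ j') $ w = c i' j' * (fps_X ^ (n * i') * y ^ j') $ w"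
      by (simp add: mult.assoc power_mult)
    have d: "fps_X ^ (m * j') dvd y ^ j'" using dvd_power_same[OF y(1), of j'] by (simp add: power_mult)
    have yj: "(y ^ j') $ (m * j') = 1"
    proof (induction j')
      case (Suc j')
      have "(y * y ^ j') $ (m + m * j') = y $ m * (y ^ j') $ (m * j')"
        using dvd_power_same[OF y(1), of j'] by (intro mult_nth_lead y) (simp add: power_mult)
      with Suc y(2) show ?case by simp
    qed simp
    consider "c i' j' = 0" | "w < n * i' + m * j'" | "c i' j' \<noteq> 0" "n * i' + m * j' = w"
      using wtsD[OF c, of i' j'] by linarith
    then show ?thesis
    proof cases
      case 2
      have "fps_X ^ (n * i' + m * j') dvd fps_X ^ (n * i') * y ^ j'"
        unfolding power_add using d by (rule mult_dvd_mono[OF dvd_refl])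
      then have "(fps_X ^ (n * i') * y ^ j') $ w = 0" using 2 unfolding X_pow_dvd_iff by blast
      then show ?thesis using 2 w(1) unfolding e by auto
    next
      case 3
      have "m * j' < m * 2" "m * j < m * 2" using 3(2) w n by linarith+
      then have "j' < 2" "j < 2" by simp_all
      then have jj: "j' = 0 \<or> j' = 1" "j = 0 \<or> j = 1" by auto
      have no: False if "n * p = n * q + m" for p q
        using that n(3) by (metis dvd_add_right_iff dvd_triv_left)
      have "j' = j" using jj 3(2) w(1) no[of i' i] no[of i i'] by auto
      moreover from this have "i' = i" using 3(2) w(1) n by (metis add_right_cancel mult_cancel_left not_gr0)
      moreover have "(fps_X ^ (n * i') * y ^ j') $ w = 1"
        using yj 3(2) by (auto simp: fps_X_power_mult_nth)
      ultimately show ?thesis unfolding e by simp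
    qed (use e in auto)
  qed
  have "pev c N (fps_X ^ n) y $ w = (\<Sum>i'\<le>N. \<Sum>j'\<le>N. if i' = i \<and> j' = j then c i j else 0)"
    unfolding pev_def fps_sum_nth nth ..
  also have "\<dots> = (\<Sum>i'\<le>N. if i' = i then (\<Sum>j'\<le>N. if j' = j then c i j else 0) else 0)"
    by (intro sum.cong refl) auto
  also have "\<dots> = c i j" using w by simp
  finally show ?thesis .
qed

text \<open>The weights up to \<open>p\<close> are peeled off in turn: by \<open>pev_lead\<close> a
  coefficient of the lowest remaining weight would be visible in the series. The conclusion concerns
  the whole table, also beyond \<open>N\<close>, because a monomial of weight at most
  \<open>p\<close> has both exponents at most \<open>p\<close>.\<close>

lemma low_weights:
  fixes y :: "complex fps"
  assumes n: "0 < n" "n < m" "\<not> n dvd m" and y: "fps_X ^ m dvd y" "y $ m = 1"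
    and d: "fps_X ^ Suc p dvd pev c N (fps_X ^ n) y" and p: "p \<le> n + m" "p \<le> N"
  shows "wts n m (Suc p) c"
proof -
  have "wts n m w c" if "w \<le> Suc p" for w
    using that
  proof (induction w)
    case (Suc w)
    then have IH: "wts n m w c" by simp
    show ?case unfolding wts_def
    proof (intro allI impI, rule ccontr)
      fix i j assume ij: "c i j \<noteq> 0" "\<not> Suc w \<le> n * i + m * j"
      then have w: "n * i + m * j = w" using wtsD[OF IH] by force
      have "i \<le> n * i" "j \<le> m * j" using n by auto
      then have "i \<le> w" "j \<le> w" using w by linarith+
      then have "i \<le> N" "j \<le> N" using Suc(2) p by auto
      then have "pev c N (fps_X ^ n) y $ w = c i j"
        using pev_lead[OF n y IH w] Suc(2) p by simp
      moreover have "pev c N (fps_X ^ n) y $ w = 0" using d Suc(2) unfolding X_pow_dvd_iff by simp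
      ultimately show False using ij by simp
    qed
  qed (simp add: wts_0)
  then show ?thesis by simp
qed

lemma Wser_nth:
  assumes "0 < n"
  shows "Wser n y a b N $ (q + n - 1) = of_nat n * pev b N (fps_X ^ n) y $ q
     - (pev a N (fps_X ^ n) y * fps_deriv y) $ (q + n - 1)"
proof -
  have "(fps_X ^ (n - 1) * pev b N (fps_X ^ n) y) $ (q + n - 1) = pev b N (fps_X ^ n) y $ q"
    using assms by (simp add: fps_X_power_mult_nth)
  then show ?thesis unfolding Wser_def mult.assoc
    by (simp add: fps_mult_left_const_nth flip: fps_of_nat)
qed

text \<open>A constant term of \<open>a\<close> produces \<open>t ^ (m - 1)\<close> through the
  derivative of \<open>y\<close>, and only a term \<open>t ^ (m - n)\<close> in the other component
  could cancel it. Near the monomial curve that exponent would lie in \<open>Sg n m\<close>, which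
  forces \<open>n\<close> to divide \<open>m\<close>.\<close>

lemma const_coeff_zero:
  fixes y :: "complex fps"
  assumes n: "0 < n" "n < m" "\<not> n dvd m" and y: "fps_X ^ K dvd y - fps_X ^ m" "m < K"
    and W: "fps_X ^ m dvd Wser n y a b N"
  shows "a 0 0 = 0"
proof (rule ccontr)
  assume a0: "a 0 0 \<noteq> 0"
  have ym: "fps_X ^ m dvd y" "y $ m = 1" using near_dvd[OF y(1)] near_nth[OF y(1)] y(2) by simp_all
  have Xy: "fps_X dvd y" "fps_X dvd (fps_X ^ n :: complex fps)"
    using X_pow_dvd_mono[OF ym(1), of 1] n by auto
  have "(pev a N (fps_X ^ n) y * fps_deriv y) $ (0 + (m - 1)) = pev a N (fps_X ^ n) y $ 0 * fps_deriv y $ (m - 1)"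
    using dvd_deriv[OF ym(1)] by (intro mult_nth_lead) auto
  also have "\<dots> = a 0 0 * of_nat m" using n ym(2) pev_nth_0[OF Xy(2,1)] by simp
  finally have 1: "(pev a N (fps_X ^ n) y * fps_deriv y) $ (m - 1) = a 0 0 * of_nat m" by simp
  have e: "m - n + n - 1 = m - 1" using n by simp
  have "Wser n y a b N $ (m - 1) = 0" using W n unfolding X_pow_dvd_iff by simp
  then have "pev b N (fps_X ^ n) y $ (m - n) \<noteq> 0"
    using Wser_nth[OF n(1), of y a b N "m - n"] 1 a0 n unfolding e by auto
  then have "m - n \<in> Sg n m"
    using ssup_pev_all[OF ssup_near[OF y(1)], of n b N] y(2) n by (auto simp: ssup_def)
  then have "n dvd m - n" using Sg_below n by simp
  then have "n dvd m" using n by (simp add: dvd_minus_self)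
  with n show False by simp
qed

lemma wts_no_const: "a 0 0 = 0 \<Longrightarrow> n \<le> m \<Longrightarrow> wts n m n a"
  unfolding wts_def
proof (intro allI impI)
  fix i j assume "a 0 0 = 0" "n \<le> m" "a i j \<noteq> 0"
  then have "1 \<le> i \<or> 1 \<le> j" by (cases i; cases j) auto
  moreover have "n \<le> n * i" if "1 \<le> i" using that by simp
  moreover have "m \<le> m * j" if "1 \<le> j" using that by simp
  ultimately show "n \<le> n * i + m * j" using \<open>n \<le> m\<close> by linarith
qed

text \<open>Increased by one, the exponents of the form are sums of two elements of
  \<open>Sg n m\<close> as long as the tail of \<open>y\<close> from \<open>t ^ K\<close> on is not
  involved. The tail first shows at the value \<open>K + n\<close>: its companion factor has order
  at least \<open>n - 1\<close>, and at least \<open>n\<close> where the tail is differentiated. The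
  latter rests on \<open>const_coeff_zero\<close>.\<close>

lemma near_monomial_value:
  fixes y :: "complex fps"
  assumes n: "0 < n" "n < m" "\<not> n dvd m" and y: "fps_X ^ K dvd y - fps_X ^ m" "m < K"
    and W: "Wser n y a b N \<noteq> 0" "Suc (subdegree (Wser n y a b N)) < K + n"
  shows "Suc (subdegree (Wser n y a b N)) \<in> Sg n m"
proof -
  define l where "l = subdegree (Wser n y a b N)"
  have ym: "fps_X ^ m dvd y" "y $ m = 1" using near_dvd[OF y(1)] near_nth[OF y(1)] y(2) by simp_all
  have S: "ssup (Sg n m) K y" using ssup_near[OF y(1)] .
  have nz: "Wser n y a b N $ l \<noteq> 0" unfolding l_def using W by simp
  have Wl: "fps_X ^ l dvd Wser n y a b N"
    unfolding X_pow_dvd_iff l_def by (blast intro: nth_less_subdegree_zero)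
  have pevS: "ssup (Sg n m) K (pev c N (fps_X ^ n) y)" for c using ssup_pev_all[OF S] .
  consider (b) "(fps_X ^ (n - 1) * pev b N (fps_X ^ n) y) $ l \<noteq> 0" | (a) "(pev a N (fps_X ^ n) y * fps_deriv y) $ l \<noteq> 0"
  proof -
    have "Wser n y a b N $ l = of_nat n * (fps_X ^ (n - 1) * pev b N (fps_X ^ n) y) $ l
        - (pev a N (fps_X ^ n) y * fps_deriv y) $ l"
      unfolding Wser_def mult.assoc by (simp add: fps_mult_left_const_nth flip: fps_of_nat)
    with nz have "(fps_X ^ (n - 1) * pev b N (fps_X ^ n) y) $ l \<noteq> 0
        \<or> (pev a N (fps_X ^ n) y * fps_deriv y) $ l \<noteq> 0" by force
    then show ?thesis using that by blast
  qed
  then have "Suc l \<in> Sg n m"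
  proof cases
    case b
    then have l: "n - 1 \<le> l" "pev b N (fps_X ^ n) y $ (l - (n - 1)) \<noteq> 0"
      by (auto simp: fps_X_power_mult_nth split: if_splits)
    have "l - (n - 1) < K" using W(2) n l unfolding l_def[symmetric] by simp
    then have "l - (n - 1) \<in> Sg n m" using pevS[of b] l(2) by (auto simp: ssup_def)
    then have "l - (n - 1) + n \<in> Sg n m" using Sg_add Sg_base by blast
    then show ?thesis using l n by simp
  next
    case a
    then obtain p where p: "p \<le> l" "pev a N (fps_X ^ n) y $ p \<noteq> 0" "fps_deriv y $ (l - p) \<noteq> 0"
      by (rule mult_nth_nonzeroD)
    then have q: "y $ Suc (l - p) \<noteq> 0" by auto
    then have mq: "m \<le> Suc (l - p)" using ym(1) by (auto simp: X_pow_dvd_iff not_less[symmetric])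
    have "p < K \<and> Suc (l - p) < K"
    proof (cases "l < m")
      case False
      then have "a 0 0 = 0" using const_coeff_zero[OF n y X_pow_dvd_mono[OF Wl]] by simp
      then have "wts n m n a" using wts_no_const[of a n m] n by simp
      then have "fps_X ^ n dvd pev a N (fps_X ^ n) y"
        using tadic.Fil_pev[of n m n a "fps_X ^ n" y N] ym by simp
      then have "n \<le> p" using p(2) by (auto simp: X_pow_dvd_iff not_less[symmetric])
      then show ?thesis using mq p(1) W(2) n unfolding l_def[symmetric] by auto
    qed (use p y(2) in auto)
    then have "p \<in> Sg n m" "Suc (l - p) \<in> Sg n m" using pevS[of a] S p(2) q by (auto simp: ssup_def)
    then have "p + Suc (l - p) \<in> Sg n m" by (rule Sg_add)
    then show ?thesis using p(1) by simp
  qed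
  then show ?thesis by (simp add: l_def)
qed

text \<open>A weight-raising field moves the coefficient of \<open>y\<close> at \<open>L\<close>
  beyond the exponent \<open>L + n - 1\<close>, so there the form sees only the monomial part of the
  curve.\<close>

lemma unipotent_value:
  fixes y :: "complex fps"
  assumes n: "0 < n" "n < m" and y: "fps_X ^ L dvd y - fps_X ^ m" "m < L"
    and a: "wts n m (n + 1) a" and b: "wts n m (m + 1) b"
    and W: "Wser n y a b N $ (L + n - 1) \<noteq> 0"
  shows "L + n \<in> Sg n m"
proof -
  have ym: "fps_X ^ m dvd y" "y $ m = 1" using near_dvd[OF y(1)] near_nth[OF y(1)] y(2) by simp_all
  have S: "ssup (Sg n m) L y" using ssup_near[OF y(1)] .
  have SA: "ssup (Sg n m) (n + 1 + L - m) (pev a N (fps_X ^ n) y)"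
    and SB: "ssup (Sg n m) (m + 1 + L - m) (pev b N (fps_X ^ n) y)"
    using ssup_pev[OF ym(1) S _ a] ssup_pev[OF ym(1) S _ b] y by auto
  consider (b) "pev b N (fps_X ^ n) y $ L \<noteq> 0" | (a) "(pev a N (fps_X ^ n) y * fps_deriv y) $ (L + n - 1) \<noteq> 0"
    using W Wser_nth[OF n(1), of y a b N L] by force
  then show ?thesis
  proof cases
    case b
    then have "L \<in> Sg n m" using SB by (auto simp: ssup_def)
    then show ?thesis using Sg_add Sg_base by blast
  next
    case a
    then obtain p where p: "p \<le> L + n - 1" "pev a N (fps_X ^ n) y $ p \<noteq> 0" "fps_deriv y $ (L + n - 1 - p) \<noteq> 0"
      by (rule mult_nth_nonzeroD)
    then have q: "y $ Suc (L + n - 1 - p) \<noteq> 0" by auto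
    then have mq: "m \<le> Suc (L + n - 1 - p)" using ym(1) by (auto simp: X_pow_dvd_iff not_less[symmetric])
    have "fps_X ^ (n + 1) dvd pev a N (fps_X ^ n) y"
      using tadic.Fil_pev[OF assms(5), of "fps_X ^ n" y N] ym by simp
    then have "n + 1 \<le> p" using p(2) unfolding X_pow_dvd_iff by (meson not_less)
    then have "p < n + 1 + L - m" "Suc (L + n - 1 - p) < L" using mq p(1) n y by auto
    then have "p \<in> Sg n m" "Suc (L + n - 1 - p) \<in> Sg n m" using SA S p(2) q unfolding ssup_def by blast+
    then have "p + Suc (L + n - 1 - p) \<in> Sg n m" by (rule Sg_add)
    then show ?thesis using p(1) n by simp
  qed
qed

section \<open>The Euler field and differentials of large value\<close>

lemma Wser_diff:
  "Wser n y (\<lambda>i j. a i j - a' i j) (\<lambda>i j. b i j - b' i j) N = Wser n y a b N - Wser n y a' b' N"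
  by (simp add: Wser_def pev_diff algebra_simps)

lemma Wser_cmult:
  "Wser n y (\<lambda>i j. c * a i j) (\<lambda>i j. c * b i j) N = fps_const c * Wser n y a b N"
  by (simp add: Wser_def pev_cmult algebra_simps)

text \<open>The Euler field is tangent to the monomial curve: its form is
  \<open>n * t ^ (n - 1)\<close> times \<open>m * y - t * y'\<close>, which annihilates the term
  \<open>t ^ m\<close> and rescales every other one.\<close>

lemma Wser_euler:
  assumes "0 < n" "1 \<le> N"
  shows "Wser n y (single 1 0 (of_nat n)) (single 0 1 (of_nat m)) N $ (q + n - 1)
    = of_nat n * (of_nat m - of_nat q) * y $ q"
proof -
  have "Wser n y (single 1 0 (of_nat n)) (single 0 1 (of_nat m)) N
      = fps_X ^ (n - 1) * (fps_const (of_nat n) * (fps_const (of_nat m) * y - fps_X * fps_deriv y))"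
    (is "_ = fps_X ^ (n - 1) * ?E")
    using assms pev_single[of 1 N 0 "of_nat n" "fps_X ^ n" y] pev_single[of 0 N 1 "of_nat m" "fps_X ^ n" y]
    by (cases n) (simp_all add: Wser_def algebra_simps flip: fps_of_nat)
  moreover have "?E $ q = of_nat n * (of_nat m - of_nat q) * y $ q"
    by (cases q) (simp_all add: algebra_simps)
  moreover have "(fps_X ^ (n - 1) * ?E) $ ((n - 1) + q) = ?E $ q"
    by (simp add: fps_X_power_mult_nth)
  moreover have "q + n - 1 = (n - 1) + q" using assms by simp
  ultimately show ?thesis by simp
qed

text \<open>Comparison of orders leaves a multiple of the Euler field as the only part that does not
  raise weights. The Euler form has a nonzero coefficient at \<open>L + n - 1\<close>, whereas the
  weight-raising rest contributes nothing there, as \<open>L + n\<close> is not in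
  \<open>Sg n m\<close>. A larger value therefore forces the multiple to be zero.\<close>

lemma large_value_unipotent:
  fixes y :: "complex fps"
  assumes n: "0 < n" "n < m" "\<not> n dvd m" and y: "fps_X ^ L dvd y - fps_X ^ m" "m < L" "y $ L \<noteq> 0"
    and L: "L + n \<notin> Sg n m" and W: "fps_X ^ (L + n) dvd Wser n y a b N" and N: "n + m \<le> N"
  shows "wts n m (n + 1) a \<and> wts n m (m + 1) b"
proof -
  have ym: "fps_X ^ m dvd y" "y $ m = 1" using near_dvd[OF y(1)] near_nth[OF y(1)] y(2) by simp_all
  let ?A = "pev a N (fps_X ^ n) y" and ?B = "pev b N (fps_X ^ n) y"
  have "a 0 0 = 0" using const_coeff_zero[OF n y(1,2) X_pow_dvd_mono[OF W]] y by simp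
  then have wa: "wts n m n a" using wts_no_const[of a n m] n by simp
  then have A: "fps_X ^ n dvd ?A" using tadic.Fil_pev[of n m n a "fps_X ^ n" y N] ym by simp
  have Ay: "fps_X ^ (n + m - 1) dvd ?A * fps_deriv y"
    using X_pow_mult_dvd[OF A dvd_deriv[OF ym(1)]] n by simp
  have W0: "Wser n y a b N $ (q + n - 1) = 0" if "q \<le> L" for q
  proof -
    have "q + n - 1 < L + n" using that n by simp
    then show ?thesis using W unfolding X_pow_dvd_iff by blast
  qed
  have "?B $ q = 0" if "q < m" for q
  proof -
    have "q + n - 1 < n + m - 1" using that n by simp
    then have "(?A * fps_deriv y) $ (q + n - 1) = 0" using Ay unfolding X_pow_dvd_iff by blast
    then show ?thesis using Wser_nth[OF n(1), of y a b N q] W0[of q] that y n by simp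
  qed
  then have B: "fps_X ^ m dvd ?B" by (simp add: X_pow_dvd_iff)
  then have wb: "wts n m m b" using low_weights[OF n ym, of "m - 1" b N] n N by simp
  have An: "?A $ n = a 1 0" using pev_lead[OF n ym wa, of 1 0 N] n N by simp
  have Bm: "?B $ m = b 0 1" using pev_lead[OF n ym wb, of 0 1 N] n N by simp
  have "(?A * fps_deriv y) $ (n + (m - 1)) = ?A $ n * fps_deriv y $ (m - 1)"
    by (rule mult_nth_lead[OF A dvd_deriv[OF ym(1)]])
  then have "(?A * fps_deriv y) $ (m + n - 1) = a 1 0 * of_nat m" using An ym n by (simp add: add.commute)
  \<comment> \<open>The coefficients of \<open>X\<close> in \<open>a\<close> and of \<open>Y\<close>
    in \<open>b\<close> have to balance at \<open>t ^ (m + n - 1)\<close>, so they are in the ratio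
    \<open>n : m\<close> of the Euler field.\<close>
  then have nb: "of_nat n * b 0 1 = a 1 0 * of_nat m"
    using Wser_nth[OF n(1), of y a b N m] W0[of m] Bm y by simp
  define k where "k = a 1 0 / of_nat n"
  have ka: "a 1 0 = k * of_nat n" and kb: "b 0 1 = k * of_nat m"
    using nb n by (auto simp: k_def field_simps)
  define ea eb where "ea = (\<lambda>i j. k * single 1 0 (of_nat n) i j)" and "eb = (\<lambda>i j. k * single 0 1 (of_nat m) i j)"
  define a' b' where "a' = (\<lambda>i j. a i j - ea i j)" and "b' = (\<lambda>i j. b i j - eb i j)"
  have N1: "1 \<le> N" using N n by simp
  have pea: "pev ea N (fps_X ^ n) y = fps_const (a 1 0) * fps_X ^ n"
    using N1 unfolding ea_def pev_cmult ka by (simp add: pev_single)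
  have peb: "pev eb N (fps_X ^ n) y = fps_const (b 0 1) * y"
    using N1 unfolding eb_def pev_cmult kb by (simp add: pev_single)
  have "fps_X ^ Suc n dvd pev a' N (fps_X ^ n) y"
    unfolding a'_def pev_diff pea X_pow_dvd_iff
    using A An by (auto simp: X_pow_dvd_iff less_Suc_eq)
  then have wa': "wts n m (n + 1) a'" using low_weights[OF n ym, of n a' N] n N by simp
  have "fps_X ^ Suc m dvd pev b' N (fps_X ^ n) y"
    unfolding b'_def pev_diff peb X_pow_dvd_iff
    using B Bm ym by (auto simp: X_pow_dvd_iff less_Suc_eq)
  then have wb': "wts n m (m + 1) b'" using low_weights[OF n ym, of m b' N] n N by simp
  have "Wser n y a' b' N $ (L + n - 1) = 0"
    using unipotent_value[OF n(1,2) y(1,2) wa' wb'] L by blast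
  moreover have "Wser n y ea eb N $ (L + n - 1) = k * (of_nat n * (of_nat m - of_nat L) * y $ L)"
    unfolding ea_def eb_def Wser_cmult using Wser_euler[OF n(1) N1, of y m L] by simp
  ultimately have "k * (of_nat n * (of_nat m - of_nat L) * y $ L) = 0"
    unfolding a'_def b'_def Wser_diff using W0[of L] by simp
  moreover have "of_nat m - of_nat L \<noteq> (0::complex)" using y(2) by auto
  ultimately have "k = 0" using y(3) n by simp
  then have "a' = a" "b' = b" by (auto simp: a'_def b'_def ea_def eb_def)
  with wa' wb' show ?thesis by simp
qed

section \<open>Exact differentials\<close>

definition dX :: "(nat \<Rightarrow> nat \<Rightarrow> complex) \<Rightarrow> nat \<Rightarrow> nat \<Rightarrow> complex" where
  "dX c = (\<lambda>i j. of_nat (Suc i) * c (Suc i) j)"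

definition dY :: "(nat \<Rightarrow> nat \<Rightarrow> complex) \<Rightarrow> nat \<Rightarrow> nat \<Rightarrow> complex" where
  "dY c = (\<lambda>i j. of_nat (Suc j) * c i (Suc j))"

lemma sum_shift_deriv:
  fixes f :: "nat \<Rightarrow> 'a::comm_ring_1"
  assumes "f (Suc N) = 0"
  shows "(\<Sum>i\<le>N. of_nat i * f i * z ^ (i - 1)) = (\<Sum>i\<le>N. of_nat (Suc i) * f (Suc i) * z ^ i)"
proof -
  have "(\<Sum>i\<le>N. of_nat i * f i * z ^ (i - 1)) = (\<Sum>i\<le>Suc N. of_nat i * f i * z ^ (i - 1))"
    using assms by simp
  also have "\<dots> = (\<Sum>i\<le>N. of_nat (Suc i) * f (Suc i) * z ^ i)"
    unfolding sum.atMost_Suc_shift by simp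
  finally show ?thesis .
qed

lemma pev_deriv:
  assumes "supp_le N c"
  shows "fps_deriv (pev c N F G) = pev (dX c) N F G * fps_deriv F + pev (dY c) N F G * fps_deriv G"
proof -
  let ?c = "\<lambda>i j. fps_const (c i j)"
  have c0: "?c (Suc N) j = 0" "?c i (Suc N) = 0" for i j
    using assms[unfolded supp_le_def, rule_format, of "Suc N" j] assms[unfolded supp_le_def, rule_format, of i "Suc N"]
    by force+
  have "fps_deriv (pev c N F G) = (\<Sum>i\<le>N. \<Sum>j\<le>N. ?c i j * (of_nat i * F ^ (i - 1) * fps_deriv F) * G ^ j)
      + (\<Sum>i\<le>N. \<Sum>j\<le>N. ?c i j * F ^ i * (of_nat j * G ^ (j - 1) * fps_deriv G))"
    by (simp add: pev_def fps_deriv_sum fps_deriv_power sum.distrib algebra_simps flip: fps_of_nat)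
  also have "(\<Sum>i\<le>N. \<Sum>j\<le>N. ?c i j * (of_nat i * F ^ (i - 1) * fps_deriv F) * G ^ j)
      = (\<Sum>j\<le>N. (\<Sum>i\<le>N. of_nat i * ?c i j * F ^ (i - 1)) * G ^ j) * fps_deriv F"
    unfolding sum_distrib_right by (subst sum.swap) (intro sum.cong refl, simp add: mult_ac)
  also have "\<dots> = (\<Sum>j\<le>N. (\<Sum>i\<le>N. of_nat (Suc i) * ?c (Suc i) j * F ^ i) * G ^ j) * fps_deriv F"
    using c0(1) by (subst sum_shift_deriv) auto
  also have "\<dots> = pev (dX c) N F G * fps_deriv F"
    unfolding pev_def by (subst sum.swap) (simp add: dX_def sum_distrib_right fps_of_nat[symmetric] del: of_nat_Suc)
  also have "(\<Sum>i\<le>N. \<Sum>j\<le>N. ?c i j * F ^ i * (of_nat j * G ^ (j - 1) * fps_deriv G))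
      = (\<Sum>i\<le>N. (\<Sum>j\<le>N. of_nat j * ?c i j * G ^ (j - 1)) * F ^ i) * fps_deriv G"
    unfolding sum_distrib_right by (intro sum.cong refl) (simp add: mult_ac)
  also have "\<dots> = (\<Sum>i\<le>N. (\<Sum>j\<le>N. of_nat (Suc j) * ?c i (Suc j) * G ^ j) * F ^ i) * fps_deriv G"
    using c0(2) by (subst sum_shift_deriv) auto
  also have "\<dots> = pev (dY c) N F G * fps_deriv G"
    unfolding pev_def sum_distrib_right by (intro sum.cong refl) (simp add: dY_def fps_of_nat[symmetric] mult_ac del: of_nat_Suc)
  finally show ?thesis .
qed

text \<open>Up to sign the field is the Hamiltonian field of the polynomial. Exactness is what ties
  the values of functions to the values of differentials.\<close>

lemma Wser_exact:
  assumes "supp_le N c"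
  shows "Wser n y (\<lambda>i j. - dY c i j) (dX c) N = fps_deriv (pev c N (fps_X ^ n) y)"
  using pev_cmult[of "-1" "dY c" N "fps_X ^ n" y]
  by (simp add: Wser_def pev_deriv[OF assms] fps_deriv_power algebra_simps flip: fps_of_nat fps_const_neg)

text \<open>By \<open>low_weights\<close> an order above \<open>n + m\<close> is a weight above
  \<open>n + m\<close>, and the derivatives by \<open>Y\<close> and \<open>X\<close> lower the
  weight by \<open>m\<close> and \<open>n\<close> only.\<close>

lemma exact_unipotent:
  fixes y :: "complex fps"
  assumes n: "0 < n" "n < m" "\<not> n dvd m" and y: "fps_X ^ m dvd y" "y $ m = 1"
    and c: "supp_le N c" "n + m \<le> N" and d: "fps_X ^ Suc (n + m) dvd pev c N (fps_X ^ n) y"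
  shows "wts n m (n + 1) (\<lambda>i j. - dY c i j)" "wts n m (m + 1) (dX c)"
proof -
  have w: "wts n m (Suc (n + m)) c" using low_weights[OF n y d] c by simp
  show "wts n m (n + 1) (\<lambda>i j. - dY c i j)" unfolding wts_def
  proof (intro allI impI)
    fix i j assume "- dY c i j \<noteq> 0"
    then have "Suc (n + m) \<le> n * i + m * Suc j" by (intro wtsD[OF w]) (auto simp: dY_def)
    then show "n + 1 \<le> n * i + m * j" by simp
  qed
  show "wts n m (m + 1) (dX c)" unfolding wts_def
  proof (intro allI impI)
    fix i j assume "dX c i j \<noteq> 0"
    then have "Suc (n + m) \<le> n * Suc i + m * j" by (intro wtsD[OF w]) (auto simp: dX_def)
    then show "m + 1 \<le> n * i + m * j" by simp
  qed
qed

section \<open>Convergent power series in two variables\<close>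

text \<open>Unlike \<open>analytic2\<close>, this names the radius and the coefficients and asks for
  absolute summability at the radius itself, so that the M-test and Lipschitz bounds work on a
  closed polydisc.\<close>

definition ps2 :: "(complex \<times> complex \<Rightarrow> complex) \<Rightarrow> real \<Rightarrow> (nat \<Rightarrow> nat \<Rightarrow> complex) \<Rightarrow> bool" where
  "ps2 h r c \<longleftrightarrow> 0 < r \<and> (\<lambda>(i, j). norm (c i j) * r ^ (i + j)) summable_on UNIV \<and>
     (\<forall>x y. norm x \<le> r \<longrightarrow> norm y \<le> r \<longrightarrow> ((\<lambda>(i, j). c i j * x ^ i * y ^ j) has_sum h (x, y)) UNIV)"

lemma analytic2_imp_ps2:
  assumes "analytic2 h"
  obtains r c where "ps2 h r c"
proof -
  obtain R c where R: "R > 0" and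
    c: "\<And>x y. norm x < R \<Longrightarrow> norm y < R \<Longrightarrow> ((\<lambda>(i, j). c i j * x ^ i * y ^ j) has_sum h (x, y)) UNIV"
    using assms unfolding analytic2_def by blast
  define r where "r = R / 2"
  have r: "0 < r" "r < R" using R by (auto simp: r_def)
  have "((\<lambda>(i, j). c i j * of_real r ^ i * of_real r ^ j) has_sum h (of_real r, of_real r)) UNIV"
    using r by (intro c) auto
  then have "(\<lambda>p. norm (case p of (i, j) \<Rightarrow> c i j * of_real r ^ i * of_real r ^ j)) summable_on UNIV"
    using summable_on_iff_abs_summable_on_complex has_sum_imp_summable by blast
  moreover have "norm (case p of (i, j) \<Rightarrow> c i j * of_real r ^ i * of_real r ^ j)
      = (case p of (i, j) \<Rightarrow> norm (c i j) * r ^ (i + j))" for p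
    using r by (cases p) (simp add: norm_mult norm_power power_add)
  ultimately have "(\<lambda>(i, j). norm (c i j) * r ^ (i + j)) summable_on UNIV" by simp
  then have "ps2 h r c" using r c unfolding ps2_def by auto
  then show ?thesis by (rule that)
qed

lemma ps2_imp_analytic2: "ps2 h r c \<Longrightarrow> analytic2 h"
  unfolding ps2_def analytic2_def by (meson less_imp_le)

lemma ps2_term_bound:
  assumes "ps2 h r c" "norm x \<le> r" "norm y \<le> r"
  shows "norm (c i j * x ^ i * y ^ j) \<le> norm (c i j) * r ^ (i + j)"
proof -
  have "norm x ^ i * norm y ^ j \<le> r ^ i * r ^ j"
    using assms by (intro mult_mono power_mono) (auto simp: ps2_def)
  then show ?thesis by (simp add: norm_mult norm_power power_add mult.assoc mult_left_mono)
qed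

lemma holomorphic_uniform_limit_open:
  assumes S: "open S" and lim: "uniform_limit S f g F" and F: "F \<noteq> bot"
    and hol: "eventually (\<lambda>n. f n holomorphic_on S) F"
  shows "g holomorphic_on S"
proof -
  have "g field_differentiable at z" if z: "z \<in> S" for z
  proof -
    obtain e where e: "e > 0" "cball z e \<subseteq> S" using S z open_contains_cball by blast
    have ev: "eventually (\<lambda>n. continuous_on (cball z e) (f n) \<and> f n holomorphic_on ball z e) F"
      using hol
    proof eventually_elim
      case (elim n)
      have "ball z e \<subseteq> S" using e ball_subset_cball by blast
      then show ?case using elim e(2)
        by (meson holomorphic_on_imp_continuous_on holomorphic_on_subset)
    qed
    obtain "g holomorphic_on ball z e"
      using holomorphic_uniform_limit[OF ev uniform_limit_on_subset[OF lim e(2)] F] by blast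
    then show ?thesis using e(1) by (intro holomorphic_on_imp_differentiable_at[of g "ball z e"]) auto
  qed
  then show ?thesis by (auto simp: holomorphic_on_def intro: field_differentiable_at_within)
qed

lemma ps2_holomorphic_comp:
  assumes h: "ps2 h r c" and S: "open S" and f: "f holomorphic_on S" and g: "g holomorphic_on S"
    and fg: "\<And>z. z \<in> S \<Longrightarrow> norm (f z) \<le> r \<and> norm (g z) \<le> r"
  shows "(\<lambda>z. h (f z, g z)) holomorphic_on S"
proof (rule holomorphic_uniform_limit_open[OF S])
  show "uniform_limit S (\<lambda>X t. \<Sum>p\<in>X. case p of (i, j) \<Rightarrow> c i j * f t ^ i * g t ^ j)
        (\<lambda>t. h (f t, g t)) (finite_subsets_at_top UNIV)"
  proof (rule Weierstrass_m_test_general')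
    show "norm (case p of (i, j) \<Rightarrow> c i j * f t ^ i * g t ^ j) \<le> (case p of (i, j) \<Rightarrow> norm (c i j) * r ^ (i + j))"
      if "t \<in> S" for p t
      using ps2_term_bound[OF h] fg[of t] that by (cases p) auto
    show "((\<lambda>p. case p of (i, j) \<Rightarrow> c i j * f t ^ i * g t ^ j) has_sum h (f t, g t)) UNIV"
      if "t \<in> S" for t
      using h fg[of t] that unfolding ps2_def by auto
    show "(\<lambda>(i, j). norm (c i j) * r ^ (i + j)) summable_on UNIV" using h by (simp add: ps2_def)
  qed
  have "(\<lambda>t. \<Sum>p\<in>X. case p of (i, j) \<Rightarrow> c i j * f t ^ i * g t ^ j) holomorphic_on S" for X
    unfolding case_prod_unfold using f g by (intro holomorphic_intros)
  then show "\<forall>\<^sub>F X in finite_subsets_at_top UNIV.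
      (\<lambda>t. \<Sum>p\<in>X. case p of (i, j) \<Rightarrow> c i j * f t ^ i * g t ^ j) holomorphic_on S" by simp
qed simp

lemma ps2_bounded:
  assumes h: "ps2 h r c"
  obtains M where "0 \<le> M" "\<And>x y. norm x \<le> r \<Longrightarrow> norm y \<le> r \<Longrightarrow> norm (h (x, y)) \<le> M"
proof -
  define M where "M = infsum (\<lambda>(i, j). norm (c i j) * r ^ (i + j)) UNIV"
  have M: "((\<lambda>(i, j). norm (c i j) * r ^ (i + j)) has_sum M) UNIV"
    using h by (simp add: ps2_def M_def)
  have "norm (h (x, y)) \<le> M" if xy: "norm x \<le> r" "norm y \<le> r" for x y
  proof -
    have hs: "((\<lambda>(i, j). c i j * x ^ i * y ^ j) has_sum h (x, y)) UNIV" using h xy by (auto simp: ps2_def)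
    then have "(\<lambda>p. norm (case p of (i, j) \<Rightarrow> c i j * x ^ i * y ^ j)) summable_on UNIV"
      using summable_on_iff_abs_summable_on_complex has_sum_imp_summable by blast
    then have n: "((\<lambda>p. norm (case p of (i, j) \<Rightarrow> c i j * x ^ i * y ^ j)) has_sum
        infsum (\<lambda>p. norm (case p of (i, j) \<Rightarrow> c i j * x ^ i * y ^ j)) UNIV) UNIV" by simp
    from norm_has_sum_bound[OF n hs]
    have "norm (h (x, y)) \<le> infsum (\<lambda>p. norm (case p of (i, j) \<Rightarrow> c i j * x ^ i * y ^ j)) UNIV" .
    also have "\<dots> \<le> M" using ps2_term_bound[OF h xy] by (intro has_sum_mono[OF n M]) auto
    finally show ?thesis .
  qed
  moreover from this[of 0 0] have "0 \<le> M" using h norm_ge_zero order_trans unfolding ps2_def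
    by (metis less_imp_le norm_zero)
  ultimately show ?thesis using that by blast
qed

lemma norm_monom_diff:
  fixes x y x' y' :: complex
  assumes "norm x \<le> s" "norm y \<le> s" "norm x' \<le> s" "norm y' \<le> s"
    and d: "norm (x - x') \<le> d" "norm (y - y') \<le> d"
  shows "norm (x ^ i * y ^ j - x' ^ i * y' ^ j) \<le> real (i + j) * s ^ (i + j - 1) * d"
proof -
  have s0: "0 \<le> s" using assms(1) norm_ge_zero order_trans by blast
  have d0: "0 \<le> d" using d(1) norm_ge_zero order_trans by blast
  have pw: "norm (z ^ k - w ^ k) \<le> real k * s ^ (k - 1) * d"
    if "norm z \<le> s" "norm w \<le> s" "norm (z - w) \<le> d" for z w :: complex and k
  proof (induction k)
    case (Suc k)
    have "norm (z ^ Suc k - w ^ Suc k) = norm (z * (z ^ k - w ^ k) + (z - w) * w ^ k)"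
      by (simp add: algebra_simps)
    also have "\<dots> \<le> norm z * norm (z ^ k - w ^ k) + norm (z - w) * norm w ^ k"
      by (metis norm_mult norm_power norm_triangle_ineq)
    also have "\<dots> \<le> s * (real k * s ^ (k - 1) * d) + d * s ^ k"
      using that Suc s0 d0 by (intro add_mono mult_mono power_mono) auto
    also have "\<dots> = real (Suc k) * s ^ (Suc k - 1) * d" by (cases k) (auto simp: algebra_simps)
    finally show ?case .
  qed simp
  have "norm (x ^ i * y ^ j - x' ^ i * y' ^ j) = norm (x ^ i * (y ^ j - y' ^ j) + (x ^ i - x' ^ i) * y' ^ j)"
    by (simp add: algebra_simps)
  also have "\<dots> \<le> norm x ^ i * norm (y ^ j - y' ^ j) + norm (x ^ i - x' ^ i) * norm y' ^ j"
    by (metis norm_mult norm_power norm_triangle_ineq)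
  also have "\<dots> \<le> s ^ i * (real j * s ^ (j - 1) * d) + (real i * s ^ (i - 1) * d) * s ^ j"
    using assms pw s0 d0 by (intro add_mono mult_mono power_mono) auto
  also have "\<dots> = real (i + j) * s ^ (i + j - 1) * d"
    by (cases i; cases j) (auto simp: algebra_simps power_add)
  finally show ?thesis .
qed

lemma has_sum_minus:
  fixes f g :: "'b \<Rightarrow> complex"
  assumes "(f has_sum a) A" "(g has_sum b) A"
  shows "((\<lambda>x. f x - g x) has_sum (a - b)) A"
  using has_sum_add[OF assms(1), of "\<lambda>x. - g x" "- b"] assms(2) by (simp add: has_sum_uminus)

lemma infsum_coeffs_nonneg: "0 \<le> r \<Longrightarrow> 0 \<le> infsum (\<lambda>(i, j). norm (c i j) * r ^ (i + j)) UNIV"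
  for r :: real
  by (intro infsum_nonneg) auto

text \<open>Termwise estimate. The constant \<open>K\<close> absorbs the factor
  \<open>k * s ^ (k - 1)\<close> that a monomial of degree \<open>k\<close> contributes; asking for
  it only where \<open>c i j\<close> is nonzero lets the absence of low degrees make
  \<open>K\<close> small.\<close>

lemma ps2_lipschitz:
  assumes h: "ps2 h r c" and s: "0 \<le> s" "s \<le> r" and K: "0 \<le> K"
    and cK: "\<And>i j. c i j \<noteq> 0 \<Longrightarrow> real (i + j) * s ^ (i + j - 1) \<le> K * r ^ (i + j)"
    and xy: "norm x \<le> s" "norm y \<le> s" "norm x' \<le> s" "norm y' \<le> s" "norm (x - x') \<le> d" "norm (y - y') \<le> d"
  shows "norm (h (x, y) - h (x', y')) \<le> K * infsum (\<lambda>(i, j). norm (c i j) * r ^ (i + j)) UNIV * d"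
proof -
  define M where "M = infsum (\<lambda>(i, j). norm (c i j) * r ^ (i + j)) UNIV"
  have M: "((\<lambda>(i, j). norm (c i j) * r ^ (i + j)) has_sum M) UNIV"
    using h by (simp add: ps2_def M_def)
  have d0: "0 \<le> d" using xy(5) norm_ge_zero order_trans by blast
  let ?t = "\<lambda>p. (case p of (i, j) \<Rightarrow> c i j * x ^ i * y ^ j) - (case p of (i, j) \<Rightarrow> c i j * x' ^ i * y' ^ j)"
  have hs: "(?t has_sum (h (x, y) - h (x', y'))) UNIV"
    using h xy s by (intro has_sum_minus) (auto simp: ps2_def)
  have "(\<lambda>p. norm (?t p)) summable_on UNIV"
    by (rule iffD1[OF summable_on_iff_abs_summable_on_complex has_sum_imp_summable[OF hs]])
  then have n: "((\<lambda>p. norm (?t p)) has_sum infsum (\<lambda>p. norm (?t p)) UNIV) UNIV" by simp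
  have M': "((\<lambda>p. K * d * (case p of (i, j) \<Rightarrow> norm (c i j) * r ^ (i + j))) has_sum K * d * M) UNIV"
    using M by (rule has_sum_cmult_right)
  have "norm (h (x, y) - h (x', y')) \<le> infsum (\<lambda>p. norm (?t p)) UNIV"
    by (rule norm_has_sum_bound[OF n hs])
  also have "\<dots> \<le> K * d * M"
  proof (rule has_sum_mono[OF n M'])
    fix p :: "nat \<times> nat"
    obtain i j where p: "p = (i, j)" by (cases p)
    have "norm (?t p) = norm (c i j) * norm (x ^ i * y ^ j - x' ^ i * y' ^ j)"
      by (simp add: p flip: norm_mult) (simp add: algebra_simps)
    also have "\<dots> \<le> norm (c i j) * (real (i + j) * s ^ (i + j - 1) * d)"
      by (intro mult_left_mono norm_monom_diff xy) auto
    also have "\<dots> \<le> norm (c i j) * (K * r ^ (i + j) * d)"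
    proof (cases "c i j = 0")
      case False
      show ?thesis by (intro mult_left_mono mult_right_mono[OF cK[OF False] d0]) simp
    qed simp
    finally show "norm (?t p) \<le> K * d * (case p of (i, j) \<Rightarrow> norm (c i j) * r ^ (i + j))"
      by (simp add: p algebra_simps)
  qed
  finally show ?thesis by (simp add: M_def algebra_simps)
qed

lemma real_le_two_power: "1 \<le> k \<Longrightarrow> real k \<le> 2 ^ (k - 1)"
proof -
  assume "1 \<le> k"
  moreover have "k - 1 < 2 ^ (k - 1)" by (rule less_exp)
  ultimately have "real k \<le> real (2 ^ (k - 1))" by linarith
  then show ?thesis by simp
qed

lemma ps2_lipschitz_half:
  assumes h: "ps2 h r c"
  obtains L where "0 \<le> L" "\<And>x y x' y' d. \<lbrakk>norm x \<le> r / 2; norm y \<le> r / 2; norm x' \<le> r / 2; norm y' \<le> r / 2;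
      norm (x - x') \<le> d; norm (y - y') \<le> d\<rbrakk> \<Longrightarrow> norm (h (x, y) - h (x', y')) \<le> L * d"
proof -
  have r: "0 < r" using h by (simp add: ps2_def)
  have "real k * (r / 2) ^ (k - 1) \<le> 1 / r * r ^ k" for k
  proof (cases k)
    case (Suc l)
    have "real k * (r / 2) ^ l = r ^ l * (real k / 2 ^ l)" by (simp add: power_divide)
    also have "\<dots> \<le> r ^ l * 1" using real_le_two_power[of k] r Suc by (intro mult_left_mono) auto
    finally show ?thesis using Suc r by simp
  qed (use r in simp)
  then have k: "real (i + j) * (r / 2) ^ (i + j - 1) \<le> 1 / r * r ^ (i + j)" for i j .
  show ?thesis
  proof (rule that)
    show "0 \<le> 1 / r * infsum (\<lambda>(i, j). norm (c i j) * r ^ (i + j)) UNIV"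
      using r infsum_coeffs_nonneg[of r c] by simp
  qed (use r in \<open>intro ps2_lipschitz[OF h _ _ _ k], auto\<close>)
qed

lemma ps2_lipschitz_small:
  assumes h: "ps2 h r c" and c: "\<And>i j. i + j < 2 \<Longrightarrow> c i j = 0" and e: "0 < e"
  obtains s where "0 < s" "s \<le> r" "\<And>x y x' y' d. \<lbrakk>norm x \<le> s; norm y \<le> s; norm x' \<le> s; norm y' \<le> s;
      norm (x - x') \<le> d; norm (y - y') \<le> d\<rbrakk> \<Longrightarrow> norm (h (x, y) - h (x', y')) \<le> e * d"
proof -
  have r: "0 < r" using h by (simp add: ps2_def)
  define M where "M = infsum (\<lambda>(i, j). norm (c i j) * r ^ (i + j)) UNIV"
  have M: "0 \<le> M" unfolding M_def using r infsum_coeffs_nonneg[of r c] by simp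
  \<comment> \<open>In degrees at least 2 the factor is at most \<open>2 * s / r\<^sup>2\<close>.
    The choice makes its product with \<open>M + 1\<close> at most \<open>e\<close>; the summand 1
    keeps the denominator positive.\<close>
  define s where "s = min (r / 2) (e * r\<^sup>2 / (2 * (M + 1)))"
  have s: "0 < s" using r e M by (auto simp: s_def)
  have s: "0 < s" "s \<le> r / 2" "s \<le> e * r\<^sup>2 / (2 * (M + 1))" using s unfolding s_def by linarith+
  have k2: "real k \<le> 2 * 2 ^ (k - 2)" if "k \<ge> 2" for k
  proof -
    have "2 * 2 ^ (k - 2) = (2::real) ^ (k - 1)" using le_Suc_ex[OF that] by auto
    then show ?thesis using real_le_two_power[of k] that by simp
  qed
  have "real k * s ^ (k - 1) \<le> 2 * s / r\<^sup>2 * r ^ k" if "k \<ge> 2" for k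
  proof -
    from le_Suc_ex[OF that] obtain l where l: "k = Suc (Suc l)" by auto
    have "real k * s ^ (k - 1) = s * (real k * s ^ l)" using l by simp
    also have "\<dots> \<le> s * (2 * 2 ^ l * (r / 2) ^ l)"
      using s k2[OF that] l by (intro mult_left_mono mult_mono power_mono) auto
    also have "\<dots> = 2 * s / r\<^sup>2 * r ^ k" using r by (simp add: l power_divide power2_eq_square)
    finally show ?thesis .
  qed
  moreover have "k \<ge> 2" if "c i j \<noteq> 0" "k = i + j" for i j k using c[of i j] that by force
  ultimately have "real (i + j) * s ^ (i + j - 1) \<le> 2 * s / r\<^sup>2 * r ^ (i + j)" if "c i j \<noteq> 0" for i j
    using that by blast
  note k = this
  have "2 * s / r\<^sup>2 * M \<le> 2 * s / r\<^sup>2 * (M + 1)" using s r M by (intro mult_left_mono) auto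
  also have "\<dots> \<le> e" using s(3) r M by (simp add: field_simps)
  finally have "2 * s / r\<^sup>2 * M \<le> e" .
  note Me = this
  show ?thesis
  proof (rule that)
    fix x y x' y' :: complex and d :: real
    assume xy: "norm x \<le> s" "norm y \<le> s" "norm x' \<le> s" "norm y' \<le> s" "norm (x - x') \<le> d" "norm (y - y') \<le> d"
    have d0: "0 \<le> d" using xy(5) norm_ge_zero order_trans by blast
    have "norm (h (x, y) - h (x', y')) \<le> 2 * s / r\<^sup>2 * M * d"
      unfolding M_def using s r by (intro ps2_lipschitz[OF h _ _ _ k] xy) auto
    also have "\<dots> \<le> e * d" using Me d0 by (rule mult_right_mono)
    finally show "norm (h (x, y) - h (x', y')) \<le> e * d" .
  qed (use s r in auto)
qed

text \<open>An equivalent of analyticity, by \<open>osgood\<close>, that mentions no coefficients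
  and passes at once to sums, products, composites and uniform limits.\<close>

definition sephol :: "(complex \<times> complex \<Rightarrow> complex) \<Rightarrow> real \<Rightarrow> bool" where
  "sephol h R \<longleftrightarrow> 0 < R \<and> (\<exists>M. \<forall>x\<in>ball 0 R. \<forall>y\<in>ball 0 R. norm (h (x, y)) \<le> M) \<and>
     (\<forall>y\<in>ball 0 R. (\<lambda>x. h (x, y)) holomorphic_on ball 0 R) \<and>
     (\<forall>x\<in>ball 0 R. (\<lambda>y. h (x, y)) holomorphic_on ball 0 R)"

lemma sephol_mono: "sephol h R \<Longrightarrow> 0 < R' \<Longrightarrow> R' \<le> R \<Longrightarrow> sephol h R'"
  unfolding sephol_def
proof (elim conjE exE, intro conjI ballI)
  fix M assume "\<forall>x\<in>ball 0 R. \<forall>y\<in>ball 0 R. norm (h (x, y)) \<le> M" "R' \<le> R"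
  then show "\<exists>M. \<forall>x\<in>ball 0 R'. \<forall>y\<in>ball 0 R'. norm (h (x, y)) \<le> M" by (intro exI[of _ M]) auto
next
  assume R: "R' \<le> R" and h: "\<forall>y\<in>ball 0 R. (\<lambda>x. h (x, y)) holomorphic_on ball 0 R"
    "\<forall>x\<in>ball 0 R. (\<lambda>y. h (x, y)) holomorphic_on ball 0 R"
  have b: "ball 0 R' \<subseteq> ball (0::complex) R" using R by (rule subset_ball)
  show "(\<lambda>x. h (x, y)) holomorphic_on ball 0 R'" if "y \<in> ball 0 R'" for y
    using h(1) that b by (meson holomorphic_on_subset subsetD)
  show "(\<lambda>y. h (x, y)) holomorphic_on ball 0 R'" if "x \<in> ball 0 R'" for x
    using h(2) that b by (meson holomorphic_on_subset subsetD)
qed auto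

lemma ps2_imp_sephol: "ps2 h r c \<Longrightarrow> sephol h r"
proof -
  assume h: "ps2 h r c"
  then obtain M where M: "\<And>x y. norm x \<le> r \<Longrightarrow> norm y \<le> r \<Longrightarrow> norm (h (x, y)) \<le> M"
    using ps2_bounded by blast
  have r: "0 < r" using h by (simp add: ps2_def)
  show ?thesis unfolding sephol_def
  proof (intro conjI ballI r)
    show "\<exists>M. \<forall>x\<in>ball 0 r. \<forall>y\<in>ball 0 r. norm (h (x, y)) \<le> M" using M by (intro exI[of _ M]) auto
    show "(\<lambda>x. h (x, y)) holomorphic_on ball 0 r" if "y \<in> ball 0 r" for y
      using that by (intro ps2_holomorphic_comp[OF h]) (auto intro!: holomorphic_intros)
    show "(\<lambda>y. h (x, y)) holomorphic_on ball 0 r" if "x \<in> ball 0 r" for x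
      using that by (intro ps2_holomorphic_comp[OF h]) (auto intro!: holomorphic_intros)
  qed
qed

lemma geometric2_summable:
  assumes "0 \<le> p" "p < 1" "0 \<le> q" "q < (1::real)"
  shows "(\<lambda>(i, j). p ^ i * q ^ j) summable_on (UNIV :: (nat \<times> nat) set)"
proof -
  have g: "((\<lambda>i. x ^ i) has_sum (1 / (1 - x))) UNIV" if "0 \<le> x" "x < 1" for x :: real
    using that by (intro sums_nonneg_imp_has_sum geometric_sums) auto
  have "(\<lambda>(i, j). p ^ i * q ^ j) summable_on (UNIV \<times> UNIV)"
  proof (rule summable_on_SigmaI)
    show "((\<lambda>j. case (i, j) of (i, j) \<Rightarrow> p ^ i * q ^ j) has_sum p ^ i * (1 / (1 - q))) UNIV" for i
      using has_sum_cmult_right[OF g[OF assms(3,4)], of "p ^ i"] by simp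
    show "(\<lambda>i. p ^ i * (1 / (1 - q))) summable_on UNIV"
      using has_sum_cmult_left[OF g[OF assms(1,2)], of "1 / (1 - q)"] has_sum_imp_summable by blast
  qed (use assms in auto)
  then show ?thesis by simp
qed

text \<open>\<open>h\<close> is expanded in \<open>x\<close> with coefficients \<open>a i\<close>
  that turn out to be holomorphic in \<open>y\<close>. Cauchy estimates at radius
  \<open>R / 2\<close> bound the double series, which leaves geometric ratios \<open>1 / 2\<close>
  at radius \<open>R / 4\<close>.\<close>

lemma osgood:
  assumes "sephol h R"
  shows "\<exists>c. ps2 h (R / 4) c"
proof -
  have R: "0 < R" and hx: "\<And>y. norm y < R \<Longrightarrow> (\<lambda>x. h (x, y)) holomorphic_on ball 0 R"
    and hy: "\<And>x. norm x < R \<Longrightarrow> (\<lambda>y. h (x, y)) holomorphic_on ball 0 R"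
    using assms by (auto simp: sephol_def)
  obtain M where "\<forall>x\<in>ball 0 R. \<forall>y\<in>ball 0 R. norm (h (x, y)) \<le> M"
    using assms unfolding sephol_def by blast
  then have M: "norm (h (x, y)) \<le> M" if "norm x < R" "norm y < R" for x y
    using that by simp
  have M0: "0 \<le> M" using M[of 0 0] R norm_ge_zero order_trans by (metis norm_zero)
  define r where "r = R / 2"
  have r: "0 < r" "r < R" using R by (auto simp: r_def)
  have cauchy: "norm ((deriv ^^ i) f 0 / fact i) \<le> B / r ^ i"
    if "f holomorphic_on ball 0 R" "\<And>x. norm x < R \<Longrightarrow> norm (f x) \<le> B" for f B i
  proof -
    have "norm ((deriv ^^ i) f 0) \<le> fact i * B / r ^ i"
    proof (rule Cauchy_inequality)
      show "f holomorphic_on ball 0 r" using that(1) r by (auto elim!: holomorphic_on_subset)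
      have "f holomorphic_on cball 0 r" using that(1) r by (auto elim!: holomorphic_on_subset)
      then show "continuous_on (cball 0 r) f" by (rule holomorphic_on_imp_continuous_on)
    qed (use r that(2) in auto)
    then show ?thesis by (simp add: norm_divide field_simps)
  qed
  define a where "a i y = (deriv ^^ i) (\<lambda>x. h (x, y)) 0 / fact i" for i y
  have a_bound: "norm (a i y) \<le> M / r ^ i" if "norm y < R" for i y
    unfolding a_def using cauchy[OF hx[OF that]] M that by blast
  have a_sums: "(\<lambda>i. a i y * x ^ i) sums h (x, y)" if "norm x < R" "norm y < R" for x y
    unfolding a_def using holomorphic_power_series[OF hx[OF that(2)], of x] that by simp
  have a_hol: "a i holomorphic_on ball 0 R" for i
  proof (induction i rule: less_induct)
    case (less i)
    \<comment> \<open>Once the earlier coefficients are holomorphic, \<open>a i\<close> is the limit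
      of these quotients as \<open>x\<close> tends to 0, uniformly in \<open>y\<close>.\<close>
    define g where "g x y = (h (x, y) - (\<Sum>k<i. a k y * x ^ k)) / x ^ i" for x y
    define C where "C = 2 * M / r ^ Suc i"
    have g_close: "norm (g x y - a i y) \<le> C * norm x" if x: "x \<noteq> 0" "norm x < r / 2" and y: "norm y < R" for x y
    proof -
      have "(\<lambda>k. a k y * x ^ k) sums h (x, y)" using a_sums x y r by auto
      then have "(\<lambda>k. a (k + Suc i) y * x ^ (k + Suc i)) sums (h (x, y) - (\<Sum>k<Suc i. a k y * x ^ k))"
        by (rule sums_split_initial_segment)
      then have "(\<lambda>k. a (k + Suc i) y * x ^ (k + Suc i) / x ^ i) sums ((h (x, y) - (\<Sum>k<Suc i. a k y * x ^ k)) / x ^ i)"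
        by (rule sums_divide)
      moreover have "(h (x, y) - (\<Sum>k<Suc i. a k y * x ^ k)) / x ^ i = g x y - a i y"
        using x by (simp add: g_def diff_divide_distrib add_divide_distrib)
      moreover have "a (k + Suc i) y * x ^ (k + Suc i) / x ^ i = a (k + Suc i) y * x ^ Suc k" for k
        using x by (simp add: power_add)
      ultimately have s: "(\<lambda>k. a (k + Suc i) y * x ^ Suc k) sums (g x y - a i y)" by simp
      have b: "norm (a (k + Suc i) y * x ^ Suc k) \<le> M / r ^ Suc i * norm x * (1 / 2) ^ k" for k
      proof -
        have "norm (a (k + Suc i) y * x ^ Suc k) \<le> M / r ^ (k + Suc i) * (norm x * (r / 2) ^ k)"
          using a_bound[OF y, of "k + Suc i"] x M0 r
          unfolding norm_mult norm_power power_Suc by (intro mult_mono power_mono) auto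
        also have "\<dots> = M / r ^ Suc i * norm x * (1 / 2) ^ k"
          using r by (simp add: power_add power_divide field_simps)
        finally show ?thesis .
      qed
      have "(\<lambda>k. M / r ^ Suc i * norm x * (1 / 2) ^ k) sums (M / r ^ Suc i * norm x * (1 / (1 - 1 / 2)))"
        by (intro sums_mult geometric_sums) simp
      then have t: "(\<lambda>k. M / r ^ Suc i * norm x * (1 / 2) ^ k) sums (C * norm x)"
        by (simp add: C_def algebra_simps)
      have "norm (g x y - a i y) = norm (\<Sum>k. a (k + Suc i) y * x ^ Suc k)"
        using s by (simp add: sums_iff)
      also have "\<dots> \<le> (\<Sum>k. M / r ^ Suc i * norm x * (1 / 2) ^ k)"
        using b t by (intro norm_suminf_le) (auto simp: sums_iff)
      also have "\<dots> = C * norm x" using t by (simp add: sums_iff)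
      finally show ?thesis .
    qed
    show ?case
    proof (rule holomorphic_uniform_limit_open[where F = "at (0::complex)" and f = g])
      show "uniform_limit (ball 0 R) g (a i) (at 0)"
      proof (rule uniform_limitI)
        fix e :: real assume e: "0 < e"
        have C: "0 \<le> C" using M0 r by (simp add: C_def)
        define d where "d = min (r / 2) (e / (C + 1))"
        have d: "0 < d" using r e C by (auto simp: d_def)
        have d: "0 < d" "d \<le> r / 2" "d \<le> e / (C + 1)" using d unfolding d_def by linarith+
        have "\<forall>y\<in>ball 0 R. dist (g x y) (a i y) < e" if "x \<noteq> 0" "norm x < d" for x
        proof
          fix y assume "y \<in> ball (0::complex) R"
          then have "dist (g x y) (a i y) \<le> C * norm x" using g_close[of x y] that d by (simp add: dist_norm)
          also have "\<dots> \<le> C * d" using that C by (intro mult_left_mono) auto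
          also have "\<dots> < (C + 1) * d" using d by simp
          also have "\<dots> \<le> e" using d C by (simp add: field_simps)
          finally show "dist (g x y) (a i y) < e" .
        qed
        then show "\<forall>\<^sub>F x in at 0. \<forall>y\<in>ball 0 R. dist (g x y) (a i y) < e"
          unfolding eventually_at using d(1) by (intro exI[of _ d]) auto
      qed
      have "g x holomorphic_on ball 0 R" if "norm x < R" "x \<noteq> 0" for x
        unfolding g_def using hy[OF that(1)] less that(2) by (intro holomorphic_intros) auto
      then show "\<forall>\<^sub>F x in at 0. g x holomorphic_on ball 0 R"
        unfolding eventually_at using R by (intro exI[of _ R]) auto
    qed auto
  qed
  define c where "c i j = (deriv ^^ j) (a i) 0 / fact j" for i j
  have c_bound: "norm (c i j) \<le> M / r ^ i / r ^ j" for i j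
    unfolding c_def using cauchy[OF a_hol] a_bound by blast
  have c_sums: "(\<lambda>j. c i j * y ^ j) sums a i y" if "norm y < R" for i y
    unfolding c_def using holomorphic_power_series[OF a_hol, of y] that by simp
  have r4: "R / 4 = r / 2" by (simp add: r_def)
  have b: "norm (c i j) * (R / 4) ^ (i + j) \<le> M * ((1 / 2) ^ i * (1 / 2) ^ j)" for i j
  proof -
    have "norm (c i j) * (R / 4) ^ (i + j) \<le> M / r ^ i / r ^ j * (r / 2) ^ (i + j)"
      unfolding r4 using c_bound r by (intro mult_right_mono) auto
    also have "\<dots> = M * ((1 / 2) ^ i * (1 / 2) ^ j)" using r by (simp add: power_add power_divide)
    finally show ?thesis .
  qed
  have gs: "(\<lambda>(i, j). M * ((1 / 2) ^ i * (1 / 2) ^ j)) summable_on (UNIV :: (nat \<times> nat) set)"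
    using summable_on_cmult_right[OF geometric2_summable[of "1/2" "1/2"], of M] by (simp add: case_prod_unfold)
  have cs: "(\<lambda>(i, j). norm (c i j) * (R / 4) ^ (i + j)) summable_on UNIV"
    using gs by (rule summable_on_comparison_test) (use b R in auto)
  have "((\<lambda>(i, j). c i j * x ^ i * y ^ j) has_sum h (x, y)) UNIV" if xy: "norm x \<le> R / 4" "norm y \<le> R / 4" for x y
  proof -
    have xyR: "norm x < R" "norm y < R" using xy R by auto
    have nb: "norm (c i j * x ^ i * y ^ j) \<le> norm (c i j) * (R / 4) ^ (i + j)" for i j
    proof -
      have "norm x ^ i * norm y ^ j \<le> (R / 4) ^ i * (R / 4) ^ j"
        using xy R by (intro mult_mono power_mono) auto
      then show ?thesis by (simp add: norm_mult norm_power power_add mult.assoc mult_left_mono)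
    qed
    have "(\<lambda>p. norm (case p of (i, j) \<Rightarrow> c i j * x ^ i * y ^ j)) summable_on UNIV"
      using cs by (rule summable_on_comparison_test) (use nb in auto)
    then have su: "(\<lambda>(i, j). c i j * x ^ i * y ^ j) summable_on UNIV" by (rule abs_summable_summable)
    have inner: "((\<lambda>j. c i j * x ^ i * y ^ j) has_sum a i y * x ^ i) UNIV" for i
    proof (rule norm_summable_imp_has_sum)
      have "(\<lambda>j. x ^ i * (c i j * y ^ j)) sums (x ^ i * a i y)" using c_sums[OF xyR(2)] by (rule sums_mult)
      then show "(\<lambda>j. c i j * x ^ i * y ^ j) sums (a i y * x ^ i)" by (simp add: mult_ac)
      have "norm (c i j * x ^ i * y ^ j) \<le> M * (1 / 2) ^ j" for j
      proof -
        have "norm (c i j * x ^ i * y ^ j) \<le> M * ((1 / 2) ^ i * (1 / 2) ^ j)"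
          using nb[of i j] b[of i j] by (rule order_trans)
        also have "\<dots> \<le> M * (1 * (1 / 2) ^ j)"
          using M0 by (intro mult_left_mono mult_right_mono power_le_one) auto
        finally show ?thesis by simp
      qed
      note nj = this
      show "summable (\<lambda>j. norm (c i j * x ^ i * y ^ j))"
      proof (rule summable_comparison_test[rotated])
        show "summable (\<lambda>j. M * (1 / 2) ^ j)" by (intro summable_mult summable_geometric) simp
      qed (use nj in \<open>auto intro: exI[of _ 0]\<close>)
    qed
    have "((\<lambda>i. a i y * x ^ i) has_sum infsum (\<lambda>(i, j). c i j * x ^ i * y ^ j) UNIV) UNIV"
    proof (rule has_sum_SigmaD)
      show "((\<lambda>(i, j). c i j * x ^ i * y ^ j) has_sum infsum (\<lambda>(i, j). c i j * x ^ i * y ^ j) UNIV) (Sigma UNIV (\<lambda>_. UNIV))"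
        using su by simp
    qed (use inner in auto)
    from sums_unique2[OF has_sum_imp_sums[OF this] a_sums[OF xyR]]
    show ?thesis using has_sum_infsum[OF su] by simp
  qed
  then show ?thesis using cs R unfolding ps2_def by (intro exI[of _ c]) auto
qed

lemma analytic2_iff_sephol: "analytic2 h \<longleftrightarrow> (\<exists>R. sephol h R)"
  using analytic2_imp_ps2 ps2_imp_sephol osgood ps2_imp_analytic2 by metis

section \<open>Algebra and composition of analytic germs\<close>

lemma sephol_add: "sephol f R \<Longrightarrow> sephol g R \<Longrightarrow> sephol (\<lambda>p. f p + g p) R"
  unfolding sephol_def
proof (elim conjE exE, intro conjI ballI)
  fix M N assume "\<forall>x\<in>ball 0 R. \<forall>y\<in>ball 0 R. norm (f (x, y)) \<le> M" "\<forall>x\<in>ball 0 R. \<forall>y\<in>ball 0 R. norm (g (x, y)) \<le> N"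
  then show "\<exists>M. \<forall>x\<in>ball 0 R. \<forall>y\<in>ball 0 R. norm (f (x, y) + g (x, y)) \<le> M"
    by (intro exI[of _ "M + N"] ballI) (meson add_mono norm_triangle_le)
qed (auto intro!: holomorphic_intros)

lemma sephol_mult: "sephol f R \<Longrightarrow> sephol g R \<Longrightarrow> sephol (\<lambda>p. f p * g p) R"
  unfolding sephol_def
proof (elim conjE exE, intro conjI ballI)
  fix M N assume *: "\<forall>x\<in>ball 0 R. \<forall>y\<in>ball 0 R. norm (f (x, y)) \<le> M" "\<forall>x\<in>ball 0 R. \<forall>y\<in>ball 0 R. norm (g (x, y)) \<le> N"
  have "norm (f (x, y) * g (x, y)) \<le> M * N" if "x \<in> ball 0 R" "y \<in> ball 0 R" for x y
  proof -
    have "norm (f (x, y)) \<le> M" "norm (g (x, y)) \<le> N" using * that by auto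
    moreover from this have "0 \<le> M" "0 \<le> N" by (meson norm_ge_zero order_trans)+
    ultimately show ?thesis unfolding norm_mult by (intro mult_mono) auto
  qed
  then show "\<exists>M. \<forall>x\<in>ball 0 R. \<forall>y\<in>ball 0 R. norm (f (x, y) * g (x, y)) \<le> M" by blast
qed (auto intro!: holomorphic_intros)

lemma analytic2_common:
  assumes "analytic2 f" "analytic2 g"
  obtains R where "sephol f R" "sephol g R"
proof -
  obtain R1 R2 where *: "sephol f R1" "sephol g R2" using assms by (auto simp: analytic2_iff_sephol)
  then have "0 < R1" "0 < R2" by (auto simp: sephol_def)
  then have "sephol f (min R1 R2)" "sephol g (min R1 R2)"
    using sephol_mono[OF *(1), of "min R1 R2"] sephol_mono[OF *(2), of "min R1 R2"] by auto
  then show ?thesis by (rule that)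
qed

lemma analytic2_add: "analytic2 f \<Longrightarrow> analytic2 g \<Longrightarrow> analytic2 (\<lambda>p. f p + g p)"
  using analytic2_common sephol_add analytic2_iff_sephol by metis

lemma analytic2_mult: "analytic2 f \<Longrightarrow> analytic2 g \<Longrightarrow> analytic2 (\<lambda>p. f p * g p)"
  using analytic2_common sephol_mult analytic2_iff_sephol by metis

lemma analytic2_const: "analytic2 (\<lambda>p. k)"
proof -
  have "sephol (\<lambda>p. k) 1" by (auto simp: sephol_def)
  then show ?thesis by (auto simp: analytic2_iff_sephol)
qed

lemma analytic2_fst: "analytic2 fst"
proof -
  have "sephol fst 1" unfolding sephol_def by (auto intro!: exI[of _ 1] holomorphic_intros)
  then show ?thesis by (auto simp: analytic2_iff_sephol)
qed

lemma analytic2_snd: "analytic2 snd"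
proof -
  have "sephol snd 1" unfolding sephol_def by (auto intro!: exI[of _ 1] holomorphic_intros)
  then show ?thesis by (auto simp: analytic2_iff_sephol)
qed

lemma analytic2_power: "analytic2 f \<Longrightarrow> analytic2 (\<lambda>p. f p ^ k)"
  by (induction k) (auto intro: analytic2_const analytic2_mult)

lemma analytic2_sum: "(\<And>i. i \<in> A \<Longrightarrow> analytic2 (f i)) \<Longrightarrow> analytic2 (\<lambda>p. \<Sum>i\<in>A. f i p)"
  by (induction A rule: infinite_finite_induct) (auto intro: analytic2_const analytic2_add)

definition polyfun :: "(nat \<Rightarrow> nat \<Rightarrow> complex) \<Rightarrow> nat \<Rightarrow> complex \<times> complex \<Rightarrow> complex" where
  "polyfun c N p = (\<Sum>i\<le>N. \<Sum>j\<le>N. c i j * fst p ^ i * snd p ^ j)"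

lemma analytic2_polyfun: "analytic2 (polyfun c N)"
  unfolding polyfun_def
  by (intro analytic2_sum analytic2_mult analytic2_const analytic2_power analytic2_fst analytic2_snd)

lemma ps2_polyfun:
  assumes "supp_le N c"
  shows "ps2 (polyfun c N) 1 c"
proof -
  have z: "c (fst p) (snd p) = 0" if "p \<in> UNIV - {..N} \<times> {..N}" for p
    using assms that by (cases p) (force simp: supp_le_def)
  have "(\<lambda>(i, j). norm (c i j) * 1 ^ (i + j)) summable_on ({..N} \<times> {..N})" by simp
  then have "(\<lambda>(i, j). norm (c i j) * 1 ^ (i + j)) summable_on UNIV"
    by (rule summable_on_cong_neutral[THEN iffD1, rotated 3]) (use z in \<open>auto simp: case_prod_unfold\<close>)
  moreover have "((\<lambda>(i, j). c i j * x ^ i * y ^ j) has_sum polyfun c N (x, y)) UNIV" for x y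
  proof -
    have "((\<lambda>(i, j). c i j * x ^ i * y ^ j) has_sum polyfun c N (x, y)) ({..N} \<times> {..N})"
      unfolding polyfun_def fst_conv snd_conv sum.cartesian_product by (rule has_sum_finite) simp
    then show ?thesis
      by (rule has_sum_cong_neutral[THEN iffD1, rotated 3]) (use z in \<open>auto simp: case_prod_unfold\<close>)
  qed
  ultimately show ?thesis by (simp add: ps2_def)
qed

lemma ps2_at_0: "ps2 h r c \<Longrightarrow> h (0, 0) = c 0 0"
proof -
  assume "ps2 h r c"
  then have 1: "((\<lambda>(i, j). c i j * 0 ^ i * 0 ^ j) has_sum h (0, 0)) UNIV" by (simp add: ps2_def)
  have 2: "((\<lambda>(i, j). c i j * 0 ^ i * 0 ^ j) has_sum c 0 0) {(0, 0)}"
    using has_sum_finite[of "{(0::nat, 0::nat)}" "\<lambda>(i, j). c i j * 0 ^ i * 0 ^ j"] by simp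
  have "((\<lambda>(i, j). c i j * 0 ^ i * 0 ^ j) has_sum c 0 0) UNIV"
    using 2 by (rule has_sum_cong_neutral[THEN iffD1, rotated 3]) (auto simp: power_0_left split: if_splits)
  then show ?thesis using has_sum_unique[OF 1] by blast
qed

lemma analytic2_small:
  assumes "analytic2 s" "0 < e"
  obtains t where "0 < t" "\<And>x y. norm x < t \<Longrightarrow> norm y < t \<Longrightarrow> norm (s (x, y) - s (0, 0)) < e"
proof -
  obtain r c where h: "ps2 s r c" using analytic2_imp_ps2[OF assms(1)] .
  have r: "0 < r" using h by (simp add: ps2_def)
  obtain L where L: "0 \<le> L" "\<And>x y x' y' d. \<lbrakk>norm x \<le> r / 2; norm y \<le> r / 2; norm x' \<le> r / 2; norm y' \<le> r / 2;
      norm (x - x') \<le> d; norm (y - y') \<le> d\<rbrakk> \<Longrightarrow> norm (s (x, y) - s (x', y')) \<le> L * d"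
    using ps2_lipschitz_half[OF h] by blast
  define t where "t = min (r / 2) (e / (L + 1))"
  have t: "0 < t" using r L(1) assms(2) by (auto simp: t_def)
  have t: "0 < t" "t \<le> r / 2" "t \<le> e / (L + 1)" using t unfolding t_def by linarith+
  have "norm (s (x, y) - s (0, 0)) < e" if "norm x < t" "norm y < t" for x y
  proof -
    have "norm (s (x, y) - s (0, 0)) \<le> L * t" using that t r by (intro L(2)) auto
    also have "\<dots> < (L + 1) * t" using t by simp
    also have "\<dots> \<le> e" using t(3) L(1) by (simp add: field_simps)
    finally show ?thesis .
  qed
  with t(1) show ?thesis by (rule that)
qed

lemma analytic2_comp:
  assumes h: "analytic2 h" and s: "analytic2 s1" "analytic2 s2" "s1 (0, 0) = 0" "s2 (0, 0) = 0"
  shows "analytic2 (\<lambda>p. h (s1 p, s2 p))"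
proof -
  obtain r c where hc: "ps2 h r c" using analytic2_imp_ps2[OF h] .
  have r: "0 < r" using hc by (simp add: ps2_def)
  obtain t1 where t1: "0 < t1" "\<And>x y. norm x < t1 \<Longrightarrow> norm y < t1 \<Longrightarrow> norm (s1 (x, y) - s1 (0, 0)) < r"
    using analytic2_small[OF s(1) r] by blast
  obtain t2 where t2: "0 < t2" "\<And>x y. norm x < t2 \<Longrightarrow> norm y < t2 \<Longrightarrow> norm (s2 (x, y) - s2 (0, 0)) < r"
    using analytic2_small[OF s(2) r] by blast
  obtain R where R: "sephol s1 R" "sephol s2 R" using analytic2_common[OF s(1,2)] .
  define t where "t = min R (min t1 t2)"
  have t: "0 < t" using R t1 t2 by (auto simp: t_def sephol_def)
  have S: "sephol s1 t" "sephol s2 t" using sephol_mono[OF R(1) t] sephol_mono[OF R(2) t] by (auto simp: t_def)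
  have b: "norm (s1 (x, y)) \<le> r" "norm (s2 (x, y)) \<le> r" if "norm x < t" "norm y < t" for x y
  proof -
    have "norm (s1 (x, y) - s1 (0, 0)) < r" "norm (s2 (x, y) - s2 (0, 0)) < r"
      using that by (auto simp: t_def intro!: t1(2) t2(2))
    then show "norm (s1 (x, y)) \<le> r" "norm (s2 (x, y)) \<le> r" using s by auto
  qed
  obtain M where M: "\<And>x y. norm x \<le> r \<Longrightarrow> norm y \<le> r \<Longrightarrow> norm (h (x, y)) \<le> M"
    by (rule ps2_bounded[OF hc]) blast
  have "sephol (\<lambda>p. h (s1 p, s2 p)) t" unfolding sephol_def
  proof (intro conjI ballI t)
    show "\<exists>M. \<forall>x\<in>ball 0 t. \<forall>y\<in>ball 0 t. norm (h (s1 (x, y), s2 (x, y))) \<le> M"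
      using b M by (intro exI[of _ M]) auto
    show "(\<lambda>x. h (s1 (x, y), s2 (x, y))) holomorphic_on ball 0 t" if "y \<in> ball 0 t" for y
      using that S b by (intro ps2_holomorphic_comp[OF hc]) (auto simp: sephol_def)
    show "(\<lambda>y. h (s1 (x, y), s2 (x, y))) holomorphic_on ball 0 t" if "x \<in> ball 0 t" for x
      using that S b by (intro ps2_holomorphic_comp[OF hc]) (auto simp: sephol_def)
  qed
  then show ?thesis by (auto simp: analytic2_iff_sephol)
qed

section \<open>Germs of maps and equivalence of curves\<close>

lemma eventually_nhds_00:
  "(\<forall>\<^sub>F p in nhds (0 :: complex, 0 :: complex). P p) \<longleftrightarrow>
   (\<exists>t>0. \<forall>x y. norm x < t \<longrightarrow> norm y < t \<longrightarrow> P (x, y))"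
proof
  assume "\<forall>\<^sub>F p in nhds (0 :: complex, 0 :: complex). P p"
  then obtain d where d: "d > 0" "\<And>p. dist p (0, 0) < d \<Longrightarrow> P p" unfolding eventually_nhds_metric by blast
  have "P (x, y)" if "norm x < d / 2" "norm y < d / 2" for x y
  proof -
    have "dist (x, y) (0, 0) \<le> norm x + norm y" unfolding dist_Pair_Pair by (simp add: sqrt_sum_squares_le_sum)
    with that show ?thesis by (intro d) auto
  qed
  then show "\<exists>t>0. \<forall>x y. norm x < t \<longrightarrow> norm y < t \<longrightarrow> P (x, y)" using d by (intro exI[of _ "d / 2"]) auto
next
  assume "\<exists>t>0. \<forall>x y. norm x < t \<longrightarrow> norm y < t \<longrightarrow> P (x, y)"
  then obtain t where t: "t > 0" "\<And>x y. norm x < t \<Longrightarrow> norm y < t \<Longrightarrow> P (x, y)" by blast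
  have "P p" if "dist p (0, 0) < t" for p
  proof -
    have "norm (fst p) < t" "norm (snd p) < t"
      using dist_fst_le[of p "(0, 0)"] dist_snd_le[of p "(0, 0)"] that by auto
    then show ?thesis using t(2)[of "fst p" "snd p"] by simp
  qed
  then show "\<forall>\<^sub>F p in nhds (0 :: complex, 0 :: complex). P p" unfolding eventually_nhds_metric using t(1) by blast
qed

lemma analytic2_tendsto:
  assumes "analytic2 s"
  shows "(s \<longlongrightarrow> s (0, 0)) (nhds (0, 0))"
  unfolding tendsto_iff eventually_nhds_00 dist_norm using analytic2_small[OF assms] by metis

lemma analytic2_map_tendsto:
  assumes "analytic2 (fst \<circ> s)" "analytic2 (snd \<circ> s)" "s (0, 0) = (0, 0)"
  shows "filterlim s (nhds (0, 0)) (nhds (0, 0))"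
proof -
  have "((\<lambda>p. ((fst \<circ> s) p, (snd \<circ> s) p)) \<longlongrightarrow> ((fst \<circ> s) (0, 0), (snd \<circ> s) (0, 0))) (nhds (0, 0))"
    by (intro tendsto_Pair analytic2_tendsto assms)
  then show ?thesis using assms(3) by simp
qed

lemma analytic2_map_comp:
  assumes "analytic2 h" "analytic2 (fst \<circ> s)" "analytic2 (snd \<circ> s)" "s (0, 0) = (0, 0)"
  shows "analytic2 (h \<circ> s)"
  using analytic2_comp[OF assms(1-3)] assms(4) by (simp add: o_def)

lemma aut2_comp:
  assumes "aut2 s" "aut2 s'"
  shows "aut2 (s' \<circ> s)"
proof -
  obtain t where s: "analytic2 (fst \<circ> s)" "analytic2 (snd \<circ> s)" "s (0, 0) = (0, 0)"
    "analytic2 (fst \<circ> t)" "analytic2 (snd \<circ> t)" "t (0, 0) = (0, 0)"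
    "\<forall>\<^sub>F p in nhds (0, 0). s (t p) = p" "\<forall>\<^sub>F p in nhds (0, 0). t (s p) = p"
    using assms(1) unfolding aut2_def by blast
  obtain t' where s': "analytic2 (fst \<circ> s')" "analytic2 (snd \<circ> s')" "s' (0, 0) = (0, 0)"
    "analytic2 (fst \<circ> t')" "analytic2 (snd \<circ> t')" "t' (0, 0) = (0, 0)"
    "\<forall>\<^sub>F p in nhds (0, 0). s' (t' p) = p" "\<forall>\<^sub>F p in nhds (0, 0). t' (s' p) = p"
    using assms(2) unfolding aut2_def by blast
  have "\<forall>\<^sub>F p in nhds (0, 0). s (t (t' p)) = t' p"
    using filterlim_iff[THEN iffD1, OF analytic2_map_tendsto[OF s'(4-6)]] s(7) by blast
  then have 1: "\<forall>\<^sub>F p in nhds (0, 0). s' (s (t (t' p))) = p" using s'(7) by eventually_elim simp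
  have "\<forall>\<^sub>F p in nhds (0, 0). t' (s' (s p)) = s p"
    using filterlim_iff[THEN iffD1, OF analytic2_map_tendsto[OF s(1-3)]] s'(8) by blast
  then have 2: "\<forall>\<^sub>F p in nhds (0, 0). t (t' (s' (s p))) = p" using s(8) by eventually_elim simp
  show ?thesis unfolding aut2_def
    using analytic2_map_comp[OF s'(1) s(1-3)] analytic2_map_comp[OF s'(2) s(1-3)]
      analytic2_map_comp[OF s(4) s'(4-6)] analytic2_map_comp[OF s(5) s'(4-6)] 1 2 s(3,6) s'(3,6)
    by (intro conjI exI[of _ "t \<circ> t'"]) (simp_all add: comp_assoc)
qed

lemma analytic1_tendsto: "analytic1 f \<Longrightarrow> (f \<longlongrightarrow> f 0) (nhds 0)"
  unfolding analytic1_def using analytic_at_imp_isCont tendsto_at_iff_tendsto_nhds isCont_def by blast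

lemma analytic1_comp: "analytic1 f \<Longrightarrow> analytic1 g \<Longrightarrow> g 0 = 0 \<Longrightarrow> analytic1 (f \<circ> g)"
  unfolding analytic1_def by (intro analytic_on_compose) auto

lemma aut1_comp:
  assumes "aut1 s" "aut1 s'"
  shows "aut1 (s' \<circ> s)"
proof -
  obtain t where s: "analytic1 s" "s 0 = 0" "analytic1 t" "t 0 = 0"
    "\<forall>\<^sub>F p in nhds 0. s (t p) = p" "\<forall>\<^sub>F p in nhds 0. t (s p) = p"
    using assms(1) unfolding aut1_def by blast
  obtain t' where s': "analytic1 s'" "s' 0 = 0" "analytic1 t'" "t' 0 = 0"
    "\<forall>\<^sub>F p in nhds 0. s' (t' p) = p" "\<forall>\<^sub>F p in nhds 0. t' (s' p) = p"
    using assms(2) unfolding aut1_def by blast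
  have "filterlim t' (nhds 0) (nhds 0)" "filterlim s (nhds 0) (nhds 0)"
    using analytic1_tendsto[OF s'(3)] analytic1_tendsto[OF s(1)] s s' by auto
  then have "\<forall>\<^sub>F p in nhds 0. s (t (t' p)) = t' p" "\<forall>\<^sub>F p in nhds 0. t' (s' (s p)) = s p"
    using s(5) s'(6) unfolding filterlim_iff by blast+
  then have "\<forall>\<^sub>F p in nhds 0. s' (s (t (t' p))) = p" "\<forall>\<^sub>F p in nhds 0. t (t' (s' (s p))) = p"
    using s'(5) s(6) by (eventually_elim, simp)+
  then show ?thesis unfolding aut1_def
    using analytic1_comp[OF s'(1) s(1,2)] analytic1_comp[OF s(3) s'(3,4)] s(2,4) s'(2,4)
    by (intro conjI exI[of _ "t \<circ> t'"]) simp_all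
qed

lemma aut1_tendsto: "aut1 r \<Longrightarrow> filterlim r (nhds 0) (nhds 0)"
  using analytic1_tendsto[of r] by (simp add: aut1_def)

lemma A_equiv_trans:
  assumes "A_equiv f g" "A_equiv g h"
  shows "A_equiv f h"
proof -
  obtain s r where 1: "aut2 s" "aut1 r" "\<forall>\<^sub>F t in nhds 0. g (r t) = s (f t)"
    using assms(1) unfolding A_equiv_def by blast
  obtain s' r' where 2: "aut2 s'" "aut1 r'" "\<forall>\<^sub>F t in nhds 0. h (r' t) = s' (g t)"
    using assms(2) unfolding A_equiv_def by blast
  have "\<forall>\<^sub>F t in nhds 0. h (r' (r t)) = s' (g (r t))"
    using aut1_tendsto[OF 1(2)] 2(3) unfolding filterlim_iff by blast
  then have "\<forall>\<^sub>F t in nhds 0. h ((r' \<circ> r) t) = (s' \<circ> s) (f t)" using 1(3) by eventually_elim simp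
  then show ?thesis unfolding A_equiv_def using aut2_comp[OF 1(1) 2(1)] aut1_comp[OF 1(2) 2(2)] by blast
qed

lemma param_tendsto:
  assumes "param f"
  shows "(f \<longlongrightarrow> (0, 0)) (nhds 0)"
proof -
  have "((\<lambda>t. ((fst \<circ> f) t, (snd \<circ> f) t)) \<longlongrightarrow> ((fst \<circ> f) 0, (snd \<circ> f) 0)) (nhds 0)"
    using assms unfolding param_def by (blast intro: tendsto_Pair analytic1_tendsto)
  then show ?thesis using assms by (simp add: param_def)
qed

text \<open>\<open>param f\<close> makes the curve tend to the origin, where the local inverse of
  the plane automorphism is available.\<close>

lemma A_equiv_sym:
  assumes "A_equiv f g" "param f"
  shows "A_equiv g f"
proof -
  obtain s r where 1: "aut2 s" "aut1 r" "\<forall>\<^sub>F t in nhds 0. g (r t) = s (f t)"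
    using assms(1) unfolding A_equiv_def by blast
  obtain t where s: "analytic2 (fst \<circ> s)" "analytic2 (snd \<circ> s)" "s (0, 0) = (0, 0)"
    "analytic2 (fst \<circ> t)" "analytic2 (snd \<circ> t)" "t (0, 0) = (0, 0)"
    "\<forall>\<^sub>F p in nhds (0, 0). s (t p) = p" "\<forall>\<^sub>F p in nhds (0, 0). t (s p) = p"
    using 1(1) unfolding aut2_def by blast
  obtain q where r: "analytic1 r" "r 0 = 0" "analytic1 q" "q 0 = 0"
    "\<forall>\<^sub>F p in nhds 0. r (q p) = p" "\<forall>\<^sub>F p in nhds 0. q (r p) = p"
    using 1(2) unfolding aut1_def by blast
  have at: "aut2 t" "aut1 q" unfolding aut2_def aut1_def using s r by blast+
  have q: "filterlim q (nhds 0) (nhds 0)" using aut1_tendsto[OF at(2)] .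
  have 2: "\<forall>\<^sub>F u in nhds 0. g (r (q u)) = s (f (q u))" using q 1(3) unfolding filterlim_iff by blast
  have "filterlim (\<lambda>u. f (q u)) (nhds (0, 0)) (nhds 0)" using filterlim_compose[OF param_tendsto[OF assms(2)] q] .
  then have "\<forall>\<^sub>F u in nhds 0. t (s (f (q u))) = f (q u)" using s(8) unfolding filterlim_iff by blast
  then have "\<forall>\<^sub>F u in nhds 0. f (q u) = t (g u)" using 2 r(5) by eventually_elim simp
  then show ?thesis unfolding A_equiv_def using at by blast
qed

section \<open>Analytic automorphisms of the plane\<close>

text \<open>The perturbation \<open>(\<beta> Y + u, v)\<close> of the identity need not be small because of \<open>\<beta>\<close>. It becomes a
  contraction for the norm that gives the second coordinate the weight \<open>K\<close>.\<close>

locale contraction_inverse =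
  fixes u v :: "complex \<times> complex \<Rightarrow> complex" and ru rv s t K :: real and cu cv and \<beta> :: complex
  assumes u: "ps2 u ru cu" and v: "ps2 v rv cv" and z: "u (0, 0) = 0" "v (0, 0) = 0"
    and K: "K = 4 * norm \<beta> + 1" and s: "0 < s" "s \<le> ru" "s \<le> rv" and t: "t = s / (2 * K)"
    and Lu: "\<And>x y x' y' d. \<lbrakk>norm x \<le> s; norm y \<le> s; norm x' \<le> s; norm y' \<le> s; norm (x - x') \<le> d; norm (y - y') \<le> d\<rbrakk>
      \<Longrightarrow> norm (u (x, y) - u (x', y')) \<le> 1 / (4 * K) * d"
    and Lv: "\<And>x y x' y' d. \<lbrakk>norm x \<le> s; norm y \<le> s; norm x' \<le> s; norm y' \<le> s; norm (x - x') \<le> d; norm (y - y') \<le> d\<rbrakk>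
      \<Longrightarrow> norm (v (x, y) - v (x', y')) \<le> 1 / (4 * K) * d"
begin

definition wn :: "complex \<times> complex \<Rightarrow> real" where "wn p = max (norm (fst p)) (K * norm (snd p))"

definition Np :: "complex \<times> complex \<Rightarrow> complex \<times> complex" where "Np p = (\<beta> * snd p + u p, v p)"

text \<open>Iteration for the fixed point of \<open>p = q - Np p\<close>, which is the preimage of
  \<open>q\<close> under the identity plus \<open>Np\<close>. Explicit iterates make it possible to
  show holomorphy in \<open>q\<close> stage by stage.\<close>

primrec G :: "nat \<Rightarrow> complex \<times> complex \<Rightarrow> complex \<times> complex" where
  "G 0 q = (0, 0)"
| "G (Suc k) q = q - Np (G k q)"

lemma K1: "1 \<le> K" "4 * norm \<beta> \<le> K" "0 < K"
  using norm_ge_zero[of \<beta>] unfolding K by linarith+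

lemma wn_le: "wn p \<le> d \<longleftrightarrow> norm (fst p) \<le> d \<and> K * norm (snd p) \<le> d" by (auto simp: wn_def)

lemma wn_leD: "wn p \<le> d \<Longrightarrow> norm (fst p) \<le> d" "wn p \<le> d \<Longrightarrow> norm (snd p) \<le> d"
proof -
  assume d: "wn p \<le> d"
  then show "norm (fst p) \<le> d" by (simp add: wn_le)
  have "1 * norm (snd p) \<le> K * norm (snd p)" using K1 by (intro mult_right_mono) auto
  then show "norm (snd p) \<le> d" using d by (simp add: wn_le)
qed

lemma wn_ge0: "0 \<le> wn p" by (simp add: wn_def le_max_iff_disj)

lemma wn_triangle: "wn (p + q) \<le> wn p + wn q"
proof -
  have "K * norm (snd p + snd q) \<le> K * norm (snd p) + K * norm (snd q)"
    using norm_triangle_ineq[of "snd p" "snd q"] K1 by (simp flip: distrib_left)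
  then show ?thesis using norm_triangle_ineq[of "fst p" "fst q"] by (auto simp: wn_def)
qed

lemma wn_eq0: "wn p \<le> 0 \<Longrightarrow> p = (0, 0)"
  using wn_leD[of p 0] by (cases p) auto

lemma Np0: "Np (0, 0) = (0, 0)" by (simp add: Np_def z)

text \<open>Every contribution is at most one quarter of the distance: \<open>K\<close> is at least
  \<open>4 * norm \<beta>\<close>, which bounds the linear term by the weighted second coordinate,
  and the Lipschitz constant \<open>1 / (4 * K)\<close> serves for \<open>u\<close> and, after
  multiplication by \<open>K\<close>, for \<open>v\<close>. At most two contributions meet in one
  coordinate.\<close>

lemma Np_contr:
  assumes p: "wn p \<le> s" "wn p' \<le> s"
  shows "wn (Np p - Np p') \<le> wn (p - p') / 2"
proof -
  define d where "d = wn (p - p')"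
  note pd = wn_leD[OF p(1)] wn_leD[OF p(2)] wn_leD[of "p - p'" d, unfolded d_def, simplified]
  have lu: "norm (u p - u p') \<le> 1 / (4 * K) * d"
    using Lu[of "fst p" "snd p" "fst p'" "snd p'" d] pd by (simp add: d_def)
  have lv: "norm (v p - v p') \<le> 1 / (4 * K) * d"
    using Lv[of "fst p" "snd p" "fst p'" "snd p'" d] pd by (simp add: d_def)
  have d0: "0 \<le> d" by (simp add: d_def wn_ge0)
  have "1 / (4 * K) * d \<le> 1 / 4 * d" using K1 d0 by (intro mult_right_mono) (auto simp: field_simps)
  with lu have lu': "norm (u p - u p') \<le> d / 4" by simp
  have "K * norm (v p - v p') \<le> K * (1 / (4 * K) * d)" using lv K1 by (intro mult_left_mono) auto
  then have lv': "K * norm (v p - v p') \<le> d / 4" using K1 by simp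
  have "4 * norm (\<beta> * (snd p - snd p')) \<le> K * norm (snd p - snd p')"
    unfolding norm_mult using K1 by (simp add: mult_right_mono flip: mult.assoc)
  also have "\<dots> \<le> d" using wn_le[of "p - p'" d] by (simp add: d_def)
  finally have "norm (\<beta> * (snd p - snd p')) \<le> d / 4" by simp
  then have "norm (\<beta> * (snd p - snd p') + (u p - u p')) \<le> d / 4 + d / 4"
    using lu' by (intro norm_triangle_le add_mono)
  then show ?thesis unfolding wn_le using lv' d0 by (auto simp: Np_def d_def[symmetric] algebra_simps)
qed

lemma t0: "0 < t" using s K1 by (simp add: t)

lemma wn_t: "norm (fst q) < t \<Longrightarrow> norm (snd q) < t \<Longrightarrow> wn q \<le> s / 2"
proof -
  assume q: "norm (fst q) < t" "norm (snd q) < t"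
  have Kt: "K * t = s / 2" using K1 by (simp add: t)
  have "t \<le> K * t" using K1 t0 by simp
  then have "norm (fst q) \<le> s / 2" using q Kt by simp
  moreover have "K * norm (snd q) \<le> K * t" using q K1 by (intro mult_left_mono) auto
  ultimately show "wn q \<le> s / 2" unfolding wn_le Kt by blast
qed

lemma step_bound: "wn q \<le> s / 2 \<Longrightarrow> wn p \<le> s \<Longrightarrow> wn (q - Np p) \<le> s"
proof -
  assume q: "wn q \<le> s / 2" and p: "wn p \<le> s"
  have "wn (0, 0) \<le> s" using s by (simp add: wn_def)
  then have "wn (Np p - Np (0, 0)) \<le> wn (p - (0, 0)) / 2"
    using p by (intro Np_contr)
  moreover have "p - (0, 0) = p" "Np p - Np (0, 0) = Np p" unfolding Np0 by (simp_all flip: zero_prod_def)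
  ultimately have "wn (Np p) \<le> s / 2" using p by simp
  moreover have "wn (- Np p) = wn (Np p)" by (simp add: wn_def)
  ultimately show ?thesis using wn_triangle[of q "- Np p"] q by simp
qed

lemma G_bound: "wn q \<le> s / 2 \<Longrightarrow> wn (G k q) \<le> s"
  using s by (induction k) (auto simp: step_bound, simp add: wn_def)

lemma G_diff: "wn q \<le> s / 2 \<Longrightarrow> wn (G (Suc k) q - G k q) \<le> s * (1 / 2) ^ k"
proof (induction k)
  case 0
  then show ?case using G_bound[of q 1] by (simp add: wn_def)
next
  case (Suc k)
  have "G (Suc (Suc k)) q - G (Suc k) q = - (Np (G (Suc k) q) - Np (G k q))"
    by (simp del: G.simps(2) add: G.simps(2)[of "Suc k"] G.simps(2)[of k, symmetric])
       (simp add: algebra_simps)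
  then have "wn (G (Suc (Suc k)) q - G (Suc k) q) = wn (Np (G (Suc k) q) - Np (G k q))"
    by (simp only:) (simp add: wn_def norm_minus_commute)
  also have "\<dots> \<le> wn (G (Suc k) q - G k q) / 2" using G_bound[OF Suc(2)] by (intro Np_contr)
  also have "\<dots> \<le> s * (1 / 2) ^ Suc k" using Suc by simp
  finally show ?case .
qed

text \<open>The limit of the iterates, written as a telescoping series so that \<open>G_diff\<close>
  and the M-test give uniform convergence.\<close>

definition tau1 where "tau1 q = (\<Sum>k. fst (G (Suc k) q) - fst (G k q))"
definition tau2 where "tau2 q = (\<Sum>k. snd (G (Suc k) q) - snd (G k q))"
definition tau where "tau q = (tau1 q, tau2 q)"

definition D where "D = {q :: complex \<times> complex. norm (fst q) < t \<and> norm (snd q) < t}"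

lemma G_unif:
  "uniform_limit D (\<lambda>n q. fst (G n q)) tau1 sequentially" "uniform_limit D (\<lambda>n q. snd (G n q)) tau2 sequentially"
proof -
  have S: "summable (\<lambda>k. s * (1 / 2) ^ k)" by (intro summable_mult summable_geometric) simp
  have b: "norm (fst (G (Suc k) q) - fst (G k q)) \<le> s * (1 / 2) ^ k"
    "norm (snd (G (Suc k) q) - snd (G k q)) \<le> s * (1 / 2) ^ k" if "q \<in> D" for k q
    using wn_leD[OF G_diff[OF wn_t, of q k]] that unfolding D_def by (simp_all del: G.simps)
  have tel: "(\<Sum>i<n. fst (G (Suc i) q) - fst (G i q)) = fst (G n q)"
     "(\<Sum>i<n. snd (G (Suc i) q) - snd (G i q)) = snd (G n q)" for n q
    using sum_lessThan_telescope[of "\<lambda>i. fst (G i q)" n] sum_lessThan_telescope[of "\<lambda>i. snd (G i q)" n]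
    by (simp_all del: G.simps(2))
  show "uniform_limit D (\<lambda>n q. fst (G n q)) tau1 sequentially"
    using Weierstrass_m_test[of D "\<lambda>k q. fst (G (Suc k) q) - fst (G k q)", OF b(1) S]
    unfolding tel tau1_def by simp
  show "uniform_limit D (\<lambda>n q. snd (G n q)) tau2 sequentially"
    using Weierstrass_m_test[of D "\<lambda>k q. snd (G (Suc k) q) - snd (G k q)", OF b(2) S]
    unfolding tel tau2_def by simp
qed

lemma G_tendsto: "q \<in> D \<Longrightarrow> (\<lambda>n. G n q) \<longlonglongrightarrow> tau q"
  using tendsto_Pair[OF tendsto_uniform_limitI[OF G_unif(1), of q] tendsto_uniform_limitI[OF G_unif(2), of q]]
  by (simp add: tau_def)

lemma wn_tendsto: "f \<longlonglongrightarrow> l \<Longrightarrow> (\<lambda>n. wn (f n)) \<longlonglongrightarrow> wn l"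
  unfolding wn_def by (intro tendsto_intros)

lemma tau_bound: "q \<in> D \<Longrightarrow> wn (tau q) \<le> s"
proof -
  assume q: "q \<in> D"
  then have "wn (G n q) \<le> s" for n using wn_t G_bound by (simp add: D_def)
  then show ?thesis using wn_tendsto[OF G_tendsto[OF q]] by (intro LIMSEQ_le_const2) auto
qed

lemma tau_fix: "q \<in> D \<Longrightarrow> tau q = q - Np (tau q)"
proof -
  assume q: "q \<in> D"
  have Gb: "wn (G n q) \<le> s" for n using q wn_t G_bound by (simp add: D_def)
  have "(\<lambda>n. wn (G n q - tau q)) \<longlonglongrightarrow> wn (tau q - tau q)"
    by (intro wn_tendsto tendsto_intros G_tendsto q)
  then have l: "(\<lambda>n. wn (G n q - tau q) / 2) \<longlonglongrightarrow> 0"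
    using tendsto_divide[of _ 0 sequentially "\<lambda>_. 2" 2] by (simp add: wn_def)
  have "wn (G (Suc n) q - (q - Np (tau q))) \<le> wn (G n q - tau q) / 2" for n
  proof -
    have "G (Suc n) q - (q - Np (tau q)) = - (Np (G n q) - Np (tau q))" by simp
    then have "wn (G (Suc n) q - (q - Np (tau q))) = wn (Np (G n q) - Np (tau q))"
      by (simp only:) (simp add: wn_def norm_minus_commute)
    then show ?thesis using Np_contr[OF Gb tau_bound[OF q]] by simp
  qed
  then have "(\<lambda>n. wn (G (Suc n) q - (q - Np (tau q)))) \<longlonglongrightarrow> 0"
    using wn_ge0 l by (intro tendsto_sandwich[OF _ _ tendsto_const l]) auto
  moreover have "(\<lambda>n. wn (G (Suc n) q - (q - Np (tau q)))) \<longlonglongrightarrow> wn (tau q - (q - Np (tau q)))"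
    by (intro wn_tendsto tendsto_intros LIMSEQ_Suc G_tendsto q)
  ultimately have "wn (tau q - (q - Np (tau q))) = 0" using LIMSEQ_unique by blast
  then have "tau q - (q - Np (tau q)) = (0, 0)" by (intro wn_eq0) simp
  then show ?thesis by (metis diff_eq_diff_eq diff_self zero_prod_def)
qed

lemma tau_unique: "q \<in> D \<Longrightarrow> wn p \<le> s \<Longrightarrow> p = q - Np p \<Longrightarrow> p = tau q"
proof -
  assume q: "q \<in> D" and p: "wn p \<le> s" "p = q - Np p"
  have "(q - Np p) - (q - Np (tau q)) = - (Np p - Np (tau q))" by simp
  then have "p - tau q = - (Np p - Np (tau q))" unfolding p(2)[symmetric] tau_fix[OF q, symmetric] .
  then have "wn (p - tau q) = wn (Np p - Np (tau q))" by (simp only:) (simp add: wn_def norm_minus_commute)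
  also have "\<dots> \<le> wn (p - tau q) / 2" using Np_contr[OF p(1) tau_bound[OF q]] .
  finally have "p - tau q = (0, 0)" by (intro wn_eq0) simp
  then show ?thesis by (metis eq_iff_diff_eq_0 zero_prod_def)
qed

lemma D_iff: "(x, y) \<in> D \<longleftrightarrow> norm x < t \<and> norm y < t" by (simp add: D_def)

lemma G_hol:
  "norm y < t \<Longrightarrow> (\<lambda>x. fst (G k (x, y))) holomorphic_on ball 0 t \<and> (\<lambda>x. snd (G k (x, y))) holomorphic_on ball 0 t"
  "norm x < t \<Longrightarrow> (\<lambda>y. fst (G k (x, y))) holomorphic_on ball 0 t \<and> (\<lambda>y. snd (G k (x, y))) holomorphic_on ball 0 t"
proof -
  have b: "norm (fst (G k (x, y))) \<le> ru \<and> norm (snd (G k (x, y))) \<le> ru \<and> norm (fst (G k (x, y))) \<le> rv \<and> norm (snd (G k (x, y))) \<le> rv"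
    if "norm x < t" "norm y < t" for k x y
    using wn_leD[OF G_bound[OF wn_t, of "(x, y)" k]] that s by auto
  note uv = ps2_holomorphic_comp[OF u open_ball] ps2_holomorphic_comp[OF v open_ball]
  show "norm y < t \<Longrightarrow> (\<lambda>x. fst (G k (x, y))) holomorphic_on ball 0 t \<and> (\<lambda>x. snd (G k (x, y))) holomorphic_on ball 0 t"
  proof (induction k)
    case (Suc k)
    have "(\<lambda>x. u (fst (G k (x, y)), snd (G k (x, y)))) holomorphic_on ball 0 t"
      by (rule uv(1)) (use Suc b in auto)
    moreover have "(\<lambda>x. v (fst (G k (x, y)), snd (G k (x, y)))) holomorphic_on ball 0 t"
      by (rule uv(2)) (use Suc b in auto)
    ultimately show ?case using Suc by (auto simp: Np_def intro!: holomorphic_intros)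
  qed simp
  show "norm x < t \<Longrightarrow> (\<lambda>y. fst (G k (x, y))) holomorphic_on ball 0 t \<and> (\<lambda>y. snd (G k (x, y))) holomorphic_on ball 0 t"
  proof (induction k)
    case (Suc k)
    have "(\<lambda>y. u (fst (G k (x, y)), snd (G k (x, y)))) holomorphic_on ball 0 t"
      by (rule uv(1)) (use Suc b in auto)
    moreover have "(\<lambda>y. v (fst (G k (x, y)), snd (G k (x, y)))) holomorphic_on ball 0 t"
      by (rule uv(2)) (use Suc b in auto)
    ultimately show ?case using Suc by (auto simp: Np_def intro!: holomorphic_intros)
  qed simp
qed

lemma uniform_limit_slice:
  assumes "uniform_limit D f l F" "\<And>z. z \<in> B \<Longrightarrow> g z \<in> D"
  shows "uniform_limit B (\<lambda>n z. f n (g z)) (\<lambda>z. l (g z)) F"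
  unfolding uniform_limit_iff
proof (intro allI impI)
  fix e :: real assume "0 < e"
  then have "\<forall>\<^sub>F n in F. \<forall>x\<in>D. dist (f n x) (l x) < e" using assms(1) by (simp add: uniform_limit_iff)
  then show "\<forall>\<^sub>F n in F. \<forall>z\<in>B. dist (f n (g z)) (l (g z)) < e"
    by eventually_elim (use assms(2) in blast)
qed

lemma tau_sephol: "sephol tau1 t" "sephol tau2 t"
proof -
  have tb: "norm (tau1 (x, y)) \<le> s" "norm (tau2 (x, y)) \<le> s" if "norm x < t" "norm y < t" for x y
    using wn_leD[OF tau_bound, of "(x, y)"] that by (auto simp: D_iff tau_def)
  have h: "(\<lambda>x. f (x, y)) holomorphic_on ball 0 t" "norm y < t \<Longrightarrow> True"
    if "uniform_limit D F f sequentially" "\<And>n. (\<lambda>x. F n (x, y)) holomorphic_on ball 0 t" "norm y < t" for f F y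
  proof -
    show "(\<lambda>x. f (x, y)) holomorphic_on ball 0 t"
      by (rule holomorphic_uniform_limit_open[OF open_ball uniform_limit_slice[OF that(1)]])
         (use that in \<open>auto simp: D_iff\<close>)
  qed simp
  have h': "(\<lambda>y. f (x, y)) holomorphic_on ball 0 t"
    if "uniform_limit D F f sequentially" "\<And>n. (\<lambda>y. F n (x, y)) holomorphic_on ball 0 t" "norm x < t" for f F x
    by (rule holomorphic_uniform_limit_open[OF open_ball uniform_limit_slice[OF that(1)]])
         (use that in \<open>auto simp: D_iff\<close>)
  show "sephol tau1 t" unfolding sephol_def
  proof (intro conjI ballI t0)
    show "\<exists>M. \<forall>x\<in>ball 0 t. \<forall>y\<in>ball 0 t. norm (tau1 (x, y)) \<le> M" using tb by (intro exI[of _ s]) auto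
    show "(\<lambda>x. tau1 (x, y)) holomorphic_on ball 0 t" if "y \<in> ball 0 t" for y
      using h(1)[OF G_unif(1), of y] G_hol(1)[of y] that by simp
    show "(\<lambda>y. tau1 (x, y)) holomorphic_on ball 0 t" if "x \<in> ball 0 t" for x
      using h'[OF G_unif(1), of x] G_hol(2)[of x] that by simp
  qed
  show "sephol tau2 t" unfolding sephol_def
  proof (intro conjI ballI t0)
    show "\<exists>M. \<forall>x\<in>ball 0 t. \<forall>y\<in>ball 0 t. norm (tau2 (x, y)) \<le> M" using tb by (intro exI[of _ s]) auto
    show "(\<lambda>x. tau2 (x, y)) holomorphic_on ball 0 t" if "y \<in> ball 0 t" for y
      using h(1)[OF G_unif(2), of y] G_hol(1)[of y] that by simp
    show "(\<lambda>y. tau2 (x, y)) holomorphic_on ball 0 t" if "x \<in> ball 0 t" for x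
      using h'[OF G_unif(2), of x] G_hol(2)[of x] that by simp
  qed
qed

lemma aut2_perturbation: "aut2 (\<lambda>p. (fst p + \<beta> * snd p + u p, snd p + v p))"
proof -
  define S where "S = (\<lambda>p. (fst p + \<beta> * snd p + u p, snd p + v p))"
  have S: "S p = p + Np p" for p by (simp add: S_def Np_def plus_prod_def)
  have a: "analytic2 (\<lambda>p. fst p + \<beta> * snd p + u p)" "analytic2 (\<lambda>p. snd p + v p)"
    using ps2_imp_analytic2[OF u] ps2_imp_analytic2[OF v]
    by (auto intro!: analytic2_add analytic2_mult analytic2_const analytic2_fst analytic2_snd)
  have fs: "fst \<circ> S = (\<lambda>p. fst p + \<beta> * snd p + u p)" "snd \<circ> S = (\<lambda>p. snd p + v p)"
    by (auto simp: S_def)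
  have a': "analytic2 tau1" "analytic2 tau2" using tau_sephol by (auto simp: analytic2_iff_sephol)
  have ft: "fst \<circ> tau = tau1" "snd \<circ> tau = tau2" by (auto simp: tau_def)
  have S0: "S (0, 0) = (0, 0)" by (simp add: S_def z)
  have Dev: "\<forall>\<^sub>F p in nhds (0, 0). p \<in> D"
    unfolding eventually_nhds_00 using t0 by (auto simp: D_iff)
  have D0: "(0, 0) \<in> D" using t0 by (simp add: D_iff)
  have tau0: "tau (0, 0) = (0, 0)"
  proof (rule tau_unique[OF D0, symmetric])
    show "wn (0, 0) \<le> s" using s by (simp add: wn_def)
    show "(0, 0) = (0, 0) - Np (0, 0)" unfolding Np0 by (simp add: zero_prod_def)
  qed
  have 1: "\<forall>\<^sub>F p in nhds (0, 0). S (tau p) = p"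
    using Dev
  proof eventually_elim
    case (elim p)
    then show ?case unfolding S using tau_fix[OF elim] by (metis diff_add_cancel)
  qed
  have "filterlim S (nhds (0, 0)) (nhds (0, 0))"
    using a S0 by (intro analytic2_map_tendsto) (simp_all add: fs)
  then have "\<forall>\<^sub>F p in nhds (0, 0). S p \<in> D" using Dev unfolding filterlim_iff by blast
  then have 2: "\<forall>\<^sub>F p in nhds (0, 0). tau (S p) = p"
    using Dev
  proof eventually_elim
    case (elim p)
    have "wn p \<le> s / 2" using elim(2) wn_t by (simp add: D_def)
    then have "wn p \<le> s" using s by simp
    then show ?case using tau_unique[OF elim(1)] by (simp add: S)
  qed
  have "aut2 S" unfolding aut2_def fs
    by (intro conjI exI[of _ tau]) (use a S0 a' tau0 1 2 ft in \<open>simp_all only:\<close>)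
  then show ?thesis by (simp add: S_def)
qed

end

text \<open>This is the shape of a weight-raising change of coordinates: as \<open>n < m\<close>,
  the coordinate \<open>Y\<close> may enter the first component linearly, but \<open>X\<close> may
  not enter the second.\<close>

lemma aut2_near_identity:
  assumes u: "ps2 u ru cu" and v: "ps2 v rv cv"
    and c: "\<And>i j. i + j < 2 \<Longrightarrow> cu i j = 0" "\<And>i j. i + j < 2 \<Longrightarrow> cv i j = 0"
  shows "aut2 (\<lambda>p. (fst p + \<beta> * snd p + u p, snd p + v p))"
proof -
  define K where "K = 4 * norm \<beta> + 1"
  have "0 < K" using norm_ge_zero[of \<beta>] unfolding K_def by linarith
  then have K: "0 < 1 / (4 * K)" by simp
  obtain s1 where s1: "0 < s1" "s1 \<le> ru" "\<And>x y x' y' d. \<lbrakk>norm x \<le> s1; norm y \<le> s1; norm x' \<le> s1; norm y' \<le> s1;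
      norm (x - x') \<le> d; norm (y - y') \<le> d\<rbrakk> \<Longrightarrow> norm (u (x, y) - u (x', y')) \<le> 1 / (4 * K) * d"
    by (rule ps2_lipschitz_small[OF u c(1) K]) blast+
  obtain s2 where s2: "0 < s2" "s2 \<le> rv" "\<And>x y x' y' d. \<lbrakk>norm x \<le> s2; norm y \<le> s2; norm x' \<le> s2; norm y' \<le> s2;
      norm (x - x') \<le> d; norm (y - y') \<le> d\<rbrakk> \<Longrightarrow> norm (v (x, y) - v (x', y')) \<le> 1 / (4 * K) * d"
    by (rule ps2_lipschitz_small[OF v c(2) K]) blast+
  define s where "s = min s1 s2"
  have s: "0 < s" "s \<le> s1" "s \<le> s2" using s1 s2 by (auto simp: s_def)
  interpret contraction_inverse u v ru rv s "s / (2 * K)" K cu cv \<beta>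
  proof
    show "u (0, 0) = 0" "v (0, 0) = 0" using ps2_at_0[OF u] ps2_at_0[OF v] c[of 0 0] by auto
    show "ps2 u ru cu" "ps2 v rv cv" "K = 4 * norm \<beta> + 1" "s / (2 * K) = s / (2 * K)" by (fact u v K_def refl)+
    show "0 < s" "s \<le> ru" "s \<le> rv" using s s1(2) s2(2) by auto
    fix x y x' y' :: complex and d :: real
    assume "norm x \<le> s" "norm y \<le> s" "norm x' \<le> s" "norm y' \<le> s" "norm (x - x') \<le> d" "norm (y - y') \<le> d"
    then show "norm (u (x, y) - u (x', y')) \<le> 1 / (4 * K) * d" "norm (v (x, y) - v (x', y')) \<le> 1 / (4 * K) * d"
      using s by (auto intro!: s1(3) s2(3) simp del: times_divide_eq_left)
  qed
  show ?thesis by (rule aut2_perturbation)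
qed

text \<open>Divided by its leading power, \<open>f\<close> tends to its leading coefficient; if the
  order were below \<open>k\<close>, the bound would force this coefficient to be zero.\<close>

lemma fps_order_bound:
  fixes f :: "complex \<Rightarrow> complex"
  assumes F: "f has_fps_expansion F" and b: "\<forall>\<^sub>F t in nhds 0. norm (f t) \<le> C * norm t ^ k"
  shows "fps_X ^ k dvd F"
proof (rule ccontr)
  assume nd: "\<not> fps_X ^ k dvd F"
  then have F0: "F \<noteq> 0" by auto
  define d where "d = subdegree F"
  have d: "d < k"
  proof (rule ccontr)
    assume "\<not> d < k"
    then have "F $ i = 0" if "i < k" for i
      using that by (intro nth_less_subdegree_zero) (simp add: d_def)
    then show False using nd by (simp add: X_pow_dvd_iff)
  qed
  define g where "g = (\<lambda>x. if x = 0 then F $ d else f x / x ^ d)"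
  have g: "g has_fps_expansion fps_shift d F"
    unfolding g_def by (rule has_fps_expansion_shift[OF F]) (auto simp: d_def)
  have lim: "(g \<longlongrightarrow> F $ d) (at 0)"
    using has_fps_expansion_imp_continuous[OF g, of UNIV] by (simp add: continuous_within g_def)
  have "(g \<longlongrightarrow> 0) (at 0)"
  proof (rule Lim_null_comparison)
    show "\<forall>\<^sub>F t in at 0. norm (g t) \<le> C * norm t ^ (k - d)"
      using b unfolding eventually_at_filter
    proof eventually_elim
      case (elim t)
      show ?case
      proof (intro impI)
        assume t: "t \<noteq> 0"
        have "norm (g t) = norm (f t) / norm t ^ d" using t by (simp add: g_def norm_divide norm_power)
        also have "\<dots> \<le> C * norm t ^ k / norm t ^ d" using elim by (intro divide_right_mono) auto
        also have "\<dots> = C * norm t ^ (k - d)" using t d by (simp add: power_diff)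
        finally show "norm (g t) \<le> C * norm t ^ (k - d)" .
      qed
    qed
    have "((\<lambda>t :: complex. C * norm t ^ (k - d)) \<longlongrightarrow> C * norm (0 :: complex) ^ (k - d)) (at 0)"
      by (intro tendsto_intros)
    then show "((\<lambda>t :: complex. C * norm t ^ (k - d)) \<longlongrightarrow> 0) (at 0)" using d by (simp add: power_0_left)
  qed
  then have "F $ d = 0" using lim tendsto_unique[of "at (0::complex)" g] by force
  then show False using F0 by (simp add: d_def)
qed

lemma fps_linear_bound:
  fixes f :: "complex \<Rightarrow> complex"
  assumes F: "f has_fps_expansion F" and F0: "F $ 0 = 0"
  obtains A where "0 < A" "\<forall>\<^sub>F t in nhds 0. norm (f t) \<le> A * norm t"
proof -
  define g where "g = (\<lambda>x. if x = 0 then F $ 1 else f x / x ^ 1)"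
  have f0: "f 0 = 0" using has_fps_expansion_imp_0_eq_fps_nth_0[OF F] F0 by simp
  have "g has_fps_expansion fps_shift 1 F" if "F \<noteq> 0"
    unfolding g_def
  proof (rule has_fps_expansion_shift[OF F])
    show "1 \<le> subdegree F" using F0 that by (intro subdegree_geI) auto
  qed simp
  moreover have "\<exists>G. g has_fps_expansion G" if "F = 0"
  proof -
    have "\<forall>\<^sub>F t in nhds 0. f t = 0" using F that by (simp add: has_fps_expansion_0_iff)
    then have "\<forall>\<^sub>F t in nhds 0. g t = 0" by eventually_elim (simp add: g_def that)
    then show ?thesis using has_fps_expansion_0_iff by blast
  qed
  ultimately obtain G where G: "g has_fps_expansion G" by blast
  have "(g \<longlongrightarrow> g 0) (at 0)"
    using has_fps_expansion_imp_continuous[OF G, of UNIV] by (simp add: continuous_within)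
  then have "(g \<longlongrightarrow> g 0) (nhds 0)" by (simp add: tendsto_at_iff_tendsto_nhds)
  then have "\<forall>\<^sub>F t in nhds 0. dist (g t) (g 0) < 1" by (rule tendstoD) simp
  then have "\<forall>\<^sub>F t in nhds 0. norm (f t) \<le> (norm (g 0) + 1) * norm t"
  proof eventually_elim
    case (elim t)
    show ?case
    proof (cases "t = 0")
      case False
      have "norm (g t) \<le> norm (g 0) + 1" using elim norm_triangle_sub[of "g t" "g 0"] by (simp add: dist_norm)
      moreover have "norm (f t) = norm (g t) * norm t" using False by (simp add: g_def norm_divide)
      ultimately show ?thesis by (simp add: mult_right_mono)
    qed (simp add: f0)
  qed
  moreover have "0 < norm (g 0) + 1" using norm_ge_zero[of "g 0"] by linarith
  ultimately show ?thesis using that by blast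
qed

text \<open>A term outside the square has degree at least \<open>N + 1\<close>, so shrinking the
  arguments from \<open>r\<close> to \<open>s\<close> gains the factor
  \<open>(s / r) ^ Suc N\<close> uniformly.\<close>

lemma ps2_remainder:
  assumes h: "ps2 h r c"
  shows "\<exists>M. \<forall>x y s. norm x \<le> s \<longrightarrow> norm y \<le> s \<longrightarrow> s \<le> r \<longrightarrow> norm (h (x, y) - polyfun c N (x, y)) \<le> M * (s / r) ^ Suc N"
proof -
  define A where "A = {..N} \<times> {..N}"
  define M where "M = infsum (\<lambda>(i, j). norm (c i j) * r ^ (i + j)) (UNIV - A)"
  have r: "0 < r" using h by (simp add: ps2_def)
  have Msum: "((\<lambda>(i, j). norm (c i j) * r ^ (i + j)) has_sum M) (UNIV - A)"
    unfolding M_def using h by (intro has_sum_infsum) (auto simp: ps2_def intro: summable_on_subset_banach)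
  have "norm (h (x, y) - polyfun c N (x, y)) \<le> M * (s / r) ^ Suc N"
    if xy: "norm x \<le> s" "norm y \<le> s" and s: "s \<le> r" for x y s
  proof -
    have s0: "0 \<le> s" using xy(1) norm_ge_zero order_trans by blast
    have xyr: "norm x \<le> r" "norm y \<le> r" using xy s by auto
    let ?t = "\<lambda>(i, j). c i j * x ^ i * y ^ j"
    have "(?t has_sum polyfun c N (x, y)) A"
      unfolding A_def polyfun_def fst_conv snd_conv sum.cartesian_product by (rule has_sum_finite) simp
    moreover have "(?t has_sum h (x, y)) UNIV" using h xyr by (auto simp: ps2_def)
    ultimately have hs: "(?t has_sum (h (x, y) - polyfun c N (x, y))) (UNIV - A)"
      by (intro has_sum_Diff) auto
    have n: "((\<lambda>p. norm (?t p)) has_sum infsum (\<lambda>p. norm (?t p)) (UNIV - A)) (UNIV - A)"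
      by (intro has_sum_infsum iffD1[OF summable_on_iff_abs_summable_on_complex has_sum_imp_summable[OF hs]])
    have m: "((\<lambda>p. (s / r) ^ Suc N * (case p of (i, j) \<Rightarrow> norm (c i j) * r ^ (i + j))) has_sum (s / r) ^ Suc N * M) (UNIV - A)"
      using Msum by (rule has_sum_cmult_right)
    have "norm (h (x, y) - polyfun c N (x, y)) \<le> infsum (\<lambda>p. norm (?t p)) (UNIV - A)"
      by (rule norm_has_sum_bound[OF n hs])
    also have "\<dots> \<le> (s / r) ^ Suc N * M"
    proof (rule has_sum_mono[OF n m])
      fix p assume p: "p \<in> UNIV - A"
      obtain i j where ij: "p = (i, j)" by (cases p)
      have "Suc N \<le> i + j" using p ij by (auto simp: A_def)
      then have "(s / r) ^ (i + j) \<le> (s / r) ^ Suc N" using s0 s r by (intro power_decreasing) auto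
      have "norm (?t p) \<le> norm (c i j) * (s ^ i * s ^ j)"
        using xy s0 by (auto simp: ij norm_mult norm_power mult.assoc intro!: mult_left_mono mult_mono power_mono)
      also have "\<dots> = norm (c i j) * r ^ (i + j) * (s / r) ^ (i + j)" using r by (simp add: power_divide power_add)
      also have "\<dots> \<le> norm (c i j) * r ^ (i + j) * (s / r) ^ Suc N"
        using \<open>(s / r) ^ (i + j) \<le> (s / r) ^ Suc N\<close> r by (intro mult_left_mono) auto
      finally show "norm (?t p) \<le> (s / r) ^ Suc N * (case p of (i, j) \<Rightarrow> norm (c i j) * r ^ (i + j))"
        by (simp add: ij mult_ac)
    qed
    finally show ?thesis by (simp add: mult.commute)
  qed
  then show ?thesis by blast
qed

lemma polyfun_expansion:
  assumes "f has_fps_expansion F" "g has_fps_expansion G"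
  shows "(\<lambda>t. polyfun c N (f t, g t)) has_fps_expansion pev c N F G"
  unfolding polyfun_def pev_def fst_conv snd_conv
  using assms by (intro has_fps_expansion_sum has_fps_expansion_mult has_fps_expansion_power has_fps_expansion_const)

text \<open>Bridge from germs to formal series: \<open>f\<close> and \<open>g\<close> are bounded by
  multiples of \<open>norm t\<close>, so the remainder of \<open>h\<close> is bounded by a multiple
  of its power \<open>Suc N\<close>, and \<open>fps_order_bound\<close> turns this into a
  congruence.\<close>

lemma comp_expansion:
  assumes h: "ps2 h r c" and F: "f has_fps_expansion F" "F $ 0 = 0" and G: "g has_fps_expansion G" "G $ 0 = 0"
  obtains H where "(\<lambda>t. h (f t, g t)) has_fps_expansion H" "\<And>N. fps_X ^ Suc N dvd H - pev c N F G"
proof -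
  have r: "0 < r" using h by (simp add: ps2_def)
  have an: "f analytic_on {0}" "g analytic_on {0}"
    using F G by (auto intro: has_fps_expansion_imp_analytic_0)
  obtain S1 where S1: "open S1" "0 \<in> S1" "f holomorphic_on S1" using an(1) by (auto simp: analytic_at)
  obtain S2 where S2: "open S2" "0 \<in> S2" "g holomorphic_on S2" using an(2) by (auto simp: analytic_at)
  obtain A where A: "0 < A" "\<forall>\<^sub>F t in nhds 0. norm (f t) \<le> A * norm t" using fps_linear_bound[OF F] .
  obtain B where B: "0 < B" "\<forall>\<^sub>F t in nhds 0. norm (g t) \<le> B * norm t" using fps_linear_bound[OF G] .
  define C where "C = max A B"
  have C0: "0 < C" using A by (simp add: C_def)
  have Cb: "\<forall>\<^sub>F t in nhds 0. norm (f t) \<le> C * norm t \<and> norm (g t) \<le> C * norm t"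
    using A(2) B(2)
  proof eventually_elim
    case (elim t)
    have "A * norm t \<le> C * norm t" "B * norm t \<le> C * norm t" by (auto simp: C_def intro!: mult_right_mono)
    with elim show ?case by linarith
  qed
  have "\<forall>\<^sub>F t in nhds (0::complex). norm t < r / C"
    using C0 r by (intro eventually_nhds_metric[THEN iffD2] exI[of _ "r / C"]) auto
  with Cb have small: "\<forall>\<^sub>F t in nhds 0. norm (f t) \<le> C * norm t \<and> norm (g t) \<le> C * norm t \<and> C * norm t \<le> r"
    by eventually_elim (use C0 in \<open>auto simp: field_simps\<close>)
  then obtain S3 where S3: "open S3" "0 \<in> S3"
    "\<And>t. t \<in> S3 \<Longrightarrow> norm (f t) \<le> C * norm t \<and> norm (g t) \<le> C * norm t \<and> C * norm t \<le> r"
    unfolding eventually_nhds by blast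
  define S where "S = S1 \<inter> S2 \<inter> S3"
  have S: "open S" "0 \<in> S" using S1 S2 S3 by (auto simp: S_def)
  have "(\<lambda>t. h (f t, g t)) holomorphic_on S"
  proof (rule ps2_holomorphic_comp[OF h S(1)])
    show "f holomorphic_on S" "g holomorphic_on S"
      using S1(3) S2(3) by (auto simp: S_def intro: holomorphic_on_subset)
  qed (use S3(3) in \<open>force simp: S_def\<close>)
  then have "(\<lambda>t. h (f t, g t)) analytic_on {0}" using S by (auto simp: analytic_at)
  then have H: "(\<lambda>t. h (f t, g t)) has_fps_expansion fps_expansion (\<lambda>t. h (f t, g t)) 0"
    by (rule analytic_at_imp_has_fps_expansion_0)
  show ?thesis
  proof (rule that[OF H])
    fix N
    obtain M where M: "\<And>x y s. norm x \<le> s \<Longrightarrow> norm y \<le> s \<Longrightarrow> s \<le> r \<Longrightarrow>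
        norm (h (x, y) - polyfun c N (x, y)) \<le> M * (s / r) ^ Suc N"
      using ps2_remainder[OF h, of N] by blast
    show "fps_X ^ Suc N dvd fps_expansion (\<lambda>t. h (f t, g t)) 0 - pev c N F G"
    proof (rule fps_order_bound)
      show "(\<lambda>t. h (f t, g t) - polyfun c N (f t, g t)) has_fps_expansion
          fps_expansion (\<lambda>t. h (f t, g t)) 0 - pev c N F G"
        by (intro has_fps_expansion_diff H polyfun_expansion F G)
      show "\<forall>\<^sub>F t in nhds 0. norm (h (f t, g t) - polyfun c N (f t, g t)) \<le> M * (C / r) ^ Suc N * norm t ^ Suc N"
        using small
      proof eventually_elim
        case (elim t)
        then have "norm (h (f t, g t) - polyfun c N (f t, g t)) \<le> M * (C * norm t / r) ^ Suc N"
          by (intro M) auto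
        then show ?case by (simp add: power_mult_distrib power_divide mult_ac)
      qed
    qed
  qed
qed

section \<open>Values along a curve\<close>

definition par :: "nat \<Rightarrow> (complex \<Rightarrow> complex) \<Rightarrow> complex \<Rightarrow> complex \<times> complex" where
  "par n y t = (t ^ n, y t)"

lemma analytic1_iff: "analytic1 f \<longleftrightarrow> (\<exists>F. f has_fps_expansion F)"
  unfolding analytic1_def
  using analytic_at_imp_has_fps_expansion_0 has_fps_expansion_imp_analytic_0 by blast

lemma zero_germ_iff: "f has_fps_expansion F \<Longrightarrow> zero_germ f \<longleftrightarrow> F = 0"
  unfolding zero_germ_def has_fps_expansion_0_iff[symmetric] using fps_expansion_unique_complex by blast

lemma expansion_eventually_eq:
  assumes "f has_fps_expansion F" "g has_fps_expansion F"
  shows "\<forall>\<^sub>F t in nhds 0. f t = g t"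
proof -
  have "(\<lambda>t. f t - g t) has_fps_expansion F - F" using assms by (rule has_fps_expansion_diff)
  then show ?thesis by (simp add: has_fps_expansion_0_iff)
qed

lemma ordt_eq:
  assumes f: "f has_fps_expansion F" and F: "F \<noteq> 0"
  shows "ordt f = subdegree F"
proof -
  have e: "(deriv ^^ k) f 0 \<noteq> 0 \<longleftrightarrow> F $ k \<noteq> 0" for k
    using fps_nth_fps_expansion[OF f, of k] by simp
  show ?thesis unfolding ordt_def e
    by (rule Least_equality) (use F in \<open>auto intro: subdegree_leI\<close>)
qed

text \<open>Values computed with polynomials alone. Truncating a germ at a sufficiently high degree
  does not change its order along the curve, so this set and \<open>dvalF\<close> agree with
  \<open>vals\<close> and \<open>dvals\<close>.\<close>

definition valF :: "nat \<Rightarrow> complex fps \<Rightarrow> nat set" where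
  "valF n Y = {subdegree (pev c N (fps_X ^ n) Y) | c N. pev c N (fps_X ^ n) Y \<noteq> 0}"

definition dvalF :: "nat \<Rightarrow> complex fps \<Rightarrow> nat set" where
  "dvalF n Y = {Suc (subdegree (Wser n Y a b N)) | a b N. Wser n Y a b N \<noteq> 0}"

lemma subdegree_cong_trunc:
  fixes f g :: "'a::comm_ring_1 fps"
  assumes f: "f \<noteq> 0" and d: "fps_X ^ Suc (subdegree f) dvd f - g"
  shows "g \<noteq> 0" "subdegree g = subdegree f"
proof -
  have e: "g $ i = f $ i" if "i \<le> subdegree f" for i using d that by (simp add: X_pow_dvd_iff del: power_Suc)
  have "g $ subdegree f \<noteq> 0" using e[of "subdegree f"] f by simp
  then show "g \<noteq> 0" by auto
  show "subdegree g = subdegree f"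
    using \<open>g $ subdegree f \<noteq> 0\<close> by (intro subdegreeI) (auto simp: e)
qed

lemma X_pow_expansion: "(\<lambda>t. t ^ n) has_fps_expansion (fps_X ^ n :: complex fps)"
  by (rule has_fps_expansion_fps_X_power)

lemma comp_expansion_par:
  assumes "ps2 h r c" "0 < n" "y has_fps_expansion Y" "Y $ 0 = 0"
  obtains H where "(\<lambda>t. h (t ^ n, y t)) has_fps_expansion H" "\<And>N. fps_X ^ Suc N dvd H - pev c N (fps_X ^ n) Y"
proof -
  have "(fps_X ^ n :: complex fps) $ 0 = 0" using assms(2) by simp
  from comp_expansion[OF assms(1) X_pow_expansion this assms(3,4)] that show ?thesis by blast
qed

lemma vals_par:
  assumes n: "0 < n" and y: "y has_fps_expansion Y" "Y $ 0 = 0"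
  shows "vals (par n y) = valF n Y"
proof (intro set_eqI iffI)
  fix l assume "l \<in> vals (par n y)"
  then obtain h where h: "analytic2 h" "\<not> zero_germ (\<lambda>t. h (par n y t))" "l = ordt (\<lambda>t. h (par n y t))"
    by (auto simp: vals_def)
  obtain r c where hc: "ps2 h r c" using analytic2_imp_ps2[OF h(1)] .
  obtain H where H: "(\<lambda>t. h (t ^ n, y t)) has_fps_expansion H" "\<And>N. fps_X ^ Suc N dvd H - pev c N (fps_X ^ n) Y"
    using comp_expansion_par[OF hc n y] by blast
  have H0: "H \<noteq> 0" using h(2) zero_germ_iff[OF H(1)] by (simp add: par_def)
  have l: "l = subdegree H" using h(3) ordt_eq[OF H(1) H0] by (simp add: par_def)
  show "l \<in> valF n Y" unfolding valF_def using subdegree_cong_trunc[OF H0 H(2)] l by force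
next
  fix l assume "l \<in> valF n Y"
  then obtain c N where *: "pev c N (fps_X ^ n) Y \<noteq> 0" "l = subdegree (pev c N (fps_X ^ n) Y)"
    by (auto simp: valF_def)
  have e: "(\<lambda>t. polyfun c N (par n y t)) has_fps_expansion pev c N (fps_X ^ n) Y"
    unfolding par_def by (rule polyfun_expansion[OF X_pow_expansion y(1)])
  show "l \<in> vals (par n y)" unfolding vals_def
    using analytic2_polyfun[of c N] zero_germ_iff[OF e] ordt_eq[OF e] *
    by (intro CollectI exI[of _ "polyfun c N"]) auto
qed

lemma pull_diff_expansion:
  assumes h: "(\<lambda>t. h (par n y t)) has_fps_expansion H" and g: "(\<lambda>t. g (par n y t)) has_fps_expansion G"
    and y: "y has_fps_expansion Y"
  shows "pull_diff h g (par n y) has_fps_expansion H * fps_deriv (fps_X ^ n) + G * fps_deriv Y"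
proof -
  have c: "fst \<circ> par n y = (\<lambda>t. t ^ n)" "snd \<circ> par n y = y" by (auto simp: par_def)
  show ?thesis unfolding pull_diff_def c
    by (intro has_fps_expansion_add has_fps_expansion_mult h g has_fps_expansion_deriv y X_pow_expansion)
qed

lemma Wser_alt:
  "Wser n Y (\<lambda>i j. - g i j) h N = pev h N (fps_X ^ n) Y * fps_deriv (fps_X ^ n) + pev g N (fps_X ^ n) Y * fps_deriv Y"
  using pev_cmult[of "-1" g N "fps_X ^ n" Y]
  by (simp add: Wser_def fps_deriv_power algebra_simps flip: fps_of_nat fps_const_neg)

lemma dvals_par:
  assumes n: "0 < n" and y: "y has_fps_expansion Y" "Y $ 0 = 0"
  shows "dvals (par n y) = dvalF n Y"
proof (intro set_eqI iffI)
  fix l assume "l \<in> dvals (par n y)"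
  then obtain h g where h: "analytic2 h" "analytic2 g" "\<not> zero_germ (pull_diff h g (par n y))"
    "l = ordt (pull_diff h g (par n y)) + 1"
    by (auto simp: dvals_def)
  obtain r c where hc: "ps2 h r c" using analytic2_imp_ps2[OF h(1)] .
  obtain r' d where gd: "ps2 g r' d" using analytic2_imp_ps2[OF h(2)] .
  obtain H where H: "(\<lambda>t. h (t ^ n, y t)) has_fps_expansion H" "\<And>N. fps_X ^ Suc N dvd H - pev c N (fps_X ^ n) Y"
    using comp_expansion_par[OF hc n y] by blast
  obtain G where G: "(\<lambda>t. g (t ^ n, y t)) has_fps_expansion G" "\<And>N. fps_X ^ Suc N dvd G - pev d N (fps_X ^ n) Y"
    using comp_expansion_par[OF gd n y] by blast
  define W where "W = H * fps_deriv (fps_X ^ n) + G * fps_deriv Y"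
  have W: "pull_diff h g (par n y) has_fps_expansion W"
    unfolding W_def by (rule pull_diff_expansion) (use H(1) G(1) y(1) in \<open>simp_all add: par_def\<close>)
  have W0: "W \<noteq> 0" using h(3) zero_germ_iff[OF W] by simp
  have l: "l = Suc (subdegree W)" using h(4) ordt_eq[OF W W0] by simp
  have "W - Wser n Y (\<lambda>i j. - d i j) c N = (H - pev c N (fps_X ^ n) Y) * fps_deriv (fps_X ^ n)
      + (G - pev d N (fps_X ^ n) Y) * fps_deriv Y" for N
    unfolding Wser_alt W_def by (simp add: algebra_simps)
  then have "fps_X ^ Suc N dvd W - Wser n Y (\<lambda>i j. - d i j) c N" for N
    using H(2)[of N] G(2)[of N] by (simp del: power_Suc)
  from subdegree_cong_trunc[OF W0 this] show "l \<in> dvalF n Y" unfolding dvalF_def l by force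
next
  fix l assume "l \<in> dvalF n Y"
  then obtain a b N where *: "Wser n Y a b N \<noteq> 0" "l = Suc (subdegree (Wser n Y a b N))"
    by (auto simp: dvalF_def)
  have e: "(\<lambda>t. polyfun c N (par n y t)) has_fps_expansion pev c N (fps_X ^ n) Y" for c
    unfolding par_def by (rule polyfun_expansion[OF X_pow_expansion y(1)])
  have "pull_diff (polyfun b N) (polyfun (\<lambda>i j. - a i j) N) (par n y) has_fps_expansion Wser n Y a b N"
    using pull_diff_expansion[OF e e y(1), of b "\<lambda>i j. - a i j"] Wser_alt[of n Y "\<lambda>i j. - a i j" b N] by simp
  note w = this
  show "l \<in> dvals (par n y)" unfolding dvals_def
    using analytic2_polyfun[of b N] analytic2_polyfun[of "\<lambda>i j. - a i j" N] zero_germ_iff[OF w] ordt_eq[OF w] * 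
    by (intro CollectI exI[of _ "polyfun b N"] exI[of _ "polyfun (\<lambda>i j. - a i j) N"]) auto
qed

text \<open>With all weights 0 the weight condition is void, so this is the algebra of polynomials
  in \<open>F\<close> and \<open>G\<close>.\<close>

definition palg :: "complex fps \<Rightarrow> complex fps \<Rightarrow> complex fps set" where
  "palg F G = wspan 0 0 F G 0"

lemma palg_iff: "f \<in> palg F G \<longleftrightarrow> (\<exists>c N. f = pev c N F G)"
proof
  assume "f \<in> palg F G" then show "\<exists>c N. f = pev c N F G" unfolding palg_def by (blast dest: wspan_imp_pev)
next
  assume "\<exists>c N. f = pev c N F G"
  then show "f \<in> palg F G" unfolding palg_def pev_def by (auto intro!: wspan.Fil_sum wspan_monom)
qed

lemma palg_closed:
  "f \<in> palg F G \<Longrightarrow> g \<in> palg F G \<Longrightarrow> f + g \<in> palg F G"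
  "f \<in> palg F G \<Longrightarrow> g \<in> palg F G \<Longrightarrow> f * g \<in> palg F G"
  "P \<in> palg F G \<Longrightarrow> Q \<in> palg F G \<Longrightarrow> pev c N P Q \<in> palg F G"
proof -
  show "f \<in> palg F G \<Longrightarrow> g \<in> palg F G \<Longrightarrow> f + g \<in> palg F G"
    unfolding palg_def by (rule wspan.Fil_add)
  show "f \<in> palg F G \<Longrightarrow> g \<in> palg F G \<Longrightarrow> f * g \<in> palg F G"
    unfolding palg_def using wspan.Fil_mult[where w = 0 and w' = 0 and n = 0 and m = 0] by simp
  show "P \<in> palg F G \<Longrightarrow> Q \<in> palg F G \<Longrightarrow> pev c N P Q \<in> palg F G"
    unfolding palg_def by (rule wspan.Fil_pev[OF wts_0])
qed

lemma palg_deriv: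
  assumes "f \<in> palg F G"
  shows "\<exists>p\<in>palg F G. \<exists>q\<in>palg F G. fps_deriv f = p * fps_deriv F + q * fps_deriv G"
proof -
  obtain N c where c: "supp_le N c" "f = pev c N F G" using wspan_imp_pev assms unfolding palg_def by blast
  have "pev (dX c) N F G \<in> palg F G" "pev (dY c) N F G \<in> palg F G" using palg_iff by blast+
  then show ?thesis unfolding c(2) using pev_deriv[OF c(1)] by blast
qed

lemma Wser_palg:
  assumes "p \<in> palg (fps_X ^ n) Y" "q \<in> palg (fps_X ^ n) Y"
  shows "\<exists>a b N. Wser n Y a b N = p * fps_deriv (fps_X ^ n) + q * fps_deriv Y"
proof -
  obtain N1 c where c: "supp_le N1 c" "p = pev c N1 (fps_X ^ n) Y" using wspan_imp_pev assms(1) unfolding palg_def by blast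
  obtain N2 d where d: "supp_le N2 d" "q = pev d N2 (fps_X ^ n) Y" using wspan_imp_pev assms(2) unfolding palg_def by blast
  define N where "N = max N1 N2"
  have "Wser n Y (\<lambda>i j. - d i j) c N = p * fps_deriv (fps_X ^ n) + q * fps_deriv Y"
    unfolding Wser_alt using pev_extend'[OF c(1), of N] pev_extend'[OF d(1), of N] c(2) d(2) by (simp add: N_def)
  then show ?thesis by blast
qed

lemma cong_pev:
  assumes "fps_X ^ k dvd P - P'" "fps_X ^ k dvd Q - Q'"
  shows "fps_X ^ k dvd pev c N P Q - pev c N P' Q'"
  unfolding pev_def sum_subtractf[symmetric]
proof (intro dvd_sum)
  fix i j
  have 1: "fps_X ^ k dvd P ^ i - P' ^ i" using assms(1) by (rule dvd_trans) (simp add: power_diff_sumr2)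
  have 2: "fps_X ^ k dvd Q ^ j - Q' ^ j" using assms(2) by (rule dvd_trans) (simp add: power_diff_sumr2)
  have "fps_const (c i j) * P ^ i * Q ^ j - fps_const (c i j) * P' ^ i * Q' ^ j
      = fps_const (c i j) * (P ^ i * (Q ^ j - Q' ^ j) + (P ^ i - P' ^ i) * Q' ^ j)" by (simp add: algebra_simps)
  then show "fps_X ^ k dvd fps_const (c i j) * P ^ i * Q ^ j - fps_const (c i j) * P' ^ i * Q' ^ j"
    using 1 2 by (simp add: dvd_mult dvd_mult2)
qed

lemma subdegree_compose_unit:
  fixes f r :: "complex fps"
  assumes "f \<noteq> 0" "r $ 0 = 0" "r $ 1 \<noteq> 0"
  shows "f oo r \<noteq> 0" "subdegree (f oo r) = subdegree f"
proof -
  have r: "fps_X dvd r" using assms(2) by (simp add: X_dvd_iff)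
  have d: "fps_X ^ subdegree f dvd f" unfolding X_pow_dvd_iff by (blast intro: nth_less_subdegree_zero)
  have c: "(f oo r) $ subdegree f \<noteq> 0" using compose_nth_lead[OF d r] assms by simp
  then show "f oo r \<noteq> 0" by auto
  show "subdegree (f oo r) = subdegree f"
    using c compose_dvd[OF d r] by (intro subdegreeI) (auto simp: X_pow_dvd_iff)
qed

lemma subdegree_mult_unit:
  fixes f g :: "complex fps"
  assumes "f \<noteq> 0" "g $ 0 \<noteq> 0"
  shows "f * g \<noteq> 0" "subdegree (f * g) = subdegree f"
proof -
  have "g \<noteq> 0" using assms by auto
  then show "f * g \<noteq> 0" using assms by simp
  show "subdegree (f * g) = subdegree f" using assms \<open>g \<noteq> 0\<close> by (simp add: subdegree_eq_0)
qed

text \<open>Here P and Q stand for the components of the transformed curve, which agree to any order with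
  polynomials in the components of the original one.\<close>

lemma dvalF_subset:
  assumes r: "r $ 0 = 0" "r $ 1 \<noteq> 0" and Y2: "Y2 $ 0 = 0" and n: "0 < n2"
    and PQ: "fps_X ^ n2 oo r = P" "Y2 oo r = Q"
    and tr: "\<And>N. \<exists>P'\<in>palg (fps_X ^ n1) Y1. fps_X ^ N dvd P - P'" "\<And>N. \<exists>Q'\<in>palg (fps_X ^ n1) Y1. fps_X ^ N dvd Q - Q'"
  shows "valF n2 Y2 \<subseteq> valF n1 Y1" "dvalF n2 Y2 \<subseteq> dvalF n1 Y1"
proof -
  have rX: "fps_X dvd r" using r by (simp add: X_dvd_iff)
  show "valF n2 Y2 \<subseteq> valF n1 Y1"
  proof
    fix l assume "l \<in> valF n2 Y2"
    then obtain c N where *: "pev c N (fps_X ^ n2) Y2 \<noteq> 0" "l = subdegree (pev c N (fps_X ^ n2) Y2)"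
      by (auto simp: valF_def)
    have e: "pev c N (fps_X ^ n2) Y2 oo r = pev c N P Q" using pev_compose[OF rX] PQ by simp
    note s = subdegree_compose_unit[OF *(1) r, unfolded e]
    obtain P' where P': "P' \<in> palg (fps_X ^ n1) Y1" "fps_X ^ Suc l dvd P - P'" using tr(1) by blast
    obtain Q' where Q': "Q' \<in> palg (fps_X ^ n1) Y1" "fps_X ^ Suc l dvd Q - Q'" using tr(2) by blast
    have "fps_X ^ Suc (subdegree (pev c N P Q)) dvd pev c N P Q - pev c N P' Q'"
      using cong_pev[OF P'(2) Q'(2)] s(2) *(2) by simp
    from subdegree_cong_trunc[OF s(1) this] have "pev c N P' Q' \<noteq> 0" "l = subdegree (pev c N P' Q')"
      using s(2) *(2) by auto
    moreover have "pev c N P' Q' \<in> palg (fps_X ^ n1) Y1" using palg_closed(3) P'(1) Q'(1) by blast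
    ultimately show "l \<in> valF n1 Y1" unfolding palg_iff valF_def by force
  qed
  show "dvalF n2 Y2 \<subseteq> dvalF n1 Y1"
  proof
    fix l assume "l \<in> dvalF n2 Y2"
    then obtain a b N where *: "Wser n2 Y2 a b N \<noteq> 0" "l = Suc (subdegree (Wser n2 Y2 a b N))"
      by (auto simp: dvalF_def)
    define g where "g = (\<lambda>i j. - a i j)"
    have W: "Wser n2 Y2 a b N = pev b N (fps_X ^ n2) Y2 * fps_deriv (fps_X ^ n2) + pev g N (fps_X ^ n2) Y2 * fps_deriv Y2"
      using Wser_alt[of n2 Y2 g b N] by (simp add: g_def)
    \<comment> \<open>Pulled back along \<open>r\<close>, the form of the second curve becomes a
      form in \<open>P\<close> and \<open>Q\<close>; the extra factor \<open>fps_deriv r\<close> is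
      a unit, so the order is unchanged.\<close>
    define E where "E = pev b N P Q * fps_deriv P + pev g N P Q * fps_deriv Q"
    have E: "(Wser n2 Y2 a b N oo r) * fps_deriv r = E"
      unfolding W E_def fps_compose_add_distrib fps_compose_mult_distrib[OF r(1)] pev_compose[OF rX] PQ
        fps_compose_deriv[OF r(1), of "fps_X ^ n2", unfolded PQ]
        fps_compose_deriv[OF r(1), of Y2, unfolded PQ] by (simp add: algebra_simps)
    have "fps_deriv r $ 0 \<noteq> 0" using r(2) by simp
    note s = subdegree_mult_unit[OF subdegree_compose_unit(1)[OF *(1) r] this, unfolded E subdegree_compose_unit(2)[OF *(1) r]]
    \<comment> \<open>Differentiation costs one order of precision. What remains is agreement modulo
      \<open>t ^ l\<close>, and \<open>E\<close> has order \<open>l - 1\<close>.\<close>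
    obtain P' where P': "P' \<in> palg (fps_X ^ n1) Y1" "fps_X ^ Suc l dvd P - P'" using tr(1) by blast
    obtain Q' where Q': "Q' \<in> palg (fps_X ^ n1) Y1" "fps_X ^ Suc l dvd Q - Q'" using tr(2) by blast
    define E' where "E' = pev b N P' Q' * fps_deriv P' + pev g N P' Q' * fps_deriv Q'"
    have PQ': "fps_X ^ l dvd P - P'" "fps_X ^ l dvd Q - Q'" using P'(2) Q'(2) by (auto elim: X_pow_dvd_mono)
    have dd: "fps_X ^ l dvd fps_deriv (P - P')" "fps_X ^ l dvd fps_deriv (Q - Q')"
      using dvd_deriv[OF P'(2)] dvd_deriv[OF Q'(2)] by simp_all
    have "E - E' = (pev b N P Q - pev b N P' Q') * fps_deriv P + pev b N P' Q' * fps_deriv (P - P')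
       + ((pev g N P Q - pev g N P' Q') * fps_deriv Q + pev g N P' Q' * fps_deriv (Q - Q'))"
      by (simp add: E_def E'_def algebra_simps)
    also have "fps_X ^ l dvd \<dots>"
      by (intro dvd_add dvd_mult2[OF cong_pev[OF PQ']] dvd_mult[OF dd(1)] dvd_mult[OF dd(2)])
    finally have "fps_X ^ Suc (subdegree E) dvd E - E'" using s(2) *(2) by simp
    note E' = subdegree_cong_trunc[OF s(1) this]
    obtain p1 q1 where p1: "p1 \<in> palg (fps_X ^ n1) Y1" "q1 \<in> palg (fps_X ^ n1) Y1"
      "fps_deriv P' = p1 * fps_deriv (fps_X ^ n1) + q1 * fps_deriv Y1" using palg_deriv[OF P'(1)] by blast
    obtain p2 q2 where p2: "p2 \<in> palg (fps_X ^ n1) Y1" "q2 \<in> palg (fps_X ^ n1) Y1"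
      "fps_deriv Q' = p2 * fps_deriv (fps_X ^ n1) + q2 * fps_deriv Y1" using palg_deriv[OF Q'(1)] by blast
    have "E' = (pev b N P' Q' * p1 + pev g N P' Q' * p2) * fps_deriv (fps_X ^ n1)
        + (pev b N P' Q' * q1 + pev g N P' Q' * q2) * fps_deriv Y1"
      unfolding E'_def p1(3) p2(3) by (simp add: algebra_simps)
    moreover have "pev b N P' Q' \<in> palg (fps_X ^ n1) Y1" "pev g N P' Q' \<in> palg (fps_X ^ n1) Y1"
      using palg_closed(3) P'(1) Q'(1) by blast+
    then have "pev b N P' Q' * p1 + pev g N P' Q' * p2 \<in> palg (fps_X ^ n1) Y1"
      "pev b N P' Q' * q1 + pev g N P' Q' * q2 \<in> palg (fps_X ^ n1) Y1"
      using p1 p2 palg_closed(1,2) by blast+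
    ultimately obtain a' b' M where "Wser n1 Y1 a' b' M = E'" using Wser_palg by metis
    then show "l \<in> dvalF n1 Y1" unfolding dvalF_def using E' s(2) *(2) by force
  qed
qed

lemma aut1_expansion:
  assumes "aut1 \<rho>"
  obtains r where "\<rho> has_fps_expansion r" "r $ 0 = 0" "r $ 1 \<noteq> 0"
proof -
  obtain q where \<rho>: "analytic1 \<rho>" "\<rho> 0 = 0" "analytic1 q" "q 0 = 0" "\<forall>\<^sub>F t in nhds 0. q (\<rho> t) = t"
    using assms unfolding aut1_def by blast
  obtain r where r: "\<rho> has_fps_expansion r" using \<rho>(1) by (auto simp: analytic1_iff)
  obtain s where s: "q has_fps_expansion s" using \<rho>(3) by (auto simp: analytic1_iff)
  have r0: "r $ 0 = 0" using has_fps_expansion_imp_0_eq_fps_nth_0[OF r] \<rho>(2) by simp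
  have s0: "s $ 0 = 0" using has_fps_expansion_imp_0_eq_fps_nth_0[OF s] \<rho>(4) by simp
  have 1: "(q \<circ> \<rho>) has_fps_expansion (s oo r)" by (rule has_fps_expansion_compose[OF s r r0])
  have "(\<lambda>t. t) has_fps_expansion (s oo r)"
    by (rule has_fps_expansion_cong[THEN iffD1, OF _ refl 1]) (use \<rho>(5) in simp)
  then have "s oo r = fps_X" using fps_expansion_unique_complex has_fps_expansion_fps_X by blast
  moreover have "(s oo r) $ 1 = s $ 1 * (r $ 1) ^ 1"
    using r0 s0 by (intro compose_nth_lead) (auto simp: X_dvd_iff)
  ultimately have "r $ 1 \<noteq> 0" by auto
  then show ?thesis using that r r0 by blast
qed

lemma A_equiv_expansions:
  assumes eq: "A_equiv (par n1 y1) (par n2 y2)" and n: "0 < n1" "0 < n2"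
    and y1: "y1 has_fps_expansion Y1" "Y1 $ 0 = 0" and y2: "y2 has_fps_expansion Y2" "Y2 $ 0 = 0"
  obtains r P Q c d where "r $ 0 = 0" "r $ 1 \<noteq> 0" "fps_X ^ n2 oo r = P" "Y2 oo r = Q"
    "\<And>N. fps_X ^ Suc N dvd P - pev c N (fps_X ^ n1) Y1" "\<And>N. fps_X ^ Suc N dvd Q - pev d N (fps_X ^ n1) Y1"
proof -
  obtain \<sigma> \<rho> where s: "aut2 \<sigma>" and r: "aut1 \<rho>" and e: "\<forall>\<^sub>F t in nhds 0. par n2 y2 (\<rho> t) = \<sigma> (par n1 y1 t)"
    using eq unfolding A_equiv_def by blast
  obtain R where R: "\<rho> has_fps_expansion R" "R $ 0 = 0" "R $ 1 \<noteq> 0" using aut1_expansion[OF r] .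
  have an: "analytic2 (fst \<circ> \<sigma>)" "analytic2 (snd \<circ> \<sigma>)" using s unfolding aut2_def by auto
  obtain r1 c where c: "ps2 (fst \<circ> \<sigma>) r1 c" using analytic2_imp_ps2[OF an(1)] .
  obtain r2 d where d: "ps2 (snd \<circ> \<sigma>) r2 d" using analytic2_imp_ps2[OF an(2)] .
  obtain P where P: "(\<lambda>t. (fst \<circ> \<sigma>) (t ^ n1, y1 t)) has_fps_expansion P" "\<And>N. fps_X ^ Suc N dvd P - pev c N (fps_X ^ n1) Y1"
    using comp_expansion_par[OF c n(1) y1] by blast
  obtain Q where Q: "(\<lambda>t. (snd \<circ> \<sigma>) (t ^ n1, y1 t)) has_fps_expansion Q" "\<And>N. fps_X ^ Suc N dvd Q - pev d N (fps_X ^ n1) Y1"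
    using comp_expansion_par[OF d n(1) y1] by blast
  have "((\<lambda>t. t ^ n2) \<circ> \<rho>) has_fps_expansion (fps_X ^ n2 oo R)"
    by (rule has_fps_expansion_compose[OF X_pow_expansion R(1,2)])
  moreover have "((\<lambda>t. t ^ n2) \<circ> \<rho>) has_fps_expansion P"
    by (rule has_fps_expansion_cong[THEN iffD1, OF _ refl P(1)])
       (use e in \<open>eventually_elim, auto simp: par_def prod_eq_iff\<close>)
  ultimately have 1: "fps_X ^ n2 oo R = P" by (rule fps_expansion_unique_complex)
  have "(y2 \<circ> \<rho>) has_fps_expansion (Y2 oo R)" by (rule has_fps_expansion_compose[OF y2(1) R(1,2)])
  moreover have "(y2 \<circ> \<rho>) has_fps_expansion Q"
    by (rule has_fps_expansion_cong[THEN iffD1, OF _ refl Q(1)])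
       (use e in \<open>eventually_elim, auto simp: par_def prod_eq_iff\<close>)
  ultimately have 2: "Y2 oo R = Q" by (rule fps_expansion_unique_complex)
  show ?thesis using that[OF R(2,3) 1 2 P(2) Q(2)] .
qed

lemma values_subset:
  assumes eq: "A_equiv (par n1 y1) (par n2 y2)" and n: "0 < n1" "0 < n2"
    and y1: "y1 has_fps_expansion Y1" "Y1 $ 0 = 0" and y2: "y2 has_fps_expansion Y2" "Y2 $ 0 = 0"
  shows "valF n2 Y2 \<subseteq> valF n1 Y1" "dvalF n2 Y2 \<subseteq> dvalF n1 Y1"
proof -
  obtain r P Q c d where *: "r $ 0 = 0" "r $ 1 \<noteq> 0" "fps_X ^ n2 oo r = P" "Y2 oo r = Q"
    "\<And>N. fps_X ^ Suc N dvd P - pev c N (fps_X ^ n1) Y1" "\<And>N. fps_X ^ Suc N dvd Q - pev d N (fps_X ^ n1) Y1"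
    using A_equiv_expansions[OF assms] by metis
  have p: "pev c N (fps_X ^ n1) Y1 \<in> palg (fps_X ^ n1) Y1" for c N using palg_iff by blast
  have t: "\<exists>P'\<in>palg (fps_X ^ n1) Y1. fps_X ^ N dvd P - P'" "\<exists>Q'\<in>palg (fps_X ^ n1) Y1. fps_X ^ N dvd Q - Q'" for N
    using *(5)[of N] *(6)[of N] p by (blast intro: X_pow_dvd_mono[of "Suc N"] le_SucI order.refl)+
  show "valF n2 Y2 \<subseteq> valF n1 Y1" "dvalF n2 Y2 \<subseteq> dvalF n1 Y1"
    using dvalF_subset[OF *(1,2) y2(2) n(2) *(3,4) t] by auto
qed

lemma par_param:
  assumes n: "0 < n" and y: "y has_fps_expansion Y" "Y $ 0 = 0"
  shows "param (par n y)"
proof -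
  have c: "fst \<circ> par n y = (\<lambda>t. t ^ n)" "snd \<circ> par n y = y" by (auto simp: par_def)
  have "\<not> zero_germ (par n y)"
  proof
    assume "zero_germ (par n y)"
    then have "\<forall>\<^sub>F t in nhds 0. par n y t = 0" by (simp add: zero_germ_def)
    then have "\<forall>\<^sub>F t in nhds 0. t ^ n = (0 :: complex)" by eventually_elim (simp add: par_def zero_prod_def)
    then have "zero_germ (\<lambda>t. t ^ n)" by (simp add: zero_germ_def)
    then show False using zero_germ_iff[OF X_pow_expansion[of n]] by simp
  qed
  moreover have "analytic1 (\<lambda>t. t ^ n)" "analytic1 y" using X_pow_expansion y analytic1_iff by blast+
  moreover have "y 0 = 0" using has_fps_expansion_imp_0_eq_fps_nth_0[OF y(1)] y(2) by simp
  ultimately show ?thesis using n unfolding param_def c by (simp add: par_def power_0_left)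
qed

lemma values_equiv:
  assumes eq: "A_equiv (par n1 y1) (par n2 y2)" and n: "0 < n1" "0 < n2"
    and y1: "y1 has_fps_expansion Y1" "Y1 $ 0 = 0" and y2: "y2 has_fps_expansion Y2" "Y2 $ 0 = 0"
  shows "valF n2 Y2 = valF n1 Y1" "dvalF n2 Y2 = dvalF n1 Y1"
  using values_subset[OF assms] values_subset[OF A_equiv_sym[OF eq par_param[OF n(1) y1]] n(2,1) y2 y1] by auto

section \<open>Elimination of a coefficient\<close>

lemma aut1_intro:
  assumes r: "\<rho> has_fps_expansion R" "R $ 0 = 0" "R $ 1 \<noteq> 0"
  obtains \<rho>' where "analytic1 \<rho>'" "\<rho>' 0 = 0" "\<forall>\<^sub>F t in nhds 0. \<rho> (\<rho>' t) = t" "\<forall>\<^sub>F t in nhds 0. \<rho>' (\<rho> t) = t"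
    "aut1 \<rho>"
proof -
  have \<rho>0: "\<rho> 0 = 0" using has_fps_expansion_imp_0_eq_fps_nth_0[OF r(1)] r(2) by simp
  obtain S where S: "open S" "0 \<in> S" "\<rho> holomorphic_on S"
    using has_fps_expansion_imp_analytic_0[OF r(1)] by (auto simp: analytic_at)
  have "deriv \<rho> 0 \<noteq> 0" using fps_nth_fps_expansion[OF r(1), of 1] r(3) by simp
  then obtain e where e: "e > 0" "ball 0 e \<subseteq> S" "open (\<rho> ` ball 0 e)" "inj_on \<rho> (ball 0 e)"
    using has_complex_derivative_locally_invertible[OF S(3,2,1)] by blast
  have hb: "\<rho> holomorphic_on ball 0 e" using S(3) e(2) by (rule holomorphic_on_subset)
  obtain g where g: "g holomorphic_on (\<rho> ` ball 0 e)" "\<And>z. z \<in> ball 0 e \<Longrightarrow> g (\<rho> z) = z"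
    using holomorphic_has_inverse[OF hb open_ball e(4)] by metis
  have in0: "0 \<in> \<rho> ` ball 0 e" using e(1) \<rho>0 by (intro image_eqI[of _ _ 0]) auto
  have g0: "g 0 = 0" using g(2)[of 0] e(1) \<rho>0 by simp
  have ag: "analytic1 g" unfolding analytic1_def analytic_at using g(1) e(3) in0 by blast
  have 1: "\<forall>\<^sub>F t in nhds 0. \<rho> (g t) = t"
    using eventually_nhds_in_open[OF e(3) in0] by eventually_elim (use g(2) in auto)
  have 2: "\<forall>\<^sub>F t in nhds 0. g (\<rho> t) = t"
  proof (rule eventually_mono[OF eventually_nhds_in_open[OF open_ball]])
    show "0 \<in> ball 0 e" using e(1) by simp
  qed (rule g(2))
  have "analytic1 \<rho>" using r(1) analytic1_iff by blast
  then have "aut1 \<rho>" unfolding aut1_def using \<rho>0 ag g0 1 2 by blast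
  with ag g0 1 2 show ?thesis by (rule that)
qed

text \<open>\<open>P / t ^ n\<close> tends to 1, so the principal branch of the root gives an
  analytic solution; uniqueness of roots tangent to the identity identifies its expansion with
  \<open>r\<close>.\<close>

lemma analytic_root:
  fixes P :: "complex \<Rightarrow> complex"
  assumes P: "P has_fps_expansion r ^ n" and n: "0 < n" and r: "fps_X ^ 2 dvd r - fps_X"
  obtains \<rho> where "\<rho> has_fps_expansion r" "\<forall>\<^sub>F t in nhds 0. \<rho> t ^ n = P t"
proof -
  have rn: "fps_X ^ n dvd r ^ n" "(r ^ n) $ n = 1"
    using tangent_idD[OF r] dvd_power_same[of fps_X r n] power_nth_lead[of r n] by auto
  have rn0: "r ^ n \<noteq> 0" using rn(2) by force
  have sub: "n \<le> subdegree (r ^ n)"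
    using rn(1) rn0 by (intro subdegree_geI) (auto simp: X_pow_dvd_iff)
  define p where "p = (\<lambda>t. if t = 0 then (r ^ n) $ n else P t / t ^ n)"
  have p: "p has_fps_expansion fps_shift n (r ^ n)"
    unfolding p_def by (rule has_fps_expansion_shift[OF P sub]) simp
  have p0: "p 0 = 1" using rn(2) by (simp add: p_def)
  define q where "q = (\<lambda>t. exp (Ln (p t) / of_nat n))"
  have "p analytic_on {0}" using p by (rule has_fps_expansion_imp_analytic_0)
  then have "q analytic_on {0}" unfolding q_def using n
    by (intro analytic_intros) (auto simp: p0)
  then obtain Q where Q: "q has_fps_expansion Q" using analytic_at_imp_has_fps_expansion_0 by blast
  have Q0: "Q $ 0 = 1" using has_fps_expansion_imp_0_eq_fps_nth_0[OF Q] by (simp add: q_def p0)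
  have "(\<lambda>t. t * q t) has_fps_expansion fps_X * Q"
    by (intro has_fps_expansion_mult has_fps_expansion_fps_X Q)
  note XQ = this
  have "(p \<longlongrightarrow> p 0) (nhds 0)"
    using has_fps_expansion_imp_continuous[OF p, of UNIV] by (simp add: continuous_within tendsto_at_iff_tendsto_nhds)
  then have "\<forall>\<^sub>F t in nhds 0. p t \<in> - {0}"
    by (rule topological_tendstoD) (auto simp: p0)
  then have e: "\<forall>\<^sub>F t in nhds 0. (t * q t) ^ n = P t"
  proof eventually_elim
    case (elim t)
    have "q t ^ n = exp (of_nat n * (Ln (p t) / of_nat n))" by (simp only: q_def exp_of_nat_mult)
    also have "\<dots> = p t" using elim n by simp
    finally have "(t * q t) ^ n = t ^ n * p t" by (simp add: power_mult_distrib)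
    also have "\<dots> = P t"
    proof (cases "t = 0")
      case True
      have "P 0 = (r ^ n) $ 0" using has_fps_expansion_imp_0_eq_fps_nth_0[OF P] .
      also have "\<dots> = 0" using rn(1) n unfolding X_pow_dvd_iff by blast
      finally show ?thesis using True n by simp
    qed (simp add: p_def)
    finally show ?case .
  qed
  have "(\<lambda>t. (t * q t) ^ n) has_fps_expansion (fps_X * Q) ^ n" by (rule has_fps_expansion_power[OF XQ])
  then have "P has_fps_expansion (fps_X * Q) ^ n" using has_fps_expansion_cong[OF e refl] by blast
  then have eq: "(fps_X * Q) ^ n = r ^ n" using P by (rule fps_expansion_unique_complex)
  have "fps_X dvd Q - 1" by (simp add: X_dvd_iff Q0)
  then have "fps_X ^ 2 dvd fps_X * Q - fps_X"
    using mult_dvd_mono[of fps_X fps_X fps_X "Q - 1"] by (simp add: power2_eq_square algebra_simps)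
  then have "fps_X * Q = r" using root_unique r n eq by blast
  then show ?thesis using that[of "\<lambda>t. t * q t"] XQ e by simp
qed

lemma compose_tangent_cancel:
  fixes D r :: "complex fps"
  assumes r: "fps_X ^ 2 dvd r - fps_X" and d: "fps_X ^ k dvd D oo r"
  shows "fps_X ^ k dvd D" "D $ k = (D oo r) $ k"
proof -
  show D: "fps_X ^ k dvd D"
  proof (cases "D = 0")
    case False
    have "D oo r \<noteq> 0" "subdegree (D oo r) = subdegree D"
      using subdegree_compose_unit[OF False] tangent_idD[OF r] by auto
    moreover have "k \<le> subdegree (D oo r)"
      using d \<open>D oo r \<noteq> 0\<close> by (intro subdegree_geI) (auto simp: X_pow_dvd_iff)
    ultimately show ?thesis unfolding X_pow_dvd_iff by (metis nth_less_subdegree_zero less_le_trans)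
  qed simp
  show "D $ k = (D oo r) $ k" using compose_nth_lead[OF D tangent_idD(3)[OF r]] tangent_idD(2)[OF r] by simp
qed

text \<open>Realises \<open>formal_elimination\<close>: the polynomial map
  \<open>(X + u, Y + v)\<close> is an automorphism, the formal root is the expansion of a
  reparametrization \<open>\<rho>\<close>, and the new second component is \<open>Q\<close> composed
  with the inverse of \<open>\<rho>\<close>.\<close>

lemma eliminate_coefficient:
  assumes n: "0 < n" "n < m" and y: "y has_fps_expansion Y" "fps_X ^ m dvd Y"
    and a: "wts n m (n + 1) a" and b: "wts n m (m + 1) b"
    and k: "m \<le> k" and W: "fps_X ^ (k + n - 1) dvd Wser n Y a b N"
  obtains z Z where "z has_fps_expansion Z" "A_equiv (par n y) (par n z)" "fps_X ^ k dvd Z - Y"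
    "Z $ k = Y $ k + Wser n Y a b N $ (k + n - 1) / of_nat n"
proof -
  obtain M u v r where *: "supp_le M u" "supp_le M v" "wts n m (n + 1) u" "wts n m (m + 1) v"
    "fps_X ^ 2 dvd r - fps_X" "r ^ n = fps_X ^ n + pev u M (fps_X ^ n) Y"
    "fps_X ^ k dvd Y + pev v M (fps_X ^ n) Y - (Y oo r)"
    "(Y + pev v M (fps_X ^ n) Y - (Y oo r)) $ k = Wser n Y a b N $ (k + n - 1) / of_nat n"
    using formal_elimination[OF y(2) n a b k W] by metis
  define P where "P t = t ^ n + polyfun u M (par n y t)" for t
  define Q where "Q t = y t + polyfun v M (par n y t)" for t
  have P: "P has_fps_expansion r ^ n" unfolding P_def par_def *(6)
    by (intro has_fps_expansion_add X_pow_expansion polyfun_expansion y)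
  have Q: "Q has_fps_expansion Y + pev v M (fps_X ^ n) Y" unfolding Q_def par_def
    by (intro has_fps_expansion_add X_pow_expansion polyfun_expansion y)
  obtain \<rho> where \<rho>: "\<rho> has_fps_expansion r" "\<forall>\<^sub>F t in nhds 0. \<rho> t ^ n = P t"
    using analytic_root[OF P n(1) *(5)] .
  note rt = tangent_idD[OF *(5)]
  obtain q where q: "analytic1 q" "q 0 = 0" "\<forall>\<^sub>F t in nhds 0. \<rho> (q t) = t" "\<forall>\<^sub>F t in nhds 0. q (\<rho> t) = t" "aut1 \<rho>"
    using aut1_intro[OF \<rho>(1)] rt by (metis One_nat_def zero_neq_one)
  define z where "z = Q \<circ> q"
  obtain qF where qF: "q has_fps_expansion qF" using q(1) analytic1_iff by blast
  have "qF $ 0 = 0" using has_fps_expansion_imp_0_eq_fps_nth_0[OF qF] q(2) by simp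
  then obtain Z where Z: "z has_fps_expansion Z"
    unfolding z_def using has_fps_expansion_compose[OF Q qF] by blast
  have zr: "\<forall>\<^sub>F t in nhds 0. (z \<circ> \<rho>) t = Q t" using q(4) by eventually_elim (simp add: z_def)
  have "(z \<circ> \<rho>) has_fps_expansion (Z oo r)" by (rule has_fps_expansion_compose[OF Z \<rho>(1) rt(1)])
  then have "Q has_fps_expansion (Z oo r)" using has_fps_expansion_cong[OF zr refl] by blast
  then have ZQ: "Z oo r = Y + pev v M (fps_X ^ n) Y" using Q by (rule fps_expansion_unique_complex)
  have d: "fps_X ^ k dvd (Z - Y) oo r" using *(7) by (simp add: fps_compose_sub_distrib ZQ)
  \<comment> \<open>The weight bounds leave one linear term besides the identity, namely
    \<open>Y\<close> in the first component. It is split off because the rest is then of degree at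
    least 2.\<close>
  define \<beta> where "\<beta> = u 0 1"
  define u' where "u' = (\<lambda>i j. if i = 0 \<and> j = 1 then 0 else u i j)"
  have u'0: "u' i j = 0" if "i + j < 2" for i j
  proof (rule ccontr)
    assume nz: "u' i j \<noteq> 0"
    then have "u i j \<noteq> 0" "\<not> (i = 0 \<and> j = 1)" by (auto simp: u'_def split: if_splits)
    then have "n + 1 \<le> n * i + m * j" using wtsD[OF *(3)] by blast
    moreover have "j = 0 \<and> i \<le> 1" using that \<open>\<not> (i = 0 \<and> j = 1)\<close> by linarith
    ultimately show False by (cases i) auto
  qed
  have v0: "v i j = 0" if "i + j < 2" for i j
  proof (rule ccontr)
    assume "v i j \<noteq> 0"
    then have "m + 1 \<le> n * i + m * j" using wtsD[OF *(4)] by blast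
    moreover have "i = 0 \<and> j = 0 \<or> i = 1 \<and> j = 0 \<or> i = 0 \<and> j = 1" using that by linarith
    ultimately show False using n by auto
  qed
  have "supp_le M u'" using *(1) by (auto simp: supp_le_def u'_def)
  then have "aut2 (\<lambda>p. (fst p + \<beta> * snd p + polyfun u' M p, snd p + polyfun v M p))"
    by (intro aut2_near_identity[OF ps2_polyfun ps2_polyfun[OF *(2)]] u'0 v0)
  moreover have "\<beta> * snd p + polyfun u' M p = polyfun u M p" for p
  proof (cases "1 \<le> M")
    case True
    have "polyfun u M p = (\<Sum>i\<le>M. \<Sum>j\<le>M. u' i j * fst p ^ i * snd p ^ j + (if j = 1 then if i = 0 then \<beta> * snd p else 0 else 0))"
      unfolding polyfun_def u'_def by (intro sum.cong refl) (auto simp: \<beta>_def)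
    also have "\<dots> = polyfun u' M p + \<beta> * snd p"
      using True by (simp add: sum.distrib polyfun_def)
    finally show ?thesis by simp
  next
    case False
    then have "\<beta> = 0" using *(1) by (auto simp: supp_le_def \<beta>_def)
    then show ?thesis by (auto simp: polyfun_def u'_def \<beta>_def intro!: sum.cong)
  qed
  ultimately have s: "aut2 (\<lambda>p. (fst p + polyfun u M p, snd p + polyfun v M p))" by (simp add: add.assoc)
  have "\<forall>\<^sub>F t in nhds 0. par n z (\<rho> t) = (fst (par n y t) + polyfun u M (par n y t), snd (par n y t) + polyfun v M (par n y t))"
    using zr \<rho>(2) by eventually_elim (simp add: par_def P_def Q_def)
  then have "A_equiv (par n y) (par n z)" unfolding A_equiv_def using s q(5) by blast
  then show ?thesis
  proof (rule that[OF Z])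
    show "fps_X ^ k dvd Z - Y" using compose_tangent_cancel(1)[OF *(5) d] .
    show "Z $ k = Y $ k + Wser n Y a b N $ (k + n - 1) / of_nat n"
      using compose_tangent_cancel(2)[OF *(5) d] unfolding fps_compose_sub_distrib ZQ *(8)
      by (simp add: diff_eq_eq add.commute)
  qed
qed

lemma ps2_uminus: "ps2 h r c \<Longrightarrow> ps2 (\<lambda>p. - h p) r (\<lambda>i j. - c i j)"
proof -
  assume h: "ps2 h r c"
  have "((\<lambda>(i, j). - c i j * x ^ i * y ^ j) has_sum - h (x, y)) UNIV" if "norm x \<le> r" "norm y \<le> r" for x y
  proof -
    have "((\<lambda>(i, j). c i j * x ^ i * y ^ j) has_sum h (x, y)) UNIV" using h that by (auto simp: ps2_def)
    then have "((\<lambda>p. - (case p of (i, j) \<Rightarrow> c i j * x ^ i * y ^ j)) has_sum - h (x, y)) UNIV"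
      by (simp add: has_sum_uminus)
    then show ?thesis by (simp add: case_prod_unfold)
  qed
  then show ?thesis using h by (simp add: ps2_def)
qed

lemma aut1_id: "aut1 (\<lambda>t. t)"
proof -
  have "analytic1 (\<lambda>t. t)" unfolding analytic1_iff using has_fps_expansion_fps_X by blast
  then show ?thesis unfolding aut1_def by (auto intro!: exI[of _ "\<lambda>t. t"])
qed

text \<open>By \<open>low_weights\<close> the germ \<open>h\<close> has weight above
  \<open>m\<close>, hence no constant or linear terms, and \<open>(X, Y - h)\<close> is an
  automorphism. The parameter stays the same.\<close>

lemma remove_tail:
  assumes n: "0 < n" "n < m" "\<not> n dvd m" and y: "y has_fps_expansion Y" "fps_X ^ m dvd Y" "Y $ m = 1"
    and h: "analytic2 h" and f: "f has_fps_expansion F" "fps_X ^ Suc m dvd F"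
    and fh: "\<forall>\<^sub>F t in nhds 0. f t = h (par n y t)"
  shows "A_equiv (par n y) (par n (\<lambda>t. y t - f t))"
proof -
  obtain r c where c: "ps2 h r c" using analytic2_imp_ps2[OF h] .
  have Y0: "Y $ 0 = 0" using y(2) n by (auto simp: X_pow_dvd_iff)
  obtain H where H: "(\<lambda>t. h (t ^ n, y t)) has_fps_expansion H" "\<And>N. fps_X ^ Suc N dvd H - pev c N (fps_X ^ n) Y"
    using comp_expansion_par[OF c n(1) y(1) Y0] by blast
  have "f has_fps_expansion H"
    using has_fps_expansion_cong[OF fh refl, of H] H(1) by (simp add: par_def)
  then have HF: "H = F" using f(1) by (rule fps_expansion_unique_complex)
  have "fps_X ^ Suc m dvd H - pev c m (fps_X ^ n) Y" by (rule H(2))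
  then have "fps_X ^ Suc m dvd pev c m (fps_X ^ n) Y"
    using dvd_diff[OF f(2)[folded HF], of "H - pev c m (fps_X ^ n) Y"] by simp
  then have w: "wts n m (Suc m) c" using low_weights[OF n y(2,3)] by simp
  have c0: "- c i j = 0" if "i + j < 2" for i j
  proof (rule ccontr)
    assume "- c i j \<noteq> 0"
    then have "m + 1 \<le> n * i + m * j" using wtsD[OF w, of i j] by simp
    moreover have "i = 0 \<and> j = 0 \<or> i = 1 \<and> j = 0 \<or> i = 0 \<and> j = 1" using that by linarith
    ultimately show False using n by auto
  qed
  have z: "ps2 (polyfun (\<lambda>_ _. 0) 0) 1 (\<lambda>_ _. 0)" by (rule ps2_polyfun) (simp add: supp_le_def)
  have "aut2 (\<lambda>p. (fst p + 0 * snd p + polyfun (\<lambda>_ _. 0) 0 p, snd p + - h p))"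
    by (rule aut2_near_identity[OF z ps2_uminus[OF c] _ c0]) simp_all
  then have s: "aut2 (\<lambda>p. (fst p, snd p - h p))" by (simp add: polyfun_def)
  have "\<forall>\<^sub>F t in nhds 0. par n (\<lambda>t. y t - f t) t = (fst (par n y t), snd (par n y t) - h (par n y t))"
    using fh by eventually_elim (simp add: par_def)
  then show ?thesis unfolding A_equiv_def using s aut1_id by blast
qed

lemma A_equiv_scale:
  assumes r: "r \<noteq> 0" and z: "\<And>t. z (r * t) = r ^ m * y t"
  shows "A_equiv (par n y) (par n z)"
proof -
  have lin: "analytic2 (\<lambda>p. a * fst p)" "analytic2 (\<lambda>p. a * snd p)" for a
    by (intro analytic2_mult analytic2_const analytic2_fst analytic2_snd)+
  have o: "fst \<circ> (\<lambda>p. (a * fst p, b * snd p)) = (\<lambda>p. a * fst p)" "snd \<circ> (\<lambda>p. (a * fst p, b * snd p)) = (\<lambda>p. b * snd p)"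
    for a b :: complex by auto
  have s: "aut2 (\<lambda>p. (r ^ n * fst p, r ^ m * snd p))"
    unfolding aut2_def
  proof (intro conjI exI[of _ "\<lambda>p. (inverse (r ^ n) * fst p, inverse (r ^ m) * snd p)"])
  qed (use r lin o in \<open>simp_all add: o_def flip: mult.assoc\<close>)
  have "analytic1 (\<lambda>t. a * t)" for a
    unfolding analytic1_iff using has_fps_expansion_cmult_left[OF has_fps_expansion_fps_X] by blast
  then have "aut1 (\<lambda>t. r * t)" unfolding aut1_def using r by (auto intro!: exI[of _ "\<lambda>t. inverse r * t"])
  then show ?thesis unfolding A_equiv_def using s z
    by (intro exI[of _ "\<lambda>p. (r ^ n * fst p, r ^ m * snd p)"] exI[of _ "\<lambda>t. r * t"]) (auto simp: par_def power_mult_distrib)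
qed

section \<open>Finite determinacy\<close>

text \<open>The regrouped series converges at \<open>s ^ d\<close> for every positive
  \<open>s < r\<close>, so its radius is at least \<open>r ^ d\<close>.\<close>

lemma power_substitution:
  fixes f :: "complex \<Rightarrow> complex"
  assumes f: "f holomorphic_on ball 0 r" and r: "0 < r" and F: "f has_fps_expansion F" and d: "0 < d"
    and supp: "\<And>k. F $ k \<noteq> 0 \<Longrightarrow> d dvd k"
  obtains g where "g holomorphic_on ball 0 (r ^ d)" "\<And>t. t \<in> ball 0 r \<Longrightarrow> g (t ^ d) = f t"
proof -
  define G where "G = Abs_fps (\<lambda>k. F $ (d * k))"
  have sums: "(\<lambda>k. F $ k * t ^ k) sums f t" if "t \<in> ball 0 r" for t
    using holomorphic_power_series[OF f that] fps_nth_fps_expansion[OF F] by simp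
  have gsums: "(\<lambda>k. G $ k * (t ^ d) ^ k) sums f t" if t: "t \<in> ball 0 r" for t
  proof -
    have sm: "strict_mono (\<lambda>k. d * k)" using d by (auto simp: strict_mono_def)
    have "F $ k * t ^ k = 0" if "k \<notin> range (\<lambda>k. d * k)" for k
    proof (rule ccontr)
      assume "F $ k * t ^ k \<noteq> 0"
      then have "d dvd k" using supp by auto
      then show False using that by (auto elim!: dvdE)
    qed
    then have "(\<lambda>k. F $ (d * k) * t ^ (d * k)) sums f t"
      using sums_mono_reindex[OF sm, of "\<lambda>k. F $ k * t ^ k"] sums[OF t] by blast
    then show ?thesis by (simp add: G_def power_mult)
  qed
  have sub: "ball (0 :: complex) (r ^ d) \<subseteq> eball 0 (fps_conv_radius G)"
  proof
    fix x :: complex assume x: "x \<in> ball 0 (r ^ d)"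
    have "root d (norm x) < r" using x d r real_root_less_iff[of d "norm x" "r ^ d"] by (simp add: real_root_power_cancel)
    then obtain s where s: "root d (norm x) < s" "s < r" using dense by blast
    have s0: "0 < s" using s(1) d real_root_ge_zero[of "norm x" d] by (meson norm_ge_zero le_less_trans)
    have "summable (\<lambda>k. G $ k * (of_real s ^ d) ^ k)"
      using gsums[of "of_real s"] s s0 by (auto simp: sums_iff)
    then have "ereal (norm ((of_real s :: complex) ^ d)) \<le> conv_radius (fps_nth G)" by (rule conv_radius_geI)
    then have "ereal (s ^ d) \<le> fps_conv_radius G" using s0 by (simp add: fps_conv_radius_def norm_power)
    moreover have "norm x < s ^ d"
    proof -
      have "root d (norm x) ^ d < s ^ d" using s d by (intro power_strict_mono) auto
      then show ?thesis using d by simp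
    qed
    ultimately have "ereal (norm x) < fps_conv_radius G" by (meson ereal_less_eq(3) less_le_trans less_ereal.simps(1))
    then show "x \<in> eball 0 (fps_conv_radius G)" by (simp add: in_eball_iff)
  qed
  have h: "eval_fps G holomorphic_on ball 0 (r ^ d)"
    using sub by (rule holomorphic_on_eval_fps)
  have e: "eval_fps G (t ^ d) = f t" if "t \<in> ball 0 r" for t
    using gsums[OF that] by (simp add: eval_fps_def sums_iff)
  show ?thesis using that[OF h] e by blast
qed

section \<open>Interpolation over the conjugates\<close>

locale root_of_unity =
  fixes n :: nat and \<zeta> :: complex
  assumes n: "0 < n" and z: "\<zeta> ^ n = 1" and inj: "\<And>i j. i < n \<Longrightarrow> j < n \<Longrightarrow> \<zeta> ^ i = \<zeta> ^ j \<Longrightarrow> i = j"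
begin

lemma norm_zeta: "norm \<zeta> = 1"
proof -
  have "norm \<zeta> ^ n = 1 ^ n" using z by (metis norm_one norm_power power_one)
  then show ?thesis using n power_eq_imp_eq_base[of "norm \<zeta>" n 1] by simp
qed

lemma zeta_mod: "\<zeta> ^ k = \<zeta> ^ (k mod n)"
proof -
  have "\<zeta> ^ k = \<zeta> ^ (n * (k div n) + k mod n)" by simp
  then show ?thesis unfolding power_add power_mult z by simp
qed

lemma zeta_eq_1: "\<zeta> ^ k = 1 \<longleftrightarrow> n dvd k"
proof
  assume "\<zeta> ^ k = 1"
  then have "\<zeta> ^ (k mod n) = \<zeta> ^ 0" using zeta_mod[of k] by simp
  then have "k mod n = 0" using inj[of "k mod n" 0] n by simp
  then show "n dvd k" by auto
next
  assume "n dvd k"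
  then show "\<zeta> ^ k = 1" using z by (auto simp: power_mult)
qed

lemma bij_shift: "bij_betw (\<lambda>i. Suc i mod n) {..<n} {..<n}"
proof -
  have "inj_on (\<lambda>i. Suc i mod n) {..<n}"
    by (rule inj_onI) (auto simp: mod_Suc split: if_splits)
  moreover have "(\<lambda>i. Suc i mod n) ` {..<n} \<subseteq> {..<n}" using n by auto
  ultimately show ?thesis by (simp add: bij_betw_def endo_inj_surj)
qed

text \<open>The numerators of Lagrange interpolation at the conjugates \<open>y(\<zeta>^j t)\<close>. Being invariant under
  \<open>t \<mapsto> \<zeta> t\<close>, the sum is an analytic function of \<open>t^n\<close> and \<open>Y\<close>.\<close>

definition lagrange :: "(complex \<Rightarrow> complex) \<Rightarrow> (complex \<Rightarrow> complex) \<Rightarrow> complex \<Rightarrow> complex \<Rightarrow> complex" where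
  "lagrange y g t Y = (\<Sum>i<n. g (\<zeta> ^ i * t) * (\<Prod>j\<in>{..<n} - {i}. Y - y (\<zeta> ^ j * t)))"

lemma lagrange_invariant: "lagrange y g (\<zeta> * t) Y = lagrange y g t Y"
proof -
  define p where "p i = Suc i mod n" for i
  have bp: "bij_betw p {..<n} {..<n}" unfolding p_def by (rule bij_shift)
  have e: "\<zeta> ^ i * (\<zeta> * t) = \<zeta> ^ p i * t" for i
    using zeta_mod[of "Suc i"] by (simp add: p_def mult_ac)
  have "(\<Prod>j\<in>{..<n} - {i}. Y - y (\<zeta> ^ p j * t)) = (\<Prod>j\<in>{..<n} - {p i}. Y - y (\<zeta> ^ j * t))" if i: "i < n" for i
  proof (rule prod.reindex_bij_betw)
    have "p ` ({..<n} - {i}) = p ` {..<n} - p ` {i}"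
      using bp i by (intro inj_on_image_set_diff[of p "{..<n}"]) (auto simp: bij_betw_def)
    then show "bij_betw p ({..<n} - {i}) ({..<n} - {p i})"
      using bp by (auto simp: bij_betw_def intro: inj_on_subset)
  qed
  then have "lagrange y g (\<zeta> * t) Y = (\<Sum>i<n. g (\<zeta> ^ p i * t) * (\<Prod>j\<in>{..<n} - {p i}. Y - y (\<zeta> ^ j * t)))"
    unfolding lagrange_def e by (intro sum.cong refl) auto
  also have "\<dots> = lagrange y g t Y" unfolding lagrange_def by (rule sum.reindex_bij_betw[OF bp])
  finally show ?thesis .
qed

lemma lagrange_interpolates: "lagrange y g t (y t) = g t * (\<Prod>j\<in>{1..<n}. y t - y (\<zeta> ^ j * t))"
proof -
  have "(\<Prod>j\<in>{..<n} - {i}. y t - y (\<zeta> ^ j * t)) = 0" if "i \<in> {..<n} - {0}" for i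
    using that n by (intro prod_zero) (auto intro!: bexI[of _ 0])
  then have "lagrange y g t (y t) = (\<Sum>i\<in>{0}. g (\<zeta> ^ i * t) * (\<Prod>j\<in>{..<n} - {i}. y t - y (\<zeta> ^ j * t)))"
    unfolding lagrange_def using n by (intro sum.mono_neutral_right) auto
  moreover have "{..<n} - {0} = {1..<n}" by auto
  ultimately show ?thesis by simp
qed

text \<open>For fixed \<open>Y\<close>, invariance leaves only powers of \<open>t ^ n\<close>. The
  resulting functions are chosen for each \<open>Y\<close> separately; joint analyticity is
  recovered from Osgood's lemma, since the expression is polynomial in \<open>Y\<close> for fixed
  \<open>t\<close> and bounded.\<close>

lemma lagrange_descends:
  assumes r: "0 < r" and y: "y holomorphic_on ball 0 r" and g: "g holomorphic_on ball 0 r"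
    and B: "\<And>t. t \<in> ball 0 r \<Longrightarrow> norm (y t) \<le> B" "\<And>t. t \<in> ball 0 r \<Longrightarrow> norm (g t) \<le> B"
  obtains h where "analytic2 h" "\<And>t Y. t \<in> ball 0 r \<Longrightarrow> h (t ^ n, Y) = lagrange y g t Y"
proof -
  have zb: "\<zeta> ^ j * t \<in> ball 0 r" if "t \<in> ball 0 r" for j t
    using that norm_zeta by (simp add: norm_mult norm_power)
  have comp: "(\<lambda>t. f (\<zeta> ^ j * t)) holomorphic_on ball 0 r" if "f holomorphic_on ball 0 r" for f j
    using holomorphic_on_compose_gen[OF _ that, of "\<lambda>t. \<zeta> ^ j * t" "ball 0 r"] zb
    by (force simp: o_def intro!: holomorphic_intros)
  have lh: "(\<lambda>t. lagrange y g t Y) holomorphic_on ball 0 r" for Y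
    unfolding lagrange_def using y g by (intro holomorphic_intros comp) auto
  have ex: "\<exists>q. q holomorphic_on ball 0 (r ^ n) \<and> (\<forall>t\<in>ball 0 r. q (t ^ n) = lagrange y g t Y)" for Y
  proof -
    define f where "f = (\<lambda>t. lagrange y g t Y)"
    have fh: "f holomorphic_on ball 0 r" unfolding f_def by (rule lh)
    have "f analytic_on {0}" using fh r by (auto simp: analytic_at intro!: exI[of _ "ball 0 r"])
    then obtain F where F: "f has_fps_expansion F" using analytic_at_imp_has_fps_expansion_0 by blast
    have "(\<lambda>t. \<zeta> * t) has_fps_expansion fps_const \<zeta> * fps_X"
      by (intro has_fps_expansion_cmult_left has_fps_expansion_fps_X)
    then have "(f \<circ> (\<lambda>t. \<zeta> * t)) has_fps_expansion (F oo (fps_const \<zeta> * fps_X))"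
      by (rule has_fps_expansion_compose[OF F]) simp
    moreover have "f \<circ> (\<lambda>t. \<zeta> * t) = f" by (auto simp: f_def lagrange_invariant)
    ultimately have "F oo (fps_const \<zeta> * fps_X) = F" using F fps_expansion_unique_complex by metis
    then have "\<zeta> ^ k * F $ k = F $ k" for k by (simp add: fps_compose_linear fps_eq_iff)
    then have "n dvd k" if "F $ k \<noteq> 0" for k using that zeta_eq_1[of k] by auto
    then obtain q where "q holomorphic_on ball 0 (r ^ n)" "\<And>t. t \<in> ball 0 r \<Longrightarrow> q (t ^ n) = f t"
      using power_substitution[OF fh r F n] by blast
    then show ?thesis unfolding f_def by blast
  qed
  then obtain q where q: "\<And>Y. q Y holomorphic_on ball 0 (r ^ n)" "\<And>Y t. t \<in> ball 0 r \<Longrightarrow> q Y (t ^ n) = lagrange y g t Y"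
    by metis
  define h where "h = (\<lambda>p. q (snd p) (fst p))"
  define R where "R = min 1 (r ^ n)"
  have R: "0 < R" "R \<le> 1" "R \<le> r ^ n" using r by (auto simp: R_def)
  have pre: "\<exists>t\<in>ball 0 r. t ^ n = x" if "x \<in> ball 0 R" for x :: complex
  proof -
    obtain t where t: "t ^ n = x" using exists_complex_root[of n x] n by auto
    have "norm t ^ n < r ^ n" using that R t by (simp flip: norm_power)
    then have "norm t < r" using power_less_imp_less_base[of "norm t" n r] r by simp
    then show ?thesis using t by auto
  qed
  have B0: "0 \<le> B" using B(1)[of 0] r norm_ge_zero order_trans by (metis centre_in_ball)
  have bound: "norm (lagrange y g t Y) \<le> real n * (B * (1 + B) ^ (n - 1))" if t: "t \<in> ball 0 r" and Y: "norm Y \<le> 1" for t Y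
  proof -
    have "norm (g (\<zeta> ^ i * t) * (\<Prod>j\<in>{..<n} - {i}. Y - y (\<zeta> ^ j * t))) \<le> B * (1 + B) ^ (n - 1)" if "i < n" for i
    proof -
      have "norm (\<Prod>j\<in>{..<n} - {i}. Y - y (\<zeta> ^ j * t)) \<le> (\<Prod>j\<in>{..<n} - {i}. 1 + B)"
        unfolding prod_norm[symmetric]
      proof (intro prod_mono conjI norm_ge_zero)
        fix j
        show "norm (Y - y (\<zeta> ^ j * t)) \<le> 1 + B"
          using norm_triangle_ineq4[of Y "y (\<zeta> ^ j * t)"] B(1)[OF zb[OF t, of j]] Y by linarith
      qed
      also have "\<dots> = (1 + B) ^ (n - 1)" using that by simp
      finally show ?thesis unfolding norm_mult using B(2)[OF zb[OF t]] B0 by (intro mult_mono) auto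
    qed
    then have "norm (lagrange y g t Y) \<le> (\<Sum>i<n. B * (1 + B) ^ (n - 1))" unfolding lagrange_def by (intro sum_norm_le) auto
    then show ?thesis by simp
  qed
  have "sephol h R" unfolding sephol_def
  proof (intro conjI ballI R(1))
    have "norm (h (x, Y)) \<le> real n * (B * (1 + B) ^ (n - 1))" if "x \<in> ball 0 R" "Y \<in> ball 0 R" for x Y
    proof -
      from pre[OF that(1)] obtain t where t: "t \<in> ball 0 r" "t ^ n = x" by blast
      have "norm Y \<le> 1" using that(2) R by simp
      then show ?thesis using bound[OF t(1)] q(2)[OF t(1), of Y] t(2) by (simp add: h_def)
    qed
    then show "\<exists>M. \<forall>x\<in>ball 0 R. \<forall>Y\<in>ball 0 R. norm (h (x, Y)) \<le> M" by blast
    show "(\<lambda>x. h (x, Y)) holomorphic_on ball 0 R" for Y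
      using q(1)[of Y] R(3) by (auto simp: h_def elim!: holomorphic_on_subset)
    show "(\<lambda>Y. h (x, Y)) holomorphic_on ball 0 R" if x: "x \<in> ball 0 R" for x
    proof -
      obtain t where t: "t \<in> ball 0 r" "t ^ n = x" using pre[OF x] by blast
      have "(\<lambda>Y. h (x, Y)) = (\<lambda>Y. lagrange y g t Y)" using q(2)[OF t(1)] t(2) by (auto simp: h_def)
      moreover have "(\<lambda>Y. lagrange y g t Y) holomorphic_on ball 0 R" unfolding lagrange_def by (intro holomorphic_intros)
      ultimately show ?thesis by simp
    qed
  qed
  then have "analytic2 h" using analytic2_iff_sephol by blast
  then show ?thesis using that[of h] q(2) by (simp add: h_def)
qed

end

lemma root_of_unity_exists:
  assumes "0 < n"
  obtains \<zeta> where "root_of_unity n \<zeta>"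
proof -
  define \<zeta> where "\<zeta> = cis (2 * pi / real n)"
  have p: "\<zeta> ^ k = cis (2 * pi * real k / real n)" for k
  proof -
    have "cis (2 * pi / real n) ^ k = cis (real k * (2 * pi / real n))" by (rule Complex.DeMoivre)
    moreover have "real k * (2 * pi / real n) = 2 * pi * real k / real n" by simp
    ultimately show ?thesis by (simp only: \<zeta>_def)
  qed
  have "root_of_unity n \<zeta>"
  proof
    show "\<zeta> ^ n = 1" using assms by (simp add: p)
    show "i = j" if "i < n" "j < n" "\<zeta> ^ i = \<zeta> ^ j" for i j
      using Complex.bij_betw_roots_unity[OF assms] that unfolding p bij_betw_def inj_on_def by auto
  qed (use assms in simp)
  then show ?thesis by (rule that)
qed

lemma local_hol_bound:
  fixes f g :: "complex \<Rightarrow> complex"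
  assumes "f has_fps_expansion F" "g has_fps_expansion G"
  obtains r B where "0 < r" "f holomorphic_on ball 0 r" "g holomorphic_on ball 0 r"
    "\<And>t. t \<in> ball 0 r \<Longrightarrow> norm (f t) \<le> B" "\<And>t. t \<in> ball 0 r \<Longrightarrow> norm (g t) \<le> B"
proof -
  obtain S where S: "open S" "0 \<in> S" "f holomorphic_on S"
    using has_fps_expansion_imp_analytic_0[OF assms(1)] by (auto simp: analytic_at)
  obtain T where T: "open T" "0 \<in> T" "g holomorphic_on T"
    using has_fps_expansion_imp_analytic_0[OF assms(2)] by (auto simp: analytic_at)
  have "open (S \<inter> T)" "0 \<in> S \<inter> T" using S T by auto
  then obtain r where r: "0 < r" "cball 0 r \<subseteq> S \<inter> T" unfolding open_contains_cball by blast
  have hol: "f holomorphic_on cball 0 r" "g holomorphic_on cball 0 r"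
    using S(3) T(3) r(2) by (auto elim: holomorphic_on_subset)
  have "bounded (f ` cball 0 r)" "bounded (g ` cball 0 r)"
    using hol by (auto intro!: compact_imp_bounded compact_continuous_image holomorphic_on_imp_continuous_on)
  then obtain B1 B2 where "\<forall>x\<in>f ` cball 0 r. norm x \<le> B1" "\<forall>x\<in>g ` cball 0 r. norm x \<le> B2"
    unfolding bounded_iff by blast
  moreover have "ball 0 r \<subseteq> cball (0 :: complex) r" by (rule ball_subset_cball)
  ultimately show ?thesis using hol r(1)
    by (intro that[of r "max B1 B2"]) (auto elim: holomorphic_on_subset simp: le_max_iff_disj)
qed

text \<open>If two conjugates coincide, every exponent of \<open>y\<close> is divisible by
  \<open>d = n div gcd n j\<close>, which is at least 2 as \<open>0 < j < n\<close>. The curve is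
  then a curve in \<open>t ^ d\<close>.\<close>

lemma primitive_conjugates:
  assumes prim: "primitive (par n y)" and y: "y has_fps_expansion Y" "Y $ 0 = 0"
    and rz: "root_of_unity n \<zeta>" and j: "j \<in> {1..<n}"
  shows "Y \<noteq> Y oo (fps_const (\<zeta> ^ j) * fps_X)"
proof
  interpret root_of_unity n \<zeta> by (rule rz)
  assume eq: "Y = Y oo (fps_const (\<zeta> ^ j) * fps_X)"
  define d where "d = n div gcd n j"
  have g: "0 < gcd n j" "gcd n j < n" using j by (auto intro: le_less_trans[OF gcd_le2_nat])
  have nd: "n = d * gcd n j" by (simp add: d_def)
  have d2: "2 \<le> d"
  proof (rule ccontr)
    assume "\<not> 2 \<le> d"
    then have "d = 0 \<or> d = 1" by auto
    then show False using nd g by auto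
  qed
  have supp: "d dvd k" if "Y $ k \<noteq> 0" for k
  proof -
    have "Y $ k = (\<zeta> ^ j) ^ k * Y $ k"
      using arg_cong[OF eq, of "\<lambda>f. f $ k"] by (simp add: fps_compose_linear)
    then have "\<zeta> ^ (j * k) = 1" using that by (simp add: power_mult)
    then have "n dvd j * k" by (simp add: zeta_eq_1)
    then have "d * gcd n j dvd (j div gcd n j * k) * gcd n j"
      using nd by (metis dvd_div_mult_self gcd_dvd2 mult.assoc mult.commute)
    then have "d dvd (j div gcd n j) * k" using g by simp
    moreover have "coprime d (j div gcd n j)" unfolding d_def using g by (intro div_gcd_coprime) auto
    ultimately show "d dvd k" by (simp add: coprime_dvd_mult_right_iff)
  qed
  obtain r B where r: "0 < r" "y holomorphic_on ball 0 r" using local_hol_bound[OF y(1) y(1)] by metis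
  obtain q where q: "q holomorphic_on ball 0 (r ^ d)" "\<And>t. t \<in> ball 0 r \<Longrightarrow> q (t ^ d) = y t"
    using power_substitution[OF r(2,1) y(1) _ supp] d2 by auto
  have "q analytic_on {0}" using q(1) r(1) by (auto simp: analytic_at intro!: exI[of _ "ball 0 (r ^ d)"])
  then obtain Q where Q: "q has_fps_expansion Q" using analytic_at_imp_has_fps_expansion_0 by blast
  have "q 0 = 0" using q(2)[of 0] r(1) d2 has_fps_expansion_imp_0_eq_fps_nth_0[OF y(1)] y(2)
    by (simp add: power_0_left)
  then have "Q $ 0 = 0" using has_fps_expansion_imp_0_eq_fps_nth_0[OF Q] by simp
  then have "param (par (gcd n j) q)" using par_param[OF g(1) Q] by simp
  moreover have "\<forall>\<^sub>F t in nhds 0. par n y t = par (gcd n j) q (t ^ d)"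
  proof (rule eventually_mono[OF eventually_nhds_in_open[OF open_ball]])
    fix t :: complex assume t: "t \<in> ball 0 r"
    have "t ^ n = (t ^ d) ^ gcd n j" using nd by (metis power_mult)
    then show "par n y t = par (gcd n j) q (t ^ d)" using q(2)[OF t] by (simp add: par_def)
  qed (use r(1) in simp)
  ultimately show False using prim d2 unfolding primitive_def by blast
qed

text \<open>The bound is the order of the product of the differences between \<open>y\<close> and
  its other conjugates. A series \<open>f\<close> of at least this order is the product times some
  \<open>g\<close>, and the interpolation expression for \<open>g\<close>, evaluated at
  \<open>Y = y t\<close>, returns \<open>f\<close>.\<close>

theorem finite_determinacy:
  assumes n: "0 < n" and prim: "primitive (par n y)" and y: "y has_fps_expansion Y" "Y $ 0 = 0"
  shows "\<exists>N. \<forall>(f :: complex \<Rightarrow> complex) F. f has_fps_expansion F \<longrightarrow> fps_X ^ N dvd F \<longrightarrow>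
    (\<exists>h. analytic2 h \<and> (\<forall>\<^sub>F t in nhds 0. f t = h (par n y t)))"
proof -
  obtain \<zeta> where rz: "root_of_unity n \<zeta>" using root_of_unity_exists[OF n] .
  interpret root_of_unity n \<zeta> by (rule rz)
  define \<Delta> where "\<Delta> t = (\<Prod>j\<in>{1..<n}. y t - y (\<zeta> ^ j * t))" for t
  define DF where "DF = (\<Prod>j\<in>{1..<n}. Y - (Y oo (fps_const (\<zeta> ^ j) * fps_X)))"
  have conj: "(\<lambda>t. y (\<zeta> ^ j * t)) has_fps_expansion (Y oo (fps_const (\<zeta> ^ j) * fps_X))" for j
  proof -
    have "(\<lambda>t. \<zeta> ^ j * t) has_fps_expansion fps_const (\<zeta> ^ j) * fps_X"
      by (intro has_fps_expansion_cmult_left has_fps_expansion_fps_X)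
    then have "(y \<circ> (\<lambda>t. \<zeta> ^ j * t)) has_fps_expansion (Y oo (fps_const (\<zeta> ^ j) * fps_X))"
      by (rule has_fps_expansion_compose[OF y(1)]) simp
    then show ?thesis by (simp add: o_def)
  qed
  have D: "\<Delta> has_fps_expansion DF" unfolding \<Delta>_def DF_def
    by (intro has_fps_expansion_prod has_fps_expansion_diff y conj)
  have D0: "DF \<noteq> 0" unfolding DF_def
  proof (subst prod_zero_iff, simp, intro notI)
    assume "\<exists>j\<in>{1..<n}. Y - (Y oo (fps_const (\<zeta> ^ j) * fps_X)) = 0"
    then show False using primitive_conjugates[OF prim y rz] by auto
  qed
  show ?thesis
  proof (intro exI[of _ "subdegree DF"] allI impI)
    fix f :: "complex \<Rightarrow> complex" and F
    assume f: "f has_fps_expansion F" and F: "fps_X ^ subdegree DF dvd F"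
    show "\<exists>h. analytic2 h \<and> (\<forall>\<^sub>F t in nhds 0. f t = h (par n y t))"
    proof (cases "F = 0")
      case True
      then have "\<forall>\<^sub>F t in nhds 0. f t = 0" using f by (simp add: has_fps_expansion_0_iff)
      then show ?thesis using analytic2_const[of 0] by (intro exI[of _ "\<lambda>_. 0"]) auto
    next
      case False
      have sub: "subdegree DF \<le> subdegree F" using F False by (intro subdegree_geI) (auto simp: X_pow_dvd_iff)
      define g where "g = (\<lambda>t. if t = 0 then F $ subdegree DF / DF $ subdegree DF else f t / \<Delta> t)"
      have g: "g has_fps_expansion F / DF"
        unfolding g_def by (rule has_fps_expansion_divide[OF f D sub D0 refl])
      have "F / DF * DF = F" using sub D0 False by (simp add: fps_dvd_iff)
      then have "(\<lambda>t. g t * \<Delta> t) has_fps_expansion F" using has_fps_expansion_mult[OF g D] by simp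
      then have e: "\<forall>\<^sub>F t in nhds 0. f t = g t * \<Delta> t" by (rule expansion_eventually_eq[OF f])
      obtain r B where r: "0 < r" "y holomorphic_on ball 0 r" "g holomorphic_on ball 0 r"
        "\<And>t. t \<in> ball 0 r \<Longrightarrow> norm (y t) \<le> B" "\<And>t. t \<in> ball 0 r \<Longrightarrow> norm (g t) \<le> B"
        using local_hol_bound[OF y(1) g] by metis
      obtain h where h: "analytic2 h" "\<And>t Y. t \<in> ball 0 r \<Longrightarrow> h (t ^ n, Y) = lagrange y g t Y"
        using lagrange_descends[OF r] by blast
      have "\<forall>\<^sub>F t in nhds (0 :: complex). t \<in> ball 0 r" using r(1) by (intro eventually_nhds_in_open) auto
      then have "\<forall>\<^sub>F t in nhds 0. f t = h (par n y t)"
        using e by eventually_elim (simp add: par_def h(2) lagrange_interpolates \<Delta>_def)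
      then show ?thesis using h(1) by blast
    qed
  qed
qed

section \<open>Normal forms\<close>

lemma pev_restrict:
  obtains c' where "supp_le N c'" "\<And>F G. pev c' N F G = pev c N F G"
proof -
  define c' where "c' = (\<lambda>i j. if i \<le> N \<and> j \<le> N then c i j else 0)"
  have "supp_le N c'" by (auto simp: supp_le_def c'_def)
  moreover have "pev c' N F G = pev c N F G" for F G
    unfolding pev_def c'_def by (intro sum.cong refl) auto
  ultimately show ?thesis by (rule that)
qed

lemma wts_cmult: "wts n m w c \<Longrightarrow> wts n m w (\<lambda>i j. k * c i j)" for c :: "nat \<Rightarrow> nat \<Rightarrow> complex"
  by (auto simp: wts_def)

lemma subdegreeI':
  assumes "fps_X ^ k dvd (f :: complex fps)" "f $ k \<noteq> 0"
  shows "f \<noteq> 0" "subdegree f = k"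
  using assms by (auto simp: X_pow_dvd_iff intro!: subdegreeI)

lemma subdegree_dvd: "fps_X ^ k dvd (f :: complex fps)" if "k \<le> subdegree f"
  using that unfolding X_pow_dvd_iff by (meson less_le_trans nth_less_subdegree_zero)

lemma valF_add:
  assumes "p \<in> valF n Y" "q \<in> valF n Y"
  shows "p + q \<in> valF n Y"
proof -
  obtain c N where c: "pev c N (fps_X ^ n) Y \<noteq> 0" "p = subdegree (pev c N (fps_X ^ n) Y)" using assms(1) by (auto simp: valF_def)
  obtain d M where d: "pev d M (fps_X ^ n) Y \<noteq> 0" "q = subdegree (pev d M (fps_X ^ n) Y)" using assms(2) by (auto simp: valF_def)
  have "pev c N (fps_X ^ n) Y * pev d M (fps_X ^ n) Y \<in> palg (fps_X ^ n) Y"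
    by (intro palg_closed(2)) (auto simp: palg_iff)
  then obtain e K where e: "pev c N (fps_X ^ n) Y * pev d M (fps_X ^ n) Y = pev e K (fps_X ^ n) Y" unfolding palg_iff by blast
  have "pev e K (fps_X ^ n) Y \<noteq> 0" "subdegree (pev e K (fps_X ^ n) Y) = p + q"
    using c d by (simp_all flip: e)
  then show ?thesis unfolding valF_def by force
qed

lemma Sg_subset_valF:
  assumes Y: "fps_X ^ m dvd Y" "Y $ m \<noteq> 0"
  shows "Sg n m \<subseteq> valF n Y"
proof
  fix p assume "p \<in> Sg n m"
  then obtain i j where p: "p = n * i + m * j" by (auto simp: Sg_def)
  have e: "pev (single i j 1) (max i j) (fps_X ^ n) Y = (fps_X ^ n) ^ i * Y ^ j"
    by (subst pev_single) auto
  have "Y \<noteq> 0" "subdegree Y = m" using subdegreeI'[OF Y] by auto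
  then have "(fps_X ^ n) ^ i * Y ^ j \<noteq> 0" "subdegree ((fps_X ^ n) ^ i * Y ^ j) = p"
    by (auto simp: p subdegree_power mult.commute)
  note w = this
  show "p \<in> valF n Y" unfolding valF_def
    by (intro CollectI exI[of _ "single i j 1"] exI[of _ "max i j"]) (simp only: e w, simp)
qed

text \<open>Realises a value of a function by an exact differential. The truncation degree can be
  pushed above any \<open>K\<close>, which \<open>low_weights\<close> asks for.\<close>

lemma exact_value:
  assumes "l \<in> valF n Y" "0 < l"
  obtains c N where "supp_le N c" "K \<le> N" "subdegree (pev c N (fps_X ^ n) Y) = l" "pev c N (fps_X ^ n) Y \<noteq> 0"
    "fps_X ^ (l - 1) dvd Wser n Y (\<lambda>i j. - dY c i j) (dX c) N"
    "Wser n Y (\<lambda>i j. - dY c i j) (dX c) N $ (l - 1) \<noteq> 0"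
proof -
  obtain c0 N0 where c0: "pev c0 N0 (fps_X ^ n) Y \<noteq> 0" "l = subdegree (pev c0 N0 (fps_X ^ n) Y)"
    using assms(1) by (auto simp: valF_def)
  obtain c where c: "supp_le N0 c" "\<And>F G. pev c N0 F G = pev c0 N0 F G" by (rule pev_restrict) blast
  define N where "N = max K N0"
  have e: "pev c N (fps_X ^ n) Y = pev c0 N0 (fps_X ^ n) Y"
    using pev_extend'[OF c(1), of N] c(2) by (simp add: N_def)
  have s: "supp_le N c" using c(1) by (auto simp: supp_le_def N_def le_max_iff_disj)
  define h where "h = pev c N (fps_X ^ n) Y"
  have h: "h \<noteq> 0" "subdegree h = l" using c0 e by (auto simp: h_def)
  have W: "Wser n Y (\<lambda>i j. - dY c i j) (dX c) N = fps_deriv h" unfolding h_def by (rule Wser_exact[OF s])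
  have "fps_X ^ l dvd h" using h(2) by (intro subdegree_dvd) simp
  then have "fps_X ^ (l - 1) dvd fps_deriv h" by (rule dvd_deriv)
  moreover have "h $ l \<noteq> 0" using h by (metis nth_subdegree_nonzero)
  then have "fps_deriv h $ (l - 1) \<noteq> 0" using assms(2) by simp
  ultimately show ?thesis using that[OF s, unfolded W] h by (simp add: h_def N_def)
qed

lemma valF_subset_dvalF:
  assumes "l \<in> valF n Y" "0 < l"
  shows "l \<in> dvalF n Y"
proof -
  obtain c N where c: "fps_X ^ (l - 1) dvd Wser n Y (\<lambda>i j. - dY c i j) (dX c) N"
    "Wser n Y (\<lambda>i j. - dY c i j) (dX c) N $ (l - 1) \<noteq> 0"
    using exact_value[OF assms, of 0] by metis
  have "l = Suc (subdegree (Wser n Y (\<lambda>i j. - dY c i j) (dX c) N))"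
    using subdegreeI'[OF c] assms(2) by simp
  then show ?thesis unfolding dvalF_def using subdegreeI'(1)[OF c] by blast
qed

lemma dvalF_ge:
  assumes "l \<in> dvalF n Y" "0 < n" "n \<le> m" "fps_X ^ m dvd Y"
  shows "n \<le> l"
proof -
  obtain a b N where *: "Wser n Y a b N \<noteq> 0" "l = Suc (subdegree (Wser n Y a b N))"
    using assms(1) by (auto simp: dvalF_def)
  have "fps_X ^ (n - 1) dvd fps_deriv Y" using dvd_deriv[OF assms(4)] assms(3) by (auto elim: X_pow_dvd_mono)
  then have "fps_X ^ (n - 1) dvd Wser n Y a b N" unfolding Wser_def mult.assoc
    by (intro dvd_diff dvd_mult[of _ _ "of_nat n"] dvd_mult2 dvd_mult dvd_refl)
  then have "n - 1 \<le> subdegree (Wser n Y a b N)"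
    using *(1) by (intro subdegree_geI) (auto simp: X_pow_dvd_iff)
  then show ?thesis using *(2) by simp
qed

lemma least_value:
  assumes n: "0 < n" "n \<le> m" and Y: "fps_X ^ m dvd Y" "Y $ m \<noteq> 0"
  shows "(LEAST k. k \<in> valF n Y \<and> 0 < k) = n"
proof (rule Least_equality)
  show "n \<in> valF n Y \<and> 0 < n" using Sg_subset_valF[OF Y, of n] Sg_base n by blast
  fix k assume "k \<in> valF n Y \<and> 0 < k"
  then show "n \<le> k" using dvalF_ge[OF valF_subset_dvalF n Y(1)] by blast
qed

section \<open>Elimination of single coefficients\<close>

locale branch =
  fixes n m :: nat
  assumes nm: "0 < n" "n < m" "\<not> n dvd m"
begin

definition good :: "(complex \<Rightarrow> complex) \<Rightarrow> complex fps \<Rightarrow> bool" where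
  "good y Y \<longleftrightarrow> y has_fps_expansion Y \<and> fps_X ^ m dvd Y \<and> Y $ m = 1"

lemma goodD: "good y Y \<Longrightarrow> y has_fps_expansion Y" "good y Y \<Longrightarrow> fps_X ^ m dvd Y" "good y Y \<Longrightarrow> Y $ m = 1"
  "good y Y \<Longrightarrow> Y $ 0 = 0"
  using nm by (auto simp: good_def X_pow_dvd_iff)

lemma good_values:
  assumes "good y Y" "good z Z" "A_equiv (par n y) (par n z)"
  shows "valF n Z = valF n Y" "dvalF n Z = dvalF n Y"
  using values_equiv[OF assms(3) nm(1) nm(1) goodD(1,4)[OF assms(1)] goodD(1,4)[OF assms(2)]] .

lemma good_cong:
  assumes "good y Y" "z has_fps_expansion Z" "fps_X ^ k dvd Z - Y" "m < k"
  shows "good z Z"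
proof -
  have e: "Z $ i = Y $ i" if "i \<le> m" for i using assms(3,4) that by (auto simp: X_pow_dvd_iff)
  then show ?thesis using assms(1,2) by (auto simp: good_def X_pow_dvd_iff)
qed

text \<open>The form depends linearly on the field, so a scalar multiple of the field moves the
  coefficient at \<open>k\<close> to any prescribed value while the earlier ones stay.\<close>

lemma change_coefficient:
  assumes y: "good y Y" and k: "m < k" and a: "wts n m (n + 1) a" and b: "wts n m (m + 1) b"
    and W: "fps_X ^ (k + n - 1) dvd Wser n Y a b N" "Wser n Y a b N $ (k + n - 1) \<noteq> 0"
  obtains z Z where "good z Z" "A_equiv (par n y) (par n z)" "fps_X ^ k dvd Z - Y" "Z $ k = c"
proof -
  define s where "s = (c - Y $ k) * of_nat n / Wser n Y a b N $ (k + n - 1)"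
  have Ws: "Wser n Y (\<lambda>i j. s * a i j) (\<lambda>i j. s * b i j) N = fps_const s * Wser n Y a b N" by (rule Wser_cmult)
  have d: "fps_X ^ (k + n - 1) dvd Wser n Y (\<lambda>i j. s * a i j) (\<lambda>i j. s * b i j) N"
    unfolding Ws using W(1) by (rule dvd_mult)
  have mk: "m \<le> k" using k by simp
  obtain z Z where z: "z has_fps_expansion Z" "A_equiv (par n y) (par n z)" "fps_X ^ k dvd Z - Y"
    "Z $ k = Y $ k + Wser n Y (\<lambda>i j. s * a i j) (\<lambda>i j. s * b i j) N $ (k + n - 1) / of_nat n"
    by (rule eliminate_coefficient[OF nm(1,2) goodD(1,2)[OF y] wts_cmult[OF a] wts_cmult[OF b] mk d])
  have "Z $ k = c" unfolding z(4) Ws using W(2) nm(1) by (simp add: s_def)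
  then show ?thesis using that good_cong[OF y z(1,3) k] z(2,3) by blast
qed

text \<open>An exact differential does it: since \<open>k > m\<close>, the function has order above
  \<open>n + m\<close>, so the field raises weights.\<close>

lemma change_semigroup_coefficient:
  assumes y: "good y Y" and k: "m < k" "k + n \<in> valF n Y"
  obtains z Z where "good z Z" "A_equiv (par n y) (par n z)" "fps_X ^ k dvd Z - Y" "Z $ k = c"
proof -
  have pos: "0 < k + n" using nm by simp
  obtain h N where h: "supp_le N h" "n + m \<le> N" "subdegree (pev h N (fps_X ^ n) Y) = k + n" "pev h N (fps_X ^ n) Y \<noteq> 0"
    "fps_X ^ (k + n - 1) dvd Wser n Y (\<lambda>i j. - dY h i j) (dX h) N"
    "Wser n Y (\<lambda>i j. - dY h i j) (dX h) N $ (k + n - 1) \<noteq> 0"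
    by (rule exact_value[OF k(2) pos, of "n + m"])
  have "fps_X ^ Suc (n + m) dvd pev h N (fps_X ^ n) Y" using h(3) k(1) by (intro subdegree_dvd) simp
  note w = exact_unipotent[OF nm goodD(2,3)[OF y] h(1,2) this]
  show ?thesis by (rule change_coefficient[OF y k(1) w h(5,6)]) (rule that)
qed

text \<open>Beyond \<open>L\<close> any differential of value \<open>k + n\<close> will do, because
  \<open>large_value_unipotent\<close> shows that its field raises weights.\<close>

lemma change_large_coefficient:
  assumes y: "good y Y" and L: "fps_X ^ L dvd Y - fps_X ^ m" "m < L" "Y $ L \<noteq> 0" "L + n \<notin> Sg n m"
    and k: "L < k" "k + n \<in> dvalF n Y"
  obtains z Z where "good z Z" "A_equiv (par n y) (par n z)" "fps_X ^ k dvd Z - Y" "Z $ k = c"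
proof -
  obtain a0 b0 N0 where *: "Wser n Y a0 b0 N0 \<noteq> 0" "k + n = Suc (subdegree (Wser n Y a0 b0 N0))"
    using k(2) by (auto simp: dvalF_def)
  obtain a where a: "supp_le N0 a" "\<And>F G. pev a N0 F G = pev a0 N0 F G" by (rule pev_restrict) blast
  obtain b where b: "supp_le N0 b" "\<And>F G. pev b N0 F G = pev b0 N0 F G" by (rule pev_restrict) blast
  define N where "N = max N0 (n + m)"
  have "Wser n Y a b N = Wser n Y a0 b0 N0"
    using pev_extend'[OF a(1), of N] pev_extend'[OF b(1), of N] a(2) b(2) by (simp add: Wser_def N_def)
  then have W: "Wser n Y a b N \<noteq> 0" "subdegree (Wser n Y a b N) = k + n - 1" using * by auto
  have 1: "fps_X ^ (k + n - 1) dvd Wser n Y a b N" using W(2) by (intro subdegree_dvd) simp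
  have 2: "Wser n Y a b N $ (k + n - 1) \<noteq> 0" using W by (metis nth_subdegree_nonzero)
  have "fps_X ^ (L + n) dvd Wser n Y a b N" using 1 k(1) by (auto elim: X_pow_dvd_mono)
  then have w: "wts n m (n + 1) a" "wts n m (m + 1) b"
    using large_value_unipotent[OF nm L(1,2,3,4), of a b N] by (auto simp: N_def)
  have mk: "m < k" using L(2) k(1) by simp
  show ?thesis by (rule change_coefficient[OF y mk w 1 2]) (rule that)
qed

text \<open>The Euler form annihilates \<open>t ^ m\<close>, so it begins with the first further
  term of \<open>y\<close>.\<close>

lemma first_exponent_value:
  assumes K: "fps_X ^ K dvd Y - fps_X ^ m" "m < K" "Y $ K \<noteq> 0"
  shows "K + n \<in> dvalF n Y"
proof -
  define W where "W = Wser n Y (single 1 0 (of_nat n)) (single 0 1 (of_nat m)) 1"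
  have c: "W $ (q + n - 1) = of_nat n * (of_nat m - of_nat q) * Y $ q" for q
    unfolding W_def by (rule Wser_euler[OF nm(1)]) simp
  have "fps_X ^ (K + n - 1) dvd W" unfolding X_pow_dvd_iff
  proof (intro allI impI)
    fix i assume i: "i < K + n - 1"
    have Ym: "fps_X ^ m dvd Y" using near_dvd[OF K(1)] K(2) by simp
    show "W $ i = 0"
    proof (cases "i < n - 1")
      case True
      have "fps_X ^ (n - 1) dvd fps_deriv Y" using dvd_deriv[OF Ym] nm by (auto elim: X_pow_dvd_mono)
      then have "fps_X ^ (n - 1) dvd W" unfolding W_def Wser_def mult.assoc
        by (intro dvd_diff dvd_mult[of _ _ "of_nat n"] dvd_mult2 dvd_mult dvd_refl)
      then show ?thesis using True unfolding X_pow_dvd_iff by blast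
    next
      case False
      then obtain q where q: "i = q + n - 1" using nm by (metis add.commute le_add_diff_inverse2 not_less Nat.add_diff_assoc One_nat_def Suc_leI)
      have "q < K" using i q nm by simp
      then have "q = m \<or> Y $ q = 0" using K(1) by (auto simp: X_pow_dvd_iff)
      then show ?thesis unfolding q c by auto
    qed
  qed
  moreover have "W $ (K + n - 1) \<noteq> 0" unfolding c using K nm by simp
  ultimately have "W \<noteq> 0" "subdegree W = K + n - 1" by (rule subdegreeI')+
  then have "K + n = Suc (subdegree W)" using nm by simp
  then show ?thesis using \<open>W \<noteq> 0\<close> unfolding dvalF_def W_def by blast
qed

lemma A_equiv_refl: "A_equiv (par n y) (par n y)"
  using A_equiv_scale[of 1 y 0 y n] by simp

text \<open>The first exponent \<open>K\<close> at which the curve departs from the monomial one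
  always makes \<open>K + n\<close> a value of a differential. As long as such values lie in the
  semigroup, the coefficient can be removed by an exact differential.\<close>

lemma first_stage:
  assumes y: "good y Y" and K: "m < K"
    and vals: "\<And>l. m < l \<Longrightarrow> l < K \<Longrightarrow> l + n \<in> dvalF n Y \<Longrightarrow> l + n \<in> valF n Y"
  shows "\<exists>z Z. good z Z \<and> A_equiv (par n y) (par n z) \<and> fps_X ^ K dvd Z - fps_X ^ m"
  using Suc_leI[OF K] vals
proof (induction K rule: dec_induct)
  case base
  have "fps_X ^ Suc m dvd Y - fps_X ^ m"
    using goodD(2,3)[OF y] unfolding X_pow_dvd_iff by (auto simp: less_Suc_eq)
  then show ?case using y A_equiv_refl by blast
next
  case (step K)
  then obtain z Z where z: "good z Z" "A_equiv (par n y) (par n z)" "fps_X ^ K dvd Z - fps_X ^ m"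
    by (meson less_SucI)
  have K: "m < K" using step by simp
  show ?case
  proof (cases "Z $ K = 0")
    case True
    then have "fps_X ^ Suc K dvd Z - fps_X ^ m" using z(3) K unfolding X_pow_dvd_iff by (auto simp: less_Suc_eq)
    with z show ?thesis by blast
  next
    case False
    have "K + n \<in> dvalF n Z" using first_exponent_value[OF z(3) K False] .
    then have "K + n \<in> valF n Z" using step(4)[OF K] good_values[OF y z(1,2)] by simp
    then obtain x X where x: "good x X" "A_equiv (par n z) (par n x)" "fps_X ^ K dvd X - Z" "X $ K = 0"
      using change_semigroup_coefficient[OF z(1) K] by metis
    have "fps_X ^ Suc K dvd X - fps_X ^ m"
      using x(3,4) z(3) K unfolding X_pow_dvd_iff by (auto simp: less_Suc_eq)
    then show ?thesis using x A_equiv_trans[OF z(2) x(2)] by blast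
  qed
qed

lemma rescale:
  assumes y: "good y Y" and r: "r \<noteq> 0"
  obtains z Z where "good z Z" "A_equiv (par n y) (par n z)" "\<And>i. Z $ i = r ^ m / r ^ i * Y $ i"
proof -
  define z where "z = (\<lambda>t. r ^ m * y (inverse r * t))"
  define Z where "Z = fps_const (r ^ m) * (Y oo (fps_const (inverse r) * fps_X))"
  have "(\<lambda>t. inverse r * t) has_fps_expansion fps_const (inverse r) * fps_X"
    by (intro has_fps_expansion_cmult_left has_fps_expansion_fps_X)
  then have "(y \<circ> (\<lambda>t. inverse r * t)) has_fps_expansion (Y oo (fps_const (inverse r) * fps_X))"
    by (rule has_fps_expansion_compose[OF goodD(1)[OF y]]) simp
  then have Z: "z has_fps_expansion Z" unfolding z_def Z_def o_def by (rule has_fps_expansion_cmult_left)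
  have c: "Z $ i = r ^ m / r ^ i * Y $ i" for i
    unfolding Z_def fps_compose_linear by (simp add: power_inverse field_simps)
  have "good z Z" using Z goodD(2,3)[OF y] r by (auto simp: good_def c X_pow_dvd_iff)
  moreover have "A_equiv (par n y) (par n z)" by (rule A_equiv_scale[OF r, where m = m]) (use r in \<open>simp add: z_def flip: mult.assoc\<close>)
  ultimately show ?thesis using that c by blast
qed

text \<open>The terms up to \<open>L\<close> are never touched and the set of values is invariant,
  so \<open>change_large_coefficient\<close> remains applicable after each removal.\<close>

lemma second_stage:
  assumes y: "good y Y" and L: "fps_X ^ L dvd Y - fps_X ^ m" "m < L" "Y $ L = 1" "L + n \<notin> Sg n m" and K: "L < K"
  shows "\<exists>z Z. good z Z \<and> A_equiv (par n y) (par n z) \<and> fps_X ^ Suc L dvd Z - Y \<and>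
    (\<forall>i. L < i \<longrightarrow> i < K \<longrightarrow> i + n \<in> dvalF n Y \<longrightarrow> Z $ i = 0)"
  using Suc_leI[OF K]
proof (induction K rule: dec_induct)
  case base
  have "fps_X ^ Suc L dvd Y - Y" by simp
  then show ?case using y A_equiv_refl by (intro exI[of _ y] exI[of _ Y]) simp
next
  case (step K)
  then obtain z Z where z: "good z Z" "A_equiv (par n y) (par n z)" "fps_X ^ Suc L dvd Z - Y"
    "\<And>i. L < i \<Longrightarrow> i < K \<Longrightarrow> i + n \<in> dvalF n Y \<Longrightarrow> Z $ i = 0" by blast
  have K: "L < K" using step by simp
  show ?case
  proof (cases "K + n \<in> dvalF n Y")
    case False
    then show ?thesis using z by (metis less_Suc_eq)
  next
    case True
    have eq: "Z $ i = Y $ i" if "i \<le> L" for i using z(3) that unfolding X_pow_dvd_iff by simp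
    have "fps_X ^ L dvd Z - fps_X ^ m" using L(1) eq by (auto simp: X_pow_dvd_iff)
    moreover have "Z $ L \<noteq> 0" using eq[of L] L(3) by simp
    moreover have "K + n \<in> dvalF n Z" using True good_values[OF y z(1,2)] by simp
    ultimately obtain x X where x: "good x X" "A_equiv (par n z) (par n x)" "fps_X ^ K dvd X - Z" "X $ K = 0"
      using change_large_coefficient[OF z(1) _ L(2) _ L(4) K] by metis
    have e: "X $ i = Z $ i" if "i < K" for i using x(3) that unfolding X_pow_dvd_iff by simp
    have "fps_X ^ Suc L dvd X - Y" using e eq K unfolding X_pow_dvd_iff by auto
    moreover have "X $ i = 0" if "L < i" "i < Suc K" "i + n \<in> dvalF n Y" for i
      using that e z(4) x(4) less_Suc_eq by metis
    ultimately show ?thesis using x A_equiv_trans[OF z(2) x(2)] by blast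
  qed
qed

end

text \<open>Finite determinacy as a property of a curve. Its bound is transported along
  equivalences, so the number of elimination steps can be fixed before the curve is moved.\<close>

definition determined :: "(complex \<Rightarrow> complex \<times> complex) \<Rightarrow> nat \<Rightarrow> bool" where
  "determined \<phi> N \<longleftrightarrow> (\<forall>(f :: complex \<Rightarrow> complex) F. f has_fps_expansion F \<longrightarrow> fps_X ^ N dvd F \<longrightarrow>
    (\<exists>h. analytic2 h \<and> (\<forall>\<^sub>F t in nhds 0. f t = h (\<phi> t))))"

text \<open>Reparametrization does not lower the order of \<open>f\<close>, and the inverse
  automorphism of the plane carries the germ \<open>h\<close> along, so the bound itself is
  kept.\<close>

lemma determined_equiv:
  assumes d: "determined \<phi> N" and p: "param \<phi>" and eq: "A_equiv \<phi> \<psi>"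
  shows "determined \<psi> N"
  unfolding determined_def
proof (intro allI impI)
  fix f :: "complex \<Rightarrow> complex" and F assume f: "f has_fps_expansion F" and F: "fps_X ^ N dvd F"
  obtain s r where 1: "aut2 s" "aut1 r" "\<forall>\<^sub>F t in nhds 0. \<psi> (r t) = s (\<phi> t)"
    using eq unfolding A_equiv_def by blast
  obtain R where R: "r has_fps_expansion R" "R $ 0 = 0" using aut1_expansion[OF 1(2)] by blast
  obtain t where t: "analytic2 (fst \<circ> t)" "analytic2 (snd \<circ> t)" "t (0, 0) = (0, 0)"
    "\<forall>\<^sub>F p in nhds (0, 0). t (s p) = p" using 1(1) unfolding aut2_def by blast
  obtain q where q: "analytic1 q" "q 0 = 0" "\<forall>\<^sub>F t in nhds 0. r (q t) = t" using 1(2) unfolding aut1_def by blast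
  have "(f \<circ> r) has_fps_expansion (F oo R)" by (rule has_fps_expansion_compose[OF f R])
  moreover have "fps_X ^ N dvd F oo R" by (rule compose_dvd[OF F X_dvd_iff[THEN iffD2, OF R(2)]])
  ultimately obtain h where h: "analytic2 h" "\<forall>\<^sub>F t in nhds 0. (f \<circ> r) t = h (\<phi> t)"
    using d unfolding determined_def by blast
  have "\<forall>\<^sub>F u in nhds 0. t (s (\<phi> u)) = \<phi> u"
    using param_tendsto[OF p] t(4) unfolding filterlim_iff by blast
  then have "\<forall>\<^sub>F u in nhds 0. f (r u) = h (t (\<psi> (r u)))"
    using h(2) 1(3) by eventually_elim simp
  moreover have "filterlim q (nhds 0) (nhds 0)" using analytic1_tendsto[OF q(1)] q(2) by simp
  ultimately have "\<forall>\<^sub>F u in nhds 0. f (r (q u)) = h (t (\<psi> (r (q u))))" unfolding filterlim_iff by blast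
  then have "\<forall>\<^sub>F u in nhds 0. f u = (h \<circ> t) (\<psi> u)" using q(3) by eventually_elim simp
  then show "\<exists>h. analytic2 h \<and> (\<forall>\<^sub>F t in nhds 0. f t = h (\<psi> t))"
    using analytic2_map_comp[OF h(1) t(1-3)] by blast
qed

lemma determined_values:
  assumes d: "determined (par n y) N" and n: "0 < n" and y: "y has_fps_expansion Y" "Y $ 0 = 0" and l: "N \<le> l"
  shows "l \<in> valF n Y"
proof -
  have "fps_X ^ N dvd (fps_X ^ l :: complex fps)" using l by (rule le_imp_power_dvd)
  then obtain h where h: "analytic2 h" "\<forall>\<^sub>F t in nhds 0. t ^ l = h (par n y t)"
    using d X_pow_expansion[of l] unfolding determined_def by blast
  have e: "(\<lambda>t. h (par n y t)) has_fps_expansion fps_X ^ l"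
    using has_fps_expansion_cong[OF h(2) refl] X_pow_expansion by blast
  have "\<not> zero_germ (\<lambda>t. h (par n y t))" "ordt (\<lambda>t. h (par n y t)) = l"
    using zero_germ_iff[OF e] ordt_eq[OF e] by auto
  then have "l \<in> vals (par n y)" unfolding vals_def using h(1) by blast
  then show ?thesis using vals_par[OF n y] by simp
qed

section \<open>Existence and uniqueness of the form\<close>

lemma zform_par:
  "zform n m S L b = par n (\<lambda>t. t ^ m + t ^ L + (\<Sum>i\<in>zidx n S L. b i * t ^ i))"
  by (simp add: zform_def par_def fun_eq_iff)

lemma expansion_sum_powers:
  "(\<lambda>t. \<Sum>i\<in>S. b i * t ^ i) has_fps_expansion (\<Sum>i\<in>S. fps_const (b i) * fps_X ^ i :: complex fps)"
  by (intro has_fps_expansion_sum has_fps_expansion_cmult_left X_pow_expansion)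

lemma sum_powers_nth:
  assumes "finite S"
  shows "(\<Sum>i\<in>S. fps_const (b i) * fps_X ^ i :: complex fps) $ k = (if k \<in> S then b k else 0)"
proof -
  have "(\<Sum>i\<in>S. fps_const (b i) * fps_X ^ i :: complex fps) $ k = (\<Sum>i\<in>S. if i = k then b i else 0)"
    unfolding fps_sum_nth by (intro sum.cong refl) auto
  then show ?thesis using assms by simp
qed

context branch
begin

lemma par_values:
  assumes "good y Y"
  shows "vals (par n y) = valF n Y" "dvals (par n y) = dvalF n Y" "gen0 (par n y) = n"
proof -
  show v: "vals (par n y) = valF n Y" by (rule vals_par[OF nm(1) goodD(1,4)[OF assms]])
  show "dvals (par n y) = dvalF n Y" by (rule dvals_par[OF nm(1) goodD(1,4)[OF assms]])
  show "gen0 (par n y) = n" unfolding gen0_def v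
    using least_value[OF nm(1) _ goodD(2)[OF assms]] goodD(3)[OF assms] nm by simp
qed

lemma zariski_invariant:
  assumes y: "good y Y" and ne: "dvalF n Y - valF n Y \<noteq> {}" and L: "L = zariski (par n y)"
  shows "m < L" "L + n \<in> dvalF n Y" "L + n \<notin> valF n Y"
    "\<And>l. l < L \<Longrightarrow> l + n \<in> dvalF n Y \<Longrightarrow> l + n \<in> valF n Y"
proof -
  define M where "M = (LEAST l. l \<in> dvalF n Y \<and> l \<notin> valF n Y)"
  have M: "M \<in> dvalF n Y" "M \<notin> valF n Y"
    using ne LeastI_ex[of "\<lambda>l. l \<in> dvalF n Y \<and> l \<notin> valF n Y"] unfolding M_def by auto
  \<comment> \<open>Every value of a differential is at least \<open>n\<close>, so the truncated
    subtraction in \<open>zariski\<close> is exact.\<close>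
  have "n \<le> M" using dvalF_ge[OF M(1) nm(1) _ goodD(2)[OF y]] nm by simp
  then have MLn: "M = L + n" unfolding L zariski_def par_values[OF y] M_def by simp
  show d: "L + n \<in> dvalF n Y" "L + n \<notin> valF n Y" using M MLn by auto
  show "l + n \<in> valF n Y" if "l < L" "l + n \<in> dvalF n Y" for l
    using not_less_Least[of "l + n" "\<lambda>l. l \<in> dvalF n Y \<and> l \<notin> valF n Y"] that MLn unfolding M_def by auto
  have Sg: "Sg n m \<subseteq> valF n Y" using Sg_subset_valF[OF goodD(2)[OF y]] goodD(3)[OF y] by simp
  show "m < L"
  proof (rule ccontr)
    assume "\<not> m < L"
    obtain a b N where W: "Wser n Y a b N \<noteq> 0" "L + n = Suc (subdegree (Wser n Y a b N))"
      using d(1) by (auto simp: dvalF_def)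
    have "fps_X ^ Suc m dvd Y - fps_X ^ m"
      using goodD(2,3)[OF y] unfolding X_pow_dvd_iff by (auto simp: less_Suc_eq)
    \<comment> \<open>Agreement with the monomial curve below \<open>Suc m\<close> is automatic and
      already decides all values up to \<open>m + n\<close>.\<close>
    then have "L + n \<in> Sg n m"
      using near_monomial_value[OF nm _ _ W(1), of "Suc m"] W(2) \<open>\<not> m < L\<close> by simp
    then show False using Sg d(2) by blast
  qed
qed

text \<open>Without this term the curve would be monomial to one order more, and
  \<open>near_monomial_value\<close> would put \<open>L + n\<close> into
  \<open>Sg n m\<close>.\<close>

lemma gap_coefficient:
  assumes Y: "fps_X ^ L dvd Y - fps_X ^ m" "m < L" and L: "L + n \<in> dvalF n Y" "L + n \<notin> Sg n m"
  shows "Y $ L \<noteq> 0"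
proof
  assume "Y $ L = 0"
  then have d: "fps_X ^ Suc L dvd Y - fps_X ^ m"
    using Y unfolding X_pow_dvd_iff by (auto simp: less_Suc_eq)
  obtain a b N where W: "Wser n Y a b N \<noteq> 0" "L + n = Suc (subdegree (Wser n Y a b N))"
    using L(1) by (auto simp: dvalF_def)
  have "L + n \<in> Sg n m" using near_monomial_value[OF nm d _ W(1)] W(2) Y(2) by simp
  with L(2) show False by blast
qed

text \<open>All terms from \<open>K\<close> on are changed in one stroke: by determinacy the
  difference is a germ evaluated on the curve, which \<open>remove_tail\<close> subtracts.\<close>

lemma finish_form:
  assumes z: "good z Z" and d: "determined (par n z) K" and K: "m < K"
    and x: "x has_fps_expansion X" "fps_X ^ K dvd Z - X"
  shows "A_equiv (par n z) (par n x)"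
proof -
  have f: "(\<lambda>t. z t - x t) has_fps_expansion Z - X" using goodD(1)[OF z] x(1) by (rule has_fps_expansion_diff)
  obtain h where h: "analytic2 h" "\<forall>\<^sub>F t in nhds 0. z t - x t = h (par n z t)"
    using d f x(2) unfolding determined_def by blast
  have "fps_X ^ Suc m dvd Z - X" using K by (intro X_pow_dvd_mono[OF x(2)]) simp
  from remove_tail[OF nm goodD(1-3)[OF z] h(1) f this h(2)] show ?thesis by simp
qed

lemma determined_mono: "determined \<phi> N \<Longrightarrow> N \<le> K \<Longrightarrow> determined \<phi> K"
  unfolding determined_def by (meson X_pow_dvd_mono)

lemma determined_exists:
  assumes "good y Y" "primitive (par n y)"
  obtains N where "determined (par n y) N"
  using finite_determinacy[OF nm(1) assms(2) goodD(1,4)[OF assms(1)]] unfolding determined_def by blast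

lemma zidx_finite:
  assumes y: "good y Y" and d: "determined (par n y) N"
  shows "zidx n (dvalF n Y) L \<subseteq> {..<N}"
proof
  fix i assume i: "i \<in> zidx n (dvalF n Y) L"
  show "i \<in> {..<N}"
  proof (rule ccontr)
    assume "i \<notin> {..<N}"
    then have "i + n \<in> valF n Y" using determined_values[OF d nm(1) goodD(1,4)[OF y]] by simp
    then have "i + n \<in> dvalF n Y" using valF_subset_dvalF nm(1) by simp
    then show False using i by (simp add: zidx_def)
  qed
qed

theorem normal_form_exists:
  assumes y: "good y Y" and prim: "primitive (par n y)"
  shows "A_equiv (par n y) (\<lambda>t. (t ^ n, t ^ m)) \<or>
    (dvals (par n y) - vals (par n y) \<noteq> {} \<and> finite (zidx n (dvals (par n y)) (zariski (par n y))) \<and>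
     (\<exists>b. A_equiv (par n y) (zform n m (dvals (par n y)) (zariski (par n y)) b)))"
proof -
  obtain N where N: "determined (par n y) N" using determined_exists[OF y prim] .
  have py: "param (par n y)" using par_param[OF nm(1) goodD(1,4)[OF y]] .
  note pv = par_values[OF y]
  show ?thesis
  proof (cases "dvalF n Y - valF n Y = {}")
    case True
    define K where "K = max N (Suc m)"
    have K: "m < K" "N \<le> K" by (auto simp: K_def)
    obtain z Z where z: "good z Z" "A_equiv (par n y) (par n z)" "fps_X ^ K dvd Z - fps_X ^ m"
      using first_stage[OF y K(1)] True by blast
    have "determined (par n z) K" using determined_mono[OF determined_equiv[OF N py z(2)] K(2)] .
    from finish_form[OF z(1) this K(1) X_pow_expansion z(3)] A_equiv_trans[OF z(2)]
    have "A_equiv (par n y) (par n (\<lambda>t. t ^ m))" by blast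
    moreover have "par n (\<lambda>t. t ^ m) = (\<lambda>t. (t ^ n, t ^ m))" by (simp add: par_def fun_eq_iff)
    ultimately show ?thesis by simp
  next
    case False
    define L where "L = zariski (par n y)"
    note L = zariski_invariant[OF y False L_def]
    have Sg: "Sg n m \<subseteq> valF n Y" using Sg_subset_valF[OF goodD(2)[OF y]] goodD(3)[OF y] by simp
    then have LS: "L + n \<notin> Sg n m" using L(3) by blast
    obtain x X where x: "good x X" "A_equiv (par n y) (par n x)" "fps_X ^ L dvd X - fps_X ^ m"
      using first_stage[OF y L(1)] L(4) by blast
    have "L + n \<in> dvalF n X" using L(2) good_values[OF y x(1,2)] by simp
    then have XL: "X $ L \<noteq> 0" by (rule gap_coefficient[OF x(3) L(1) _ LS])
    have "L - m \<noteq> 0" using L(1) by simp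
    \<comment> \<open>\<open>rescale\<close> multiplies the coefficient at \<open>L\<close> by
      \<open>r ^ m / r ^ L\<close>, so this root makes it 1.\<close>
    then obtain r where r: "X $ L = r ^ (L - m)" by (rule exists_complex_root)
    have r0: "r \<noteq> 0" using r XL L(1) by (metis power_0_left zero_less_diff less_numeral_extra(3))
    obtain w W where w: "good w W" "A_equiv (par n x) (par n w)" "\<And>i. W $ i = r ^ m / r ^ i * X $ i"
      by (rule rescale[OF x(1) r0]) blast
    have "r ^ L = r ^ m * r ^ (L - m)" using L(1) by (simp flip: power_add)
    then have WL: "W $ L = 1" unfolding w(3) using r r0 XL by simp
    have wd: "fps_X ^ L dvd W - fps_X ^ m"
      using x(3) r0 unfolding X_pow_dvd_iff by (auto simp: w(3) split: if_splits)
    have yw: "A_equiv (par n y) (par n w)" using A_equiv_trans[OF x(2) w(2)] .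
    define K where "K = max N (Suc L)"
    have K: "L < K" "N \<le> K" by (auto simp: K_def)
    obtain z Z where z: "good z Z" "A_equiv (par n w) (par n z)" "fps_X ^ Suc L dvd Z - W"
      "\<And>i. L < i \<Longrightarrow> i < K \<Longrightarrow> i + n \<in> dvalF n W \<Longrightarrow> Z $ i = 0"
      using second_stage[OF w(1) wd L(1) WL LS K(1)] by blast
    have yz: "A_equiv (par n y) (par n z)" using A_equiv_trans[OF yw z(2)] .
    have dW: "dvalF n W = dvalF n Y" using good_values(2)[OF y w(1) yw] .
    define S where "S = zidx n (dvalF n Y) L"
    have S: "S \<subseteq> {..<N}" unfolding S_def by (rule zidx_finite[OF y N])
    then have fS: "finite S" by (rule finite_subset) simp
    define v where "v = (\<lambda>t. t ^ m + t ^ L + (\<Sum>i\<in>S. Z $ i * t ^ i))"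
    define V where "V = fps_X ^ m + fps_X ^ L + (\<Sum>i\<in>S. fps_const (Z $ i) * fps_X ^ i)"
    have v: "v has_fps_expansion V" unfolding v_def V_def
      by (intro has_fps_expansion_add X_pow_expansion expansion_sum_powers)
    have "fps_X ^ K dvd Z - V" unfolding X_pow_dvd_iff
    proof (intro allI impI)
      fix i assume i: "i < K"
      have V: "V $ i = (if i = m then 1 else 0) + (if i = L then 1 else 0) + (if i \<in> S then Z $ i else 0)" for i
        by (simp add: V_def sum_powers_nth[OF fS])
      have ZW: "Z $ i = W $ i" if "i \<le> L" using z(3) that unfolding X_pow_dvd_iff by simp
      consider "i < L" | "i = L" | "L < i" by linarith
      then show "(Z - V) $ i = 0"
      proof cases
        case 1
        then have "W $ i = (fps_X ^ m :: complex fps) $ i" using wd unfolding X_pow_dvd_iff by simp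
        then show ?thesis using 1 ZW by (auto simp: V S_def zidx_def)
      next
        case 2
        then show ?thesis using L(1) ZW WL by (auto simp: V S_def zidx_def)
      next
        case 3
        then have "Z $ i = 0" if "i \<notin> S" using z(4)[of i] i that by (auto simp: S_def zidx_def dW)
        then show ?thesis using 3 L(1) by (auto simp: V)
      qed
    qed
    moreover have "determined (par n z) K" using determined_mono[OF determined_equiv[OF N py yz] K(2)] .
    moreover have "m < K" using K L(1) by simp
    ultimately have "A_equiv (par n z) (par n v)" using finish_form[OF z(1) _ _ v] by blast
    then have "A_equiv (par n y) (par n v)" using A_equiv_trans[OF yz] by blast
    moreover have "par n v = zform n m (dvals (par n y)) (zariski (par n y)) (\<lambda>i. Z $ i)"
      unfolding zform_par v_def S_def pv L_def ..
    ultimately show ?thesis using False fS unfolding S_def pv L_def by metis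
  qed
qed

text \<open>The form refers to its own \<open>dvals\<close> and \<open>zariski\<close>, so the
  position of \<open>L\<close> and the finiteness of the index set are not known in advance. Both
  are recovered from primitivity and from the presence of a gap.\<close>

lemma zform_good:
  assumes \<psi>: "primitive \<psi>" "\<psi> = zform n m (dvals \<psi>) L b" "L = zariski \<psi>" "dvals \<psi> - vals \<psi> \<noteq> {}"
  obtains y Y where "\<psi> = par n y" "good y Y" "finite (zidx n (dvals \<psi>) L)" "m < L"
    "\<And>t. y t = t ^ m + t ^ L + (\<Sum>i\<in>zidx n (dvals \<psi>) L. b i * t ^ i)"
    "\<And>k. Y $ k = (if k = m then 1 else 0) + (if k = L then 1 else 0) + (if k \<in> zidx n (dvals \<psi>) L then b k else 0)"
proof -
  define S where "S = zidx n (dvals \<psi>) L"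
  \<comment> \<open>A sum over an infinite index set is 0 by convention; \<open>S'\<close> describes
    the coefficients correctly in either case until finiteness is proved.\<close>
  define S' where "S' = (if finite S then S else {})"
  define y where "y = (\<lambda>t. t ^ m + t ^ L + (\<Sum>i\<in>S. b i * t ^ i))"
  define Y where "Y = fps_X ^ m + fps_X ^ L + (\<Sum>i\<in>S. fps_const (b i) * fps_X ^ i)"
  have \<psi>y: "\<psi> = par n y" using \<psi>(2) unfolding zform_par y_def S_def .
  have y: "y has_fps_expansion Y" unfolding y_def Y_def
    by (intro has_fps_expansion_add X_pow_expansion expansion_sum_powers)
  have Yk: "Y $ k = (if k = m then 1 else 0) + (if k = L then 1 else 0) + (if k \<in> S' then b k else 0)" for k
    by (cases "finite S") (simp_all add: Y_def S'_def sum_powers_nth)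
  have S'L: "L < i" if "i \<in> S'" for i using that by (auto simp: S'_def S_def zidx_def split: if_splits)
  have "param \<psi>" using \<psi>(1) by (simp add: primitive_def)
  then have "y 0 = 0" unfolding \<psi>y by (simp add: param_def par_def)
  then have Y0: "Y $ 0 = 0" using has_fps_expansion_imp_0_eq_fps_nth_0[OF y] by simp
  then have L0: "0 < L" using Yk[of 0] S'L[of 0] nm by (auto split: if_splits)
  have vv: "vals \<psi> = valF n Y" "dvals \<psi> = dvalF n Y"
    unfolding \<psi>y using vals_par[OF nm(1) y Y0] dvals_par[OF nm(1) y Y0] by auto
  have mL: "m < L"
  proof (rule ccontr)
    assume mL: "\<not> m < L"
    \<comment> \<open>If \<open>L \<le> m\<close>, the second component has order \<open>L\<close>,
      so \<open>L\<close> and the least positive value \<open>gen0 \<psi>\<close> both lie in the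
      semigroup, and so does their sum. By the definition of \<open>zariski\<close> this sum is the
      first value outside.\<close>
    have "fps_X ^ L dvd Y" unfolding X_pow_dvd_iff using mL S'L by (fastforce simp: Yk)
    moreover have "Y $ L \<noteq> 0" using S'L[of L] by (auto simp: Yk)
    ultimately have "Sg n L \<subseteq> valF n Y" by (rule Sg_subset_valF)
    then have Lv: "L \<in> valF n Y" "n \<in> valF n Y" using Sg_base by blast+
    have "gen0 \<psi> \<in> valF n Y \<and> 0 < gen0 \<psi>" unfolding gen0_def vv
      by (rule LeastI[of "\<lambda>k. k \<in> valF n Y \<and> 0 < k" n]) (use Lv nm in auto)
    then have "L + gen0 \<psi> \<in> valF n Y" using valF_add Lv by blast
    moreover have "(LEAST l. l \<in> dvals \<psi> \<and> l \<notin> vals \<psi>) = L + gen0 \<psi>"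
      using \<psi>(3) L0 unfolding zariski_def by simp
    then have "L + gen0 \<psi> \<notin> valF n Y"
      using \<psi>(4) LeastI_ex[of "\<lambda>l. l \<in> dvals \<psi> \<and> l \<notin> vals \<psi>"] unfolding vv by auto
    ultimately show False by blast
  qed
  have good: "good y Y" unfolding good_def
  proof (intro conjI y)
    show "fps_X ^ m dvd Y" unfolding X_pow_dvd_iff using mL S'L by (fastforce simp: Yk)
    show "Y $ m = 1" using mL S'L[of m] by (auto simp: Yk)
  qed
  obtain N where "determined (par n y) N" using determined_exists[OF good] \<psi>(1) \<psi>y by blast
  then have "finite S" using zidx_finite[OF good] unfolding S_def vv by (meson finite_lessThan finite_subset)
  then have "S' = S" by (simp add: S'_def)
  then show ?thesis using that[OF \<psi>y good] \<open>finite S\<close> mL Yk by (simp add: S_def y_def)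
qed

text \<open>A homothety by the derivative \<open>r\<close> of the reparametrization leaves an
  equivalence between \<open>Y\<close> and \<open>X\<close> that is unipotent. If \<open>X\<close>
  and \<open>Y\<close> differed first at \<open>l\<close>, then \<open>l + n\<close> would be a
  value of a differential, so \<open>agree\<close> leaves only \<open>l = L\<close>; there
  \<open>unipotent_value\<close> would put \<open>L + n\<close> into \<open>Sg n m\<close>.\<close>

lemma normal_form_unique:
  assumes y: "good y Y" and z: "good z Z" and eq: "A_equiv (par n y) (par n z)"
    and L: "m < L" "fps_X ^ L dvd Y - fps_X ^ m" "L + n \<notin> Sg n m"
    and agree: "\<And>i. i \<noteq> m \<Longrightarrow> i \<noteq> L \<Longrightarrow> i + n \<in> dvalF n Y \<Longrightarrow> Y $ i = 0 \<and> Z $ i = 0"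
  obtains r where "r \<noteq> 0" "\<And>i. Y $ i = r ^ i / r ^ m * Z $ i"
proof -
  obtain R P Q c d where *: "R $ 0 = 0" "R $ 1 \<noteq> 0" "fps_X ^ n oo R = P" "Z oo R = Q"
    "\<And>N. fps_X ^ Suc N dvd P - pev c N (fps_X ^ n) Y" "\<And>N. fps_X ^ Suc N dvd Q - pev d N (fps_X ^ n) Y"
    using A_equiv_expansions[OF eq nm(1) nm(1) goodD(1,4)[OF y] goodD(1,4)[OF z]] by metis
  define r where "r = R $ 1"
  have r0: "r \<noteq> 0" using *(2) by (simp add: r_def)
  define rho where "rho = fps_const (inverse r) * R"
  define X where "X = fps_const (inverse (r ^ m)) * (Z oo (fps_const r * fps_X))"
  have Xk: "X $ i = r ^ i / r ^ m * Z $ i" for i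
    unfolding X_def fps_compose_linear by (simp add: field_simps)
  have Xm: "fps_X ^ m dvd X" "X $ m = 1"
    using goodD(2,3)[OF z] r0 by (auto simp: X_pow_dvd_iff Xk)
  have rho: "fps_X ^ 2 dvd rho - fps_X"
    unfolding X_pow_dvd_iff using r0 *(1) by (auto simp: rho_def r_def less_Suc_eq numeral_2_eq_2)
  have rho0: "rho $ 0 = 0" using *(1) by (simp add: rho_def)
  have "R ^ n = P" using *(3) fps_compose_power[OF *(1), of fps_X n] *(1) by simp
  then have rhoP: "rho ^ n = fps_const (inverse (r ^ n)) * P"
    by (simp add: rho_def power_mult_distrib power_inverse fps_const_power)
  have cR: "fps_const r * fps_X oo rho = R"
  proof -
    have "fps_const r * fps_X oo rho = fps_const r * rho"
      unfolding fps_compose_mult_distrib[OF rho0] using rho0 by simp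
    also have "\<dots> = R" using r0 by (simp add: rho_def flip: mult.assoc)
    finally show ?thesis .
  qed
  have as: "(Z oo (fps_const r * fps_X)) oo rho = Z oo (fps_const r * fps_X oo rho)"
    by (rule fps_compose_assoc[symmetric]) (use rho0 in auto)
  have "X oo rho = (fps_const (inverse (r ^ m)) oo rho) * ((Z oo (fps_const r * fps_X)) oo rho)"
    unfolding X_def by (rule fps_compose_mult_distrib[OF rho0])
  then have XQ: "X oo rho = fps_const (inverse (r ^ m)) * Q" unfolding as cR *(4) by simp
  have "X = Y"
  proof (rule ccontr)
    assume ne: "X \<noteq> Y"
    define l where "l = subdegree (X - Y)"
    \<comment> \<open>\<open>l + n\<close> is the precision that \<open>formal_uniqueness\<close>
      asks for; \<open>n + m\<close> leaves room for reading off the low weights.\<close>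
    define N where "N = max (l + n) (n + m)"
    define c' where "c' = (\<lambda>i j. inverse (r ^ n) * c i j)"
    define d' where "d' = (\<lambda>i j. inverse (r ^ m) * d i j)"
    define S1 where "S1 = pev c' N (fps_X ^ n) Y"
    define S2 where "S2 = pev d' N (fps_X ^ n) Y"
    have e1: "fps_X ^ Suc N dvd rho ^ n - S1"
      unfolding rhoP S1_def c'_def pev_cmult using dvd_mult[OF *(5), of N] by (simp add: right_diff_distrib del: power_Suc)
    have e2: "fps_X ^ Suc N dvd (X oo rho) - S2"
      unfolding XQ S2_def d'_def pev_cmult using dvd_mult[OF *(6), of N] by (simp add: right_diff_distrib del: power_Suc)
    have N1: "1 \<le> N" "n \<le> N" "m \<le> N" "n + m \<le> N" using nm by (auto simp: N_def)
    have t1: "fps_X ^ Suc n dvd rho ^ n - fps_X ^ n"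
      unfolding X_pow_dvd_iff
      using dvd_power_same[OF tangent_idD(3)[OF rho], of n] power_nth_lead[OF tangent_idD(3)[OF rho], of n] tangent_idD(2)[OF rho]
      by (auto simp: X_pow_dvd_iff less_Suc_eq)
    have t2: "fps_X ^ Suc m dvd (X oo rho) - Y"
      unfolding X_pow_dvd_iff
      using compose_dvd[OF Xm(1) tangent_idD(3)[OF rho]] compose_nth_lead[OF Xm(1) tangent_idD(3)[OF rho]]
        tangent_idD(2)[OF rho] Xm(2) goodD(2,3)[OF y]
      by (auto simp: X_pow_dvd_iff less_Suc_eq)
    \<comment> \<open>The identity is subtracted. What remains has order above \<open>n\<close>, and
      for \<open>v\<close> above \<open>m\<close>, along the curve, so by \<open>low_weights\<close>
      it raises weights.\<close>
    define u where "u = (\<lambda>i j. c' i j - single 1 0 1 i j)"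
    define v where "v = (\<lambda>i j. d' i j - single 0 1 1 i j)"
    have pu: "pev u N (fps_X ^ n) Y = S1 - fps_X ^ n"
      unfolding u_def pev_diff S1_def using N1 by (subst pev_single) auto
    have pv: "pev v N (fps_X ^ n) Y = S2 - Y"
      unfolding v_def pev_diff S2_def using N1 by (subst pev_single) auto
    have "fps_X ^ Suc n dvd (rho ^ n - fps_X ^ n) - (rho ^ n - S1)"
      by (rule dvd_diff[OF t1 X_pow_dvd_mono[OF e1]]) (use N1 in simp)
    then have "fps_X ^ Suc n dvd pev u N (fps_X ^ n) Y" unfolding pu by simp
    then have wu: "wts n m (n + 1) u" using low_weights[OF nm goodD(2,3)[OF y], of n u N] N1 by simp
    have "fps_X ^ Suc m dvd ((X oo rho) - Y) - ((X oo rho) - S2)"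
      by (rule dvd_diff[OF t2 X_pow_dvd_mono[OF e2]]) (use N1 in simp)
    then have "fps_X ^ Suc m dvd pev v N (fps_X ^ n) Y" unfolding pv by simp
    then have wv: "wts n m (m + 1) v" using low_weights[OF nm goodD(2,3)[OF y], of m v N] N1 by simp
    have J: "S1 - fps_X ^ n \<in> wspan n m (fps_X ^ n) Y (n + 1)" "S2 - Y \<in> wspan n m (fps_X ^ n) Y (m + 1)"
      unfolding pu[symmetric] pv[symmetric] by (rule wspan.Fil_pev[OF wu wspan_F wspan_G], rule wspan.Fil_pev[OF wv wspan_F wspan_G])
    have dd: "fps_X ^ (l + n) dvd rho ^ n - S1" "fps_X ^ (l + n) dvd (X oo rho) - S2"
      using e1 e2 by (auto elim: X_pow_dvd_mono simp: N_def simp del: power_Suc)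
    obtain M a b where W: "wts n m (n + 1) a" "wts n m (m + 1) b"
      "fps_X ^ (l + n - 1) dvd Wser n Y a b M" "Wser n Y a b M $ (l + n - 1) \<noteq> 0"
      using formal_uniqueness[OF goodD(2)[OF y] Xm(1) ne nm(1,2) J rho order.refl] dd unfolding l_def by metis
    have "l + n \<in> dvalF n Y" unfolding dvalF_def
      using subdegreeI'[OF W(3,4)] nm by (intro CollectI exI[of _ a] exI[of _ b] exI[of _ M]) auto
    moreover have nl: "X $ l \<noteq> Y $ l"
    proof -
      have "(X - Y) $ l \<noteq> 0" unfolding l_def using ne by (intro nth_subdegree_nonzero) simp
      then show ?thesis by simp
    qed
    moreover have "l \<noteq> m" using nl Xm goodD(3)[OF y] by auto
    moreover have "X $ l = 0" if "Z $ l = 0" using that by (simp add: Xk)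
    ultimately have "l = L" using agree[of l] by metis
    then have "L + n \<in> Sg n m" using unipotent_value[OF nm(1,2) L(2,1) W(1,2)] W(4) by simp
    then show False using L(3) by blast
  qed
  then have "Y $ i = r ^ i / r ^ m * Z $ i" for i using Xk by simp
  with r0 show ?thesis by (rule that)
qed

lemma powi_diff_eq: "r \<noteq> 0 \<Longrightarrow> r powi (int i - int k) = r ^ i / r ^ k" for r :: complex
  by (simp add: power_int_diff)

text \<open>At the exponent \<open>L\<close> both coefficients are 1, which is where the condition
  on \<open>r\<close> comes from. Conversely, the homothety with factors \<open>r ^ n\<close> and
  \<open>r ^ m\<close> realises the relation between the coefficients.\<close>

theorem normal_forms_equivalent_iff:
  assumes \<psi>: "primitive \<psi>" "primitive \<psi>'" and v: "vals \<psi> = vals \<psi>'" "dvals \<psi> = dvals \<psi>'" "dvals \<psi> - vals \<psi> \<noteq> {}"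
    and f: "\<psi> = zform n m (dvals \<psi>) (zariski \<psi>) b" "\<psi>' = zform n m (dvals \<psi>') (zariski \<psi>') b'"
  shows "A_equiv \<psi> \<psi>' \<longleftrightarrow> (\<exists>r::complex. r \<noteq> 0 \<and> r powi (int (zariski \<psi>) - int m) = 1 \<and>
     (\<forall>i\<in>zidx n (dvals \<psi>) (zariski \<psi>). b i = r powi (int i - int m) * b' i))"
proof -
  have za: "zariski \<psi>' = zariski \<psi>" by (simp add: zariski_def gen0_def v)
  define L where "L = zariski \<psi>"
  define S where "S = zidx n (dvals \<psi>) L"
  obtain y Y where y: "\<psi> = par n y" "good y Y" "finite S" "m < L"
    "\<And>t. y t = t ^ m + t ^ L + (\<Sum>i\<in>S. b i * t ^ i)"
    "\<And>k. Y $ k = (if k = m then 1 else 0) + (if k = L then 1 else 0) + (if k \<in> S then b k else 0)"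
    by (rule zform_good[OF \<psi>(1) f(1) refl v(3), folded L_def, folded S_def]) blast
  have ne': "dvals \<psi>' - vals \<psi>' \<noteq> {}" using v by simp
  obtain z Z where z: "\<psi>' = par n z" "good z Z" "finite S" "m < L"
    "\<And>t. z t = t ^ m + t ^ L + (\<Sum>i\<in>S. b' i * t ^ i)"
    "\<And>k. Z $ k = (if k = m then 1 else 0) + (if k = L then 1 else 0) + (if k \<in> S then b' k else 0)"
    by (rule zform_good[OF \<psi>(2) f(2) refl ne', unfolded za v(2)[symmetric], folded L_def, folded S_def]) blast
  have SL: "L < i" if "i \<in> S" for i using that by (simp add: S_def zidx_def)
  have dv: "dvals \<psi> = dvalF n Y" "vals \<psi> = valF n Y" using par_values[OF y(2)] y(1) by auto
  have LS: "L + n \<notin> Sg n m"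
  proof -
    have ne: "dvalF n Y - valF n Y \<noteq> {}" using v(3) dv by simp
    have "L = zariski (par n y)" by (simp add: L_def y(1))
    then have "L + n \<notin> valF n Y" by (rule zariski_invariant(3)[OF y(2) ne])
    then show ?thesis using Sg_subset_valF[OF goodD(2)[OF y(2)]] goodD(3)[OF y(2)] by auto
  qed
  have YL: "fps_X ^ L dvd Y - fps_X ^ m" unfolding X_pow_dvd_iff
  proof (intro allI impI)
    fix i assume "i < L"
    then show "(Y - fps_X ^ m) $ i = 0" using SL[of i] by (auto simp: y(6))
  qed
  show ?thesis
  proof
    assume "A_equiv \<psi> \<psi>'"
    then have eq: "A_equiv (par n y) (par n z)" using y(1) z(1) by simp
    have ag: "Y $ i = 0 \<and> Z $ i = 0" if "i \<noteq> m" "i \<noteq> L" "i + n \<in> dvalF n Y" for i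
      using that by (auto simp: y(6) z(6) S_def zidx_def dv)
    obtain r where r: "r \<noteq> 0" "\<And>i. Y $ i = r ^ i / r ^ m * Z $ i"
      using normal_form_unique[OF y(2) z(2) eq y(4) YL LS ag] by metis
    have "Y $ L = 1" "Z $ L = 1" using SL[of L] y(4) by (auto simp: y(6) z(6))
    then have "r powi (int L - int m) = 1" using r(2)[of L] powi_diff_eq[OF r(1), of L m] y(4) by simp
    moreover have "b i = r powi (int i - int m) * b' i" if i: "i \<in> S" for i
    proof -
      have "Y $ i = b i" "Z $ i = b' i" using SL[OF i] y(4) i by (auto simp: y(6) z(6))
      then show ?thesis using r(2)[of i] powi_diff_eq[OF r(1), of i m] SL[OF i] y(4) by simp
    qed
    ultimately show "\<exists>r::complex. r \<noteq> 0 \<and> r powi (int (zariski \<psi>) - int m) = 1 \<and>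
     (\<forall>i\<in>zidx n (dvals \<psi>) (zariski \<psi>). b i = r powi (int i - int m) * b' i)"
      using r(1) unfolding S_def L_def by blast
  next
    assume "\<exists>r::complex. r \<noteq> 0 \<and> r powi (int (zariski \<psi>) - int m) = 1 \<and>
     (\<forall>i\<in>zidx n (dvals \<psi>) (zariski \<psi>). b i = r powi (int i - int m) * b' i)"
    then obtain r :: complex where r: "r \<noteq> 0" "r powi (int L - int m) = 1" "\<And>i. i \<in> S \<Longrightarrow> b i = r powi (int i - int m) * b' i"
      unfolding S_def L_def by blast
    have rL: "r ^ L = r ^ m" using r(1,2) powi_diff_eq[OF r(1), of L m] y(4) by simp
    have rb: "r ^ m * b i = r ^ i * b' i" if "i \<in> S" for i
      using r(1) r(3)[OF that] powi_diff_eq[OF r(1), of i m] SL[OF that] y(4) by simp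
    have "z (r * t) = r ^ m * y t" for t
    proof -
      have "(\<Sum>i\<in>S. b' i * (r * t) ^ i) = (\<Sum>i\<in>S. r ^ m * (b i * t ^ i))"
      proof (intro sum.cong refl)
        fix i assume "i \<in> S"
        have "b' i * (r * t) ^ i = (r ^ i * b' i) * t ^ i" by (simp add: power_mult_distrib mult_ac)
        also have "\<dots> = r ^ m * (b i * t ^ i)" unfolding rb[OF \<open>i \<in> S\<close>, symmetric] by simp
        finally show "b' i * (r * t) ^ i = r ^ m * (b i * t ^ i)" .
      qed
      then show ?thesis unfolding y(5) z(5)
        by (simp add: power_mult_distrib rL distrib_left sum_distrib_left)
    qed
    then show "A_equiv \<psi> \<psi>'" unfolding y(1) z(1) by (rule A_equiv_scale[OF r(1)])
  qed
qed

end

theorem theorem2p1: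
  fixes \<phi> :: "complex \<Rightarrow> complex \<times> complex" and v0 v1 :: nat and a :: "nat \<Rightarrow> complex"
  assumes prim: "primitive \<phi>"
    and v: "0 < v0" "v0 < v1" "\<not> v0 dvd v1"
    and form: "\<forall>t. \<phi> t = (t ^ v0, t ^ v1 + (\<Sum>i\<in>{v1<..<conductor (vals \<phi>)}. a i * t ^ i))"
  shows "(A_equiv \<phi> (\<lambda>t. (t ^ v0, t ^ v1))
          \<or> (dvals \<phi> - vals \<phi> \<noteq> {} \<and> finite (zidx v0 (dvals \<phi>) (zariski \<phi>)) \<and>
             (\<exists>b. A_equiv \<phi> (zform v0 v1 (dvals \<phi>) (zariski \<phi>) b))))
       \<and> (\<forall>\<psi> \<psi>' w0 w1 b b'.
            0 < w0 \<and> w0 < w1 \<and> \<not> w0 dvd w1 \<and> primitive \<psi> \<and> primitive \<psi>'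
            \<and> vals \<psi> = vals \<psi>' \<and> dvals \<psi> = dvals \<psi>' \<and> dvals \<psi> - vals \<psi> \<noteq> {}
            \<and> \<psi> = zform w0 w1 (dvals \<psi>) (zariski \<psi>) b
            \<and> \<psi>' = zform w0 w1 (dvals \<psi>') (zariski \<psi>') b'
          \<longrightarrow> (A_equiv \<psi> \<psi>' \<longleftrightarrow>
               (\<exists>r::complex. r \<noteq> 0 \<and> r powi (int (zariski \<psi>) - int w1) = 1 \<and>
                  (\<forall>i\<in>zidx w0 (dvals \<psi>) (zariski \<psi>). b i = r powi (int i - int w1) * b' i))))"
proof (intro conjI allI impI)
  interpret branch v0 v1 by standard (use v in auto)
  define S where "S = {v1<..<conductor (vals \<phi>)}"
  define y where "y = (\<lambda>t. t ^ v1 + (\<Sum>i\<in>S. a i * t ^ i))"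
  define Y where "Y = fps_X ^ v1 + (\<Sum>i\<in>S. fps_const (a i) * fps_X ^ i)"
  have \<phi>: "\<phi> = par v0 y" using form by (simp add: fun_eq_iff par_def y_def S_def)
  have fS: "finite S" by (simp add: S_def)
  have Yk: "Y $ k = (if k = v1 then 1 else 0) + (if k \<in> S then a k else 0)" for k
    by (simp add: Y_def sum_powers_nth[OF fS])
  have "good y Y" unfolding good_def
  proof (intro conjI)
    show "y has_fps_expansion Y" unfolding y_def Y_def
      by (intro has_fps_expansion_add X_pow_expansion expansion_sum_powers)
  qed (auto simp: X_pow_dvd_iff Yk S_def)
  from normal_form_exists[OF this] prim
  show "A_equiv \<phi> (\<lambda>t. (t ^ v0, t ^ v1))
          \<or> (dvals \<phi> - vals \<phi> \<noteq> {} \<and> finite (zidx v0 (dvals \<phi>) (zariski \<phi>)) \<and>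
             (\<exists>b. A_equiv \<phi> (zform v0 v1 (dvals \<phi>) (zariski \<phi>) b)))"
    unfolding \<phi> by blast
next
  fix \<psi> \<psi>' :: "complex \<Rightarrow> complex \<times> complex" and w0 w1 :: nat and b b' :: "nat \<Rightarrow> complex"
  assume *: "0 < w0 \<and> w0 < w1 \<and> \<not> w0 dvd w1 \<and> primitive \<psi> \<and> primitive \<psi>'
            \<and> vals \<psi> = vals \<psi>' \<and> dvals \<psi> = dvals \<psi>' \<and> dvals \<psi> - vals \<psi> \<noteq> {}
            \<and> \<psi> = zform w0 w1 (dvals \<psi>) (zariski \<psi>) b
            \<and> \<psi>' = zform w0 w1 (dvals \<psi>') (zariski \<psi>') b'"
  then interpret branch w0 w1 by unfold_locales auto
  show "A_equiv \<psi> \<psi>' \<longleftrightarrow>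
               (\<exists>r::complex. r \<noteq> 0 \<and> r powi (int (zariski \<psi>) - int w1) = 1 \<and>
                  (\<forall>i\<in>zidx w0 (dvals \<psi>) (zariski \<psi>). b i = r powi (int i - int w1) * b' i))"
    by (rule normal_forms_equivalent_iff) (use * in blast)+
qed

end
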